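(* Let $f$ be a function and let $\hat c_n$ be the risk-based empirical Bayes estimator. Suppose, with $D_n^R=D_{1,n}^R+D_{2,n}^R$: 1. $\sup_{c\in I_n}\frac{|R_{1,n}^R(c,f)|+|R_{2,n}^R(c)|}{D_n^R(c,f)}\to0$ and $\sup_{c\in I_n}\frac{|R_{3,n}(c,f)|+|R_{4,n}(c)|}{D_n^R(c,f)}\to0$ in $P_f$-probability; 2. $D_{2,n}^R(c)\asymp s_n^2(c)$ uniformly in $c\in I_n$. Then for any sequence $M_n\to\infty$, $$\Pi_{\hat c_n}\Bigl(w:\|\vec w_n-\vec f_n\|^2\ge M_n\inf_{c\in I_n}\mathrm E_f\|\hat f_{n,c}-\vec f_n\|^2\,\Big|\,\vec Y_n\Bigr)\to0\quad\text{in }P_f\text{-probability}.$$ In particular, this is true if the polynomial, the product or the Sobolev-type eigenvalue condition (see context) holds.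
   Context: Setting. $\mathcal X$ is a set and for each $n$, $x_{1,n},\dots,x_{n,n}\in\mathcal X$ are known design points. For $f:\mathcal X\to\mathbb R$ write $\vec f_n=(f(x_{1,n}),\dots,f(x_{n,n}))^T$. Under $P_f$ (expectation $\mathrm E_f$) one observes $\vec Y_n=\vec f_n+\vec\varepsilon_n$ with $\vec\varepsilon_n\sim\mathcal N_n(0,I)$. $W^1$ is a mean-zero Gaussian process on $\mathcal X$; given $c>0$ the prior for $f$ is the law of $\sqrt c\,W^1$. $U_n$ is the covariance matrix of $(W^1_{x_{1,n}},\dots,W^1_{x_{n,n}})$, with orthonormal eigenbasis $e_{1,n},\dots,e_{n,n}$ and eigenvalues $\lambda_{1,n},\dots,\lambda_{n,n}$; $f_{j,n}=\vec f_n^Te_{j,n}$, $Z_{j,n}=\vec\varepsilon_n^Te_{j,n}$ (i.i.d. standard normal); $\Sigma_{n,c}=I+cU_n$. $\Pi_c(\cdot\mid\vec Y_n)$ denotes the posterior given $c$, under which $\vec w_n\sim\mathcal N_n(\hat f_{n,c},I-\Sigma_{n,c}^{-1})$ with $\hat f_{n,c}=(I-\Sigma_{n,c}^{-1})\vec Y_n$; $\Pi_{\hat c_n}(\cdot\mid\vec Y_n)$ is the same with $c$ replaced by $\hat c_n$. $I_n=[\log n/n,n^{m-1}]$ for a fixed constant $m\ge1$ (the exponent in the eigenvalue condition when one is assumed). Risk-based estimator: $\hat c_n=\operatorname{argmin}_{c\in I_n}[\operatorname{tr}((I-\Sigma_{n,c}^{-1})^2)-\operatorname{tr}(\Sigma_{n,c}^{-2})+\vec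 Y_n^T\Sigma_{n,c}^{-2}\vec Y_n]$. Functions: $D_{1,n}^R(c,f)=\sum_{j=1}^n\frac{f_{j,n}^2}{(1+c\lambda_{j,n})^2}$, $D_{2,n}^R(c)=\sum_{j=1}^n\frac{(c\lambda_{j,n})^2}{(1+c\lambda_{j,n})^2}$, $R_{1,n}^R(c,f)=2\sum_{j=1}^n\frac{Z_{j,n}f_{j,n}}{(1+c\lambda_{j,n})^2}$, $R_{2,n}^R(c)=\sum_{j=1}^n(Z_{j,n}^2-1)\bigl[\frac1{(1+c\lambda_{j,n})^2}-1\bigr]$, $R_{3,n}(c,f)=-2\sum_{j=1}^n\frac{c\lambda_{j,n}Z_{j,n}f_{j,n}}{(1+c\lambda_{j,n})^2}$, $R_{4,n}(c)=\sum_{j=1}^n\frac{(c\lambda_{j,n})^2(Z_{j,n}^2-1)}{(1+c\lambda_{j,n})^2}$, $s_n^2(c)=\sum_{j=1}^n\frac{c\lambda_{j,n}}{1+c\lambda_{j,n}}$. Eigenvalue conditions. Polynomial: $\underline\delta n/j^m\le\lambda_{j,n}\le\overline\delta n/j^m$ for all $n$, $1\le j\le n$, with constants $0<\underline\delta\le\overline\delta<\infty$, $m\ge1$. Product: there are $n^2$ design points, the eigenvalues are indexed by $(i,j)\in\{1,\dots,n\}^2$ and $\lambda_{i,j,n}\asymp n^2/(i^mj^m)$, uniformly in $i,j$ and $n$. Sobolev-type: same with $\lambda_{i,j,n}\asymp n^2/(i^2+j^2)^m$. In the last two cases $m\ge1$ and everywhere $n$ is replaced by $n^2$ (in particular $I_n$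 by $I_{n^2}$) and single sums by double sums. $a_n\asymp b_n$ uniformly means that $a_n/b_n$ is bounded away from $0$ and $\infty$ by the same constants over the domain, for large $n$.
   Formalization: The "in particular" claim is proved for eigenvalue exponent m > 1 instead of m ≥ 1; at m = 1 it is false (e.g. f = 0 and eigenvalues n/j, where the best risk is of order log n but the posterior spread is of order (log n)^2). *)

theory Defs
  imports "HOL-Probability.Probability" "Jordan_Normal_Form.Gauss_Jordan_Elimination"
begin

unbundle no inner_syntax
unbundle no vec_syntax

text \<open>Design points, errors, eigenvalues and eigenvectors carry indices \<open>1, \<dots>, N\<close>, whereas the
  coordinates of vectors and matrices are numbered from \<open>0\<close>; \<open>nvec\<close> performs the shift.\<close>

definition nvec :: "nat \<Rightarrow> (nat \<Rightarrow> real) \<Rightarrow> real Matrix.vec" where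
  "nvec N g = Matrix.vec N (\<lambda>i. g (Suc i))"

definition sqnorm :: "real Matrix.vec \<Rightarrow> real" where
  "sqnorm v = v \<bullet> v"

definition tr :: "real Matrix.mat \<Rightarrow> real" where
  "tr A = (\<Sum>i<dim_row A. A $$ (i, i))"

definition orthonormal_eigenbasis ::
    "nat \<Rightarrow> real Matrix.mat \<Rightarrow> (nat \<Rightarrow> real) \<Rightarrow> (nat \<Rightarrow> real Matrix.vec) \<Rightarrow> bool" where
  "orthonormal_eigenbasis N U lam e \<longleftrightarrow>
     (\<forall>j\<in>{1..N}. e j \<in> carrier_vec N \<and> U *\<^sub>v e j = lam j \<cdot>\<^sub>v e j) \<and>
     (\<forall>j\<in>{1..N}. \<forall>k\<in>{1..N}. e j \<bullet> e k = (if j = k then 1 else 0))"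

text \<open>A degenerate (constant) variable counts as Gaussian, so covariance matrices may be singular.\<close>

definition gaussian_rv :: "'v measure \<Rightarrow> ('v \<Rightarrow> real) \<Rightarrow> bool" where
  "gaussian_rv M X \<longleftrightarrow> X \<in> borel_measurable M \<and>
     (\<exists>\<mu> \<sigma>. \<sigma> \<ge> 0 \<and>
        distr M borel X = (if \<sigma> = 0 then return borel \<mu> else density lborel (normal_density \<mu> \<sigma>)))"

definition centered_gaussian_process :: "'v measure \<Rightarrow> ('x \<Rightarrow> 'v \<Rightarrow> real) \<Rightarrow> bool" where
  "centered_gaussian_process M W \<longleftrightarrow> prob_space M \<and>
     (\<forall>S a. finite S \<longrightarrow> gaussian_rv M (\<lambda>v. \<Sum>x\<in>S. a x * W x v)) \<and>
     (\<forall>x. (\<integral>v. W x v \<partial>M) = 0)"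

definition cov_mat :: "'v measure \<Rightarrow> ('x \<Rightarrow> 'v \<Rightarrow> real) \<Rightarrow> nat \<Rightarrow> (nat \<Rightarrow> 'x) \<Rightarrow> real Matrix.mat" where
  "cov_mat M W N x = Matrix.mat N N (\<lambda>(i, j). \<integral>v. W (x (Suc i)) v * W (x (Suc j)) v \<partial>M)"

definition prior :: "'v measure \<Rightarrow> ('x \<Rightarrow> 'v \<Rightarrow> real) \<Rightarrow> real \<Rightarrow> ('x \<Rightarrow> real) measure" where
  "prior M W c = distr M (Pi\<^sub>M UNIV (\<lambda>_. borel)) (\<lambda>v x. sqrt c * W x v)"

text \<open>The density at \<open>y\<close> of the normal distribution with mean \<open>(w(x\<^sub>1), \<dots>, w(x\<^sub>N))\<close> and
  identity covariance.\<close>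

definition likelihood :: "nat \<Rightarrow> (nat \<Rightarrow> 'x) \<Rightarrow> real Matrix.vec \<Rightarrow> ('x \<Rightarrow> real) \<Rightarrow> real" where
  "likelihood N x y w = (\<Prod>i<N. normal_density (w (x (Suc i))) 1 (vec_index y i))"

text \<open>The posterior is given by Bayes' formula. Under it \<open>(w(x\<^sub>1), \<dots>, w(x\<^sub>N))\<close> is
  normal with mean \<open>fhat\<close> and covariance \<open>I - (I + c U)\<^sup>-\<^sup>1\<close>.\<close>

definition posterior :: "'v measure \<Rightarrow> ('x \<Rightarrow> 'v \<Rightarrow> real) \<Rightarrow> nat \<Rightarrow> (nat \<Rightarrow> 'x) \<Rightarrow> real \<Rightarrow>
    real Matrix.vec \<Rightarrow> ('x \<Rightarrow> real) measure" where
  "posterior M W N x c y = density (prior M W c)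
     (\<lambda>w. ennreal (likelihood N x y w / (\<integral>w'. likelihood N x y w' \<partial>(prior M W c))))"

text \<open>For \<open>c \<ge> 0\<close> and a covariance matrix \<open>U\<close> the matrix \<open>I + c U\<close> is invertible, so \<open>mat_inverse\<close>
  does not return \<open>None\<close> below.\<close>

definition Sigma_inv :: "nat \<Rightarrow> real Matrix.mat \<Rightarrow> real \<Rightarrow> real Matrix.mat" where
  "Sigma_inv N U c = the (mat_inverse (1\<^sub>m N + c \<cdot>\<^sub>m U))"

definition fhat :: "nat \<Rightarrow> real Matrix.mat \<Rightarrow> real \<Rightarrow> real Matrix.vec \<Rightarrow> real Matrix.vec" where
  "fhat N U c y = (1\<^sub>m N - Sigma_inv N U c) *\<^sub>v y"

definition c_range :: "real \<Rightarrow> nat \<Rightarrow> real set" where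
  "c_range m N = {ln (real N) / real N .. real N powr (m - 1)}"

definition risk_criterion :: "nat \<Rightarrow> real Matrix.mat \<Rightarrow> real Matrix.vec \<Rightarrow> real \<Rightarrow> real" where
  "risk_criterion N U y c =
     tr ((1\<^sub>m N - Sigma_inv N U c) ^\<^sub>m 2) - tr (Sigma_inv N U c ^\<^sub>m 2)
     + y \<bullet> (Sigma_inv N U c ^\<^sub>m 2 *\<^sub>v y)"

text \<open>In the following functions \<open>lam\<close>, \<open>g\<close> and \<open>Z\<close> are the eigenvalues of \<open>U\<close> and the coordinates
  of the vectors \<open>f\<close> and \<open>\<epsilon>\<close> relative to the eigenbasis.\<close>

definition D1R :: "nat \<Rightarrow> (nat \<Rightarrow> real) \<Rightarrow> (nat \<Rightarrow> real) \<Rightarrow> real \<Rightarrow> real" where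
  "D1R N lam g c = (\<Sum>j=1..N. (g j)\<^sup>2 / (1 + c * lam j)\<^sup>2)"

definition D2R :: "nat \<Rightarrow> (nat \<Rightarrow> real) \<Rightarrow> real \<Rightarrow> real" where
  "D2R N lam c = (\<Sum>j=1..N. (c * lam j)\<^sup>2 / (1 + c * lam j)\<^sup>2)"

definition DR :: "nat \<Rightarrow> (nat \<Rightarrow> real) \<Rightarrow> (nat \<Rightarrow> real) \<Rightarrow> real \<Rightarrow> real" where
  "DR N lam g c = D1R N lam g c + D2R N lam c"

definition R1R :: "nat \<Rightarrow> (nat \<Rightarrow> real) \<Rightarrow> (nat \<Rightarrow> real) \<Rightarrow> (nat \<Rightarrow> real) \<Rightarrow> real \<Rightarrow> real" where
  "R1R N lam g Z c = 2 * (\<Sum>j=1..N. Z j * g j / (1 + c * lam j)\<^sup>2)"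

definition R2R :: "nat \<Rightarrow> (nat \<Rightarrow> real) \<Rightarrow> (nat \<Rightarrow> real) \<Rightarrow> real \<Rightarrow> real" where
  "R2R N lam Z c = (\<Sum>j=1..N. ((Z j)\<^sup>2 - 1) * (1 / (1 + c * lam j)\<^sup>2 - 1))"

definition R3 :: "nat \<Rightarrow> (nat \<Rightarrow> real) \<Rightarrow> (nat \<Rightarrow> real) \<Rightarrow> (nat \<Rightarrow> real) \<Rightarrow> real \<Rightarrow> real" where
  "R3 N lam g Z c = - 2 * (\<Sum>j=1..N. c * lam j * Z j * g j / (1 + c * lam j)\<^sup>2)"

definition R4 :: "nat \<Rightarrow> (nat \<Rightarrow> real) \<Rightarrow> (nat \<Rightarrow> real) \<Rightarrow> real \<Rightarrow> real" where
  "R4 N lam Z c = (\<Sum>j=1..N. (c * lam j)\<^sup>2 * ((Z j)\<^sup>2 - 1) / (1 + c * lam j)\<^sup>2)"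

definition s2 :: "nat \<Rightarrow> (nat \<Rightarrow> real) \<Rightarrow> real \<Rightarrow> real" where
  "s2 N lam c = (\<Sum>j=1..N. c * lam j / (1 + c * lam j))"

definition tendsto_zero_in_prob :: "(nat \<Rightarrow> 'w measure) \<Rightarrow> (nat \<Rightarrow> 'w \<Rightarrow> real) \<Rightarrow> bool" where
  "tendsto_zero_in_prob P X \<longleftrightarrow>
     (\<forall>\<epsilon>>0. (\<lambda>n. measure (P n) {\<omega> \<in> space (P n). \<bar>X n \<omega>\<bar> \<ge> \<epsilon>}) \<longlonglongrightarrow> 0)"

text \<open>As \<open>0 / 0 = 0\<close>, the lower bound forces both functions to be nonzero on the domain.\<close>

definition asymp_unif :: "(nat \<Rightarrow> 'b set) \<Rightarrow> (nat \<Rightarrow> 'b \<Rightarrow> real) \<Rightarrow> (nat \<Rightarrow> 'b \<Rightarrow> real) \<Rightarrow> bool" where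
  "asymp_unif S a b \<longleftrightarrow> (\<exists>A>0. \<exists>B. \<forall>\<^sub>F n in sequentially. \<forall>t\<in>S n. A \<le> a n t / b n t \<and> a n t / b n t \<le> B)"

definition polynomial_eigenvalues :: "real \<Rightarrow> (nat \<Rightarrow> nat \<Rightarrow> real) \<Rightarrow> bool" where
  "polynomial_eigenvalues m lam \<longleftrightarrow> (\<exists>dl du. 0 < dl \<and> dl \<le> du \<and>
     (\<forall>n. \<forall>j\<in>{1..n}. dl * real n / real j powr m \<le> lam n j \<and> lam n j \<le> du * real n / real j powr m))"

text \<open>With \<open>n\<^sup>2\<close> design points the eigenvalue of index \<open>(i, j)\<close> is listed at the row-major position
  \<open>(i - 1) n + j\<close>. As the eigenbasis may be enumerated in any order, this is only a labelling.\<close>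

definition grid :: "nat \<Rightarrow> (nat \<times> nat) set" where
  "grid n = {1..n} \<times> {1..n}"

definition grid_pos :: "nat \<Rightarrow> nat \<times> nat \<Rightarrow> nat" where
  "grid_pos n = (\<lambda>(i, j). (i - 1) * n + j)"

definition product_eigenvalues :: "real \<Rightarrow> (nat \<Rightarrow> nat \<Rightarrow> real) \<Rightarrow> bool" where
  "product_eigenvalues m lam \<longleftrightarrow> asymp_unif grid (\<lambda>n p. lam n (grid_pos n p))
     (\<lambda>n (i, j). (real n)\<^sup>2 / (real i powr m * real j powr m))"

definition sobolev_eigenvalues :: "real \<Rightarrow> (nat \<Rightarrow> nat \<Rightarrow> real) \<Rightarrow> bool" where
  "sobolev_eigenvalues m lam \<longleftrightarrow> asymp_unif grid (\<lambda>n p. lam n (grid_pos n p))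
     (\<lambda>n (i, j). (real n)\<^sup>2 / ((real i)\<^sup>2 + (real j)\<^sup>2) powr m)"

end

(* Proof idea. In the eigenbasis the risk criterion equals, up to a term free of c,
   D(c) + R1(c) + R2(c), where D = D1 + D2 is the risk of the posterior mean. When R1 and R2 are
   uniformly at most D / 2 together, the minimiser therefore has D within a factor 3 of the infimum.
   The posterior second moment of the error is at most 5 s^2 + 2 D1 + 2 |R2|, hence a multiple of D
   since s^2 = O(D2), and Markov's inequality concludes.
   No description of the posterior as a normal law is needed: quadratic exponential moments of the
   prior follow from one-dimensional characteristic functions, and they give the Laplace transform
   of the squared error under the posterior.
   In the three eigenvalue examples s^2 = O(D2) and D2 grows at least like (cN)^(1/(2m)). Chebyshev's
   inequality along a geometric grid of values of c thus leaves a convergent geometric series of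
   order (log N)^(-1/(2m)), and between grid points the remainders change by a small multiple of D. *)

theory Submission
  imports Defs "Jordan_Normal_Form.Determinant"
begin

section \<open>Spectral calculus in the eigenbasis\<close>

text \<open>Gaussianity of the process is given only for finite linear combinations, so
  characteristic functions are the natural access to its joint law. Markov's inequality is applied
  to the bounded variable \<open>1 - exp (- S / s)\<close> rather than to the squared error
  \<open>S\<close> itself. The argument works with the fixed bound \<open>D / 2\<close> for the
  remainders. Hence the ratio of the grid can stay fixed, depending only on the constant in
  \<open>s2 \<le> C * D2R\<close>; the left endpoint of the range, where \<open>c N = ln N\<close>,
  makes the union bound vanish in the limit. The exponent \<open>m > 1\<close> in the examples makes
  the series of \<open>j powr (- m)\<close> converge. At \<open>m = 1\<close>, already in the
  polynomial case, \<open>s2\<close> exceeds \<open>D2R\<close> by a factor of order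
  \<open>ln N\<close> at the left endpoint. Measurability shapes the final proof:
  \<open>measure\<close> is 0 on non-measurable sets, so an assumed convergence in probability of a
  supremum over uncountably many \<open>c\<close> carries information only once this supremum is
  known to be measurable. The conclusion is then derived by inclusion in a measurable exceptional
  set of small probability.\<close>

lemma sum_rotate:
  fixes h :: "'a \<Rightarrow> 'b \<Rightarrow> 'c \<Rightarrow> 'd :: comm_monoid_add"
  shows "(\<Sum>i\<in>A. \<Sum>k\<in>B. \<Sum>j\<in>C. h i k j) = (\<Sum>j\<in>C. \<Sum>i\<in>A. \<Sum>k\<in>B. h i k j)"
proof -
  have "(\<Sum>i\<in>A. \<Sum>k\<in>B. \<Sum>j\<in>C. h i k j) = (\<Sum>i\<in>A. \<Sum>j\<in>C. \<Sum>k\<in>B. h i k j)"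
    by (rule sum.cong[OF refl], rule sum.swap)
  also have "\<dots> = (\<Sum>j\<in>C. \<Sum>i\<in>A. \<Sum>k\<in>B. h i k j)" by (rule sum.swap)
  finally show ?thesis .
qed

text \<open>A right inverse of a square matrix is also a left inverse: with the eigenvectors as
  rows, orthonormal rows force orthonormal columns. This is the resolution of the identity behind
  the whole section.\<close>

lemma eigenbasis_complete:
  assumes "orthonormal_eigenbasis N U lam e" "i < N" "k < N"
  shows "(\<Sum>j=1..N. e j $ i * e j $ k) = (if i = k then 1 else 0)"
proof -
  define E where "E = Matrix.mat N N (\<lambda>(j, i). e (Suc j) $ i)"
  have E: "E \<in> carrier_mat N N" by (simp add: E_def)
  have e: "e (Suc j) \<in> carrier_vec N" if "j < N" for j
    using assms(1) that by (simp add: orthonormal_eigenbasis_def)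
  have on: "e (Suc j) \<bullet> e (Suc l) = (if j = l then 1 else 0)" if "j < N" "l < N" for j l
    using assms(1) that by (simp add: orthonormal_eigenbasis_def)
  have row: "Matrix.row E j = e (Suc j)" if "j < N" for j
    using e[OF that] that by (intro eq_vecI) (auto simp: E_def)
  have "E * transpose_mat E = 1\<^sub>m N"
    using E by (intro eq_matI) (auto simp: row on)
  then have "transpose_mat E * E = 1\<^sub>m N"
    using E by (intro mat_mult_left_right_inverse[of E N "transpose_mat E"]) auto
  then have "(transpose_mat E * E) $$ (i, k) = (1\<^sub>m N) $$ (i, k)" by simp
  then have "(\<Sum>j<N. e (Suc j) $ i * e (Suc j) $ k) = (if i = k then 1 else 0)"
    using assms(2,3) by (simp add: E_def scalar_prod_def lessThan_atLeast0)
  then show ?thesis by (simp add: sum.atLeast1_atMost_eq)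
qed

lemma eigenbasis_parseval:
  assumes "orthonormal_eigenbasis N U lam e" "v \<in> carrier_vec N" "w \<in> carrier_vec N"
  shows "v \<bullet> w = (\<Sum>j=1..N. (v \<bullet> e j) * (w \<bullet> e j))"
proof -
  have e: "dim_vec (e j) = N" if "j \<in> {1..N}" for j
    using assms(1) that by (auto simp: orthonormal_eigenbasis_def)
  have "(\<Sum>j=1..N. (v \<bullet> e j) * (w \<bullet> e j))
      = (\<Sum>j=1..N. \<Sum>i<N. \<Sum>k<N. (v $ i * w $ k) * (e j $ i * e j $ k))"
    by (intro sum.cong) (auto simp: scalar_prod_def e sum_product lessThan_atLeast0 mult_ac)
  also have "\<dots> = (\<Sum>i<N. \<Sum>k<N. \<Sum>j=1..N. (v $ i * w $ k) * (e j $ i * e j $ k))"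
    by (rule sum_rotate[symmetric])
  also have "\<dots> = (\<Sum>i<N. \<Sum>k<N. (v $ i * w $ k) * (if i = k then 1 else 0))"
    by (intro sum.cong refl)
       (simp only: sum_distrib_left[symmetric], subst eigenbasis_complete[OF assms(1)], auto)
  also have "\<dots> = (\<Sum>i<N. v $ i * w $ i)"
    by (simp add: if_distrib sum.delta cong: if_cong)
  finally show ?thesis using assms(3) by (auto simp: scalar_prod_def lessThan_atLeast0)
qed

text \<open>The functional calculus: for orthonormal \<open>e\<close> this is the sum of
  \<open>d j\<close> times the projection on \<open>e j\<close>. Sums, products, inverses and traces
  of such matrices become operations on the coefficients \<open>d\<close>.\<close>

definition spec :: "nat \<Rightarrow> (nat \<Rightarrow> real Matrix.vec) \<Rightarrow> (nat \<Rightarrow> real) \<Rightarrow> real Matrix.mat" where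
  "spec N e d = Matrix.mat N N (\<lambda>(i, k). \<Sum>j=1..N. d j * (e j $ i * e j $ k))"

lemma spec_carrier [simp]: "spec N e d \<in> carrier_mat N N" "dim_row (spec N e d) = N"
    "dim_col (spec N e d) = N"
  by (auto simp: spec_def)

lemma spec_add: "spec N e d + spec N e d' = spec N e (\<lambda>j. d j + d' j)"
  by (intro eq_matI) (auto simp: spec_def sum.distrib[symmetric] algebra_simps)

lemma spec_diff: "spec N e d - spec N e d' = spec N e (\<lambda>j. d j - d' j)"
  by (intro eq_matI) (auto simp: spec_def sum_subtractf[symmetric] algebra_simps)

lemma spec_smult: "c \<cdot>\<^sub>m spec N e d = spec N e (\<lambda>j. c * d j)"
  by (intro eq_matI) (auto simp: spec_def sum_distrib_left mult_ac)

lemma spec_one: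
  assumes "orthonormal_eigenbasis N U lam e"
  shows "1\<^sub>m N = spec N e (\<lambda>_. 1)"
  by (intro eq_matI) (use eigenbasis_complete[OF assms] in \<open>auto simp: spec_def\<close>)

text \<open>Multiplying \<open>U\<close> by the resolution of the identity and using that
  \<open>U\<close> scales \<open>e j\<close> by \<open>lam j\<close> recovers \<open>U\<close> from
  its eigenpairs.\<close>

lemma spec_eigen:
  assumes "orthonormal_eigenbasis N U lam e" "U \<in> carrier_mat N N"
  shows "U = spec N e lam"
proof -
  have U: "(\<Sum>l<N. U $$ (i, l) * e j $ l) = lam j * e j $ i" if "j \<in> {1..N}" "i < N" for i j
  proof -
    have "(U *\<^sub>v e j) $ i = (lam j \<cdot>\<^sub>v e j) $ i" "dim_vec (e j) = N"
      using assms(1) that by (auto simp: orthonormal_eigenbasis_def)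
    then show ?thesis using assms(2) that by (auto simp: scalar_prod_def lessThan_atLeast0)
  qed
  show ?thesis
  proof (intro eq_matI)
    fix i k assume "i < dim_row (spec N e lam)" "k < dim_col (spec N e lam)"
    then have ik: "i < N" "k < N" by auto
    have "U $$ (i, k) = (\<Sum>l<N. U $$ (i, l) * (if l = k then 1 else 0))"
      using ik by (simp add: if_distrib cong: if_cong)
    also have "\<dots> = (\<Sum>l<N. U $$ (i, l) * (\<Sum>j=1..N. e j $ l * e j $ k))"
      by (intro sum.cong refl, subst eigenbasis_complete[OF assms(1)]) (use ik in auto)
    also have "\<dots> = (\<Sum>j=1..N. (\<Sum>l<N. U $$ (i, l) * e j $ l) * e j $ k)"
      by (simp add: sum_distrib_left sum_distrib_right mult_ac) (rule sum.swap)
    also have "\<dots> = (\<Sum>j=1..N. lam j * (e j $ i * e j $ k))"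
      by (intro sum.cong refl) (subst U, use ik in auto)
    finally show "U $$ (i, k) = spec N e lam $$ (i, k)" using ik by (simp add: spec_def)
  qed (use assms(2) in auto)
qed

lemma spec_mult:
  assumes "orthonormal_eigenbasis N U lam e"
  shows "spec N e d * spec N e d' = spec N e (\<lambda>j. d j * d' j)"
proof (intro eq_matI)
  fix i k assume "i < dim_row (spec N e (\<lambda>j. d j * d' j))" "k < dim_col (spec N e (\<lambda>j. d j * d' j))"
  then have ik: "i < N" "k < N" by auto
  have on: "(\<Sum>l<N. e j $ l * e p $ l) = (if j = p then 1 else 0)"
    if "j \<in> {1..N}" "p \<in> {1..N}" for j p
  proof -
    have "e j \<bullet> e p = (if j = p then 1 else 0)" "dim_vec (e p) = N"
      using assms that by (auto simp: orthonormal_eigenbasis_def)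
    then show ?thesis by (simp add: scalar_prod_def lessThan_atLeast0)
  qed
  have "(spec N e d * spec N e d') $$ (i, k)
      = (\<Sum>l<N. (\<Sum>j=1..N. d j * (e j $ i * e j $ l)) * (\<Sum>p=1..N. d' p * (e p $ l * e p $ k)))"
    using ik by (simp add: spec_def scalar_prod_def lessThan_atLeast0)
  also have "\<dots> = (\<Sum>l<N. \<Sum>j=1..N. \<Sum>p=1..N. d j * d' p * e j $ i * e p $ k * (e j $ l * e p $ l))"
    by (simp add: sum_product mult_ac)
  also have "\<dots> = (\<Sum>j=1..N. \<Sum>p=1..N. \<Sum>l<N. d j * d' p * e j $ i * e p $ k * (e j $ l * e p $ l))"
    by (rule sum_rotate[symmetric])
  also have "\<dots> = (\<Sum>j=1..N. \<Sum>p=1..N. d j * d' p * e j $ i * e p $ k * (if j = p then 1 else 0))"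
    by (intro sum.cong refl) (simp only: sum_distrib_left[symmetric], subst on, auto)
  also have "\<dots> = (\<Sum>j=1..N. d j * d' j * (e j $ i * e j $ k))"
    by (simp add: if_distrib sum.delta mult.assoc cong: if_cong)
  finally show "(spec N e d * spec N e d') $$ (i, k) = spec N e (\<lambda>j. d j * d' j) $$ (i, k)"
    using ik by (simp add: spec_def)
qed auto

lemma tr_spec:
  assumes "orthonormal_eigenbasis N U lam e"
  shows "tr (spec N e d) = (\<Sum>j=1..N. d j)"
proof -
  have on: "(\<Sum>l<N. e j $ l * e j $ l) = 1" if "j \<in> {1..N}" for j
  proof -
    have "e j \<bullet> e j = 1" "dim_vec (e j) = N"
      using assms that by (auto simp: orthonormal_eigenbasis_def)
    then show ?thesis by (simp add: scalar_prod_def lessThan_atLeast0)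
  qed
  have "tr (spec N e d) = (\<Sum>l<N. \<Sum>j=1..N. d j * (e j $ l * e j $ l))"
    by (simp add: tr_def spec_def)
  also have "\<dots> = (\<Sum>j=1..N. d j * (\<Sum>l<N. e j $ l * e j $ l))"
    by (subst sum.swap) (simp add: sum_distrib_left)
  also have "\<dots> = (\<Sum>j=1..N. d j)" by (intro sum.cong refl) (subst on, auto)
  finally show ?thesis .
qed

lemma spec_mult_vec:
  assumes "orthonormal_eigenbasis N U lam e" "v \<in> carrier_vec N" "w \<in> carrier_vec N"
  shows "w \<bullet> (spec N e d *\<^sub>v v) = (\<Sum>j=1..N. d j * (w \<bullet> e j) * (v \<bullet> e j))"
proof -
  have e: "dim_vec (e j) = N" if "j \<in> {1..N}" for j
    using assms(1) that by (auto simp: orthonormal_eigenbasis_def)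
  have "w \<bullet> (spec N e d *\<^sub>v v)
      = (\<Sum>i<N. w $ i * (\<Sum>k<N. (\<Sum>j=1..N. d j * (e j $ i * e j $ k)) * v $ k))"
    using assms by (auto simp: scalar_prod_def spec_def lessThan_atLeast0 intro!: sum.cong)
  also have "\<dots> = (\<Sum>i<N. \<Sum>k<N. \<Sum>j=1..N. d j * (w $ i * e j $ i) * (v $ k * e j $ k))"
    by (simp add: sum_distrib_left sum_distrib_right mult_ac)
  also have "\<dots> = (\<Sum>j=1..N. \<Sum>i<N. \<Sum>k<N. d j * (w $ i * e j $ i) * (v $ k * e j $ k))"
    by (rule sum_rotate)
  also have "\<dots> = (\<Sum>j=1..N. d j * (\<Sum>i<N. w $ i * e j $ i) * (\<Sum>k<N. v $ k * e j $ k))"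
    by (simp add: sum_distrib_left sum_distrib_right mult_ac)
  also have "\<dots> = (\<Sum>j=1..N. d j * (w \<bullet> e j) * (v \<bullet> e j))"
    by (intro sum.cong refl) (simp add: scalar_prod_def e lessThan_atLeast0)
  finally show ?thesis .
qed

lemma spec_mult_vec_eigen:
  assumes "orthonormal_eigenbasis N U lam e" "v \<in> carrier_vec N" "k \<in> {1..N}"
  shows "(spec N e d *\<^sub>v v) \<bullet> e k = d k * (v \<bullet> e k)"
proof -
  have ek: "e k \<in> carrier_vec N" using assms(1,3) by (auto simp: orthonormal_eigenbasis_def)
  have "(spec N e d *\<^sub>v v) \<bullet> e k = e k \<bullet> (spec N e d *\<^sub>v v)"
    using ek assms(2) by (intro comm_scalar_prod[of _ N]) (auto intro!: mult_mat_vec_carrier)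
  also have "\<dots> = (\<Sum>j=1..N. d j * (e k \<bullet> e j) * (v \<bullet> e j))"
    by (rule spec_mult_vec[OF assms(1,2) ek])
  also have "\<dots> = (\<Sum>j=1..N. d j * (if k = j then 1 else 0) * (v \<bullet> e j))"
    using assms(1,3) by (intro sum.cong refl) (auto simp: orthonormal_eigenbasis_def)
  also have "\<dots> = d k * (v \<bullet> e k)"
    using assms(3) by (simp add: if_distrib if_distribR cong: if_cong)
  finally show ?thesis .
qed

text \<open>The candidate inverse is exhibited in the eigenbasis. It makes \<open>1 + c U\<close> a
  unit of the matrix ring, so \<open>mat_inverse\<close> returns some matrix, which uniqueness of
  inverses identifies with the candidate.\<close>

lemma Sigma_inv_spec:
  assumes ob: "orthonormal_eigenbasis N U lam e" and U: "U \<in> carrier_mat N N"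
    and nz: "\<And>j. j \<in> {1..N} \<Longrightarrow> 1 + c * lam j \<noteq> 0"
  shows "Sigma_inv N U c = spec N e (\<lambda>j. 1 / (1 + c * lam j))"
proof -
  let ?A = "1\<^sub>m N + c \<cdot>\<^sub>m U" and ?S = "spec N e (\<lambda>j. 1 / (1 + c * lam j))"
  have A: "?A = spec N e (\<lambda>j. 1 + c * lam j)"
    by (simp add: spec_one[OF ob] spec_eigen[OF ob U] spec_smult spec_add)
  have one: "spec N e d = 1\<^sub>m N" if "\<And>j. j \<in> {1..N} \<Longrightarrow> d j = 1" for d
    unfolding spec_one[OF ob] spec_def using that by simp
  have AS: "?A * ?S = 1\<^sub>m N" "?S * ?A = 1\<^sub>m N"
    unfolding A spec_mult[OF ob] by (rule one, use nz in auto)+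
  have Ac: "?A \<in> carrier_mat N N" unfolding A by simp
  have "?A \<in> Units (ring_mat TYPE(real) N ())"
    using AS Ac unfolding Units_def by (auto simp: ring_mat_simps intro!: bexI[of _ ?S])
  then obtain B where B: "mat_inverse ?A = Some B"
    using mat_inverse(1)[OF Ac] by fastforce
  from mat_inverse(2)[OF Ac B] have "B * ?A = 1\<^sub>m N" "B \<in> carrier_mat N N" by auto
  then have "B = B * (?A * ?S)" "B * ?A * ?S = ?S" using AS by simp_all
  then have "B = ?S" using Ac \<open>B \<in> _\<close> by (metis assoc_mult_mat spec_carrier(1))
  then show ?thesis using B by (simp add: Sigma_inv_def)
qed

text \<open>With \<open>r = 1 / (1 + c * lam j)\<close> coordinate \<open>j\<close> contributes
  \<open>(1 - r)\<^sup>2 - r\<^sup>2 + r\<^sup>2 * (g + z)\<^sup>2\<close>. Expanding the square and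
  writing \<open>r\<^sup>2 * (z\<^sup>2 - 1)\<close> as
  \<open>(z\<^sup>2 - 1) * (r\<^sup>2 - 1) + (z\<^sup>2 - 1)\<close> isolates the last sum, which is
  free of \<open>c\<close> and cancels when two values of the criterion are compared.\<close>

lemma risk_criterion_eigen:
  assumes ob: "orthonormal_eigenbasis N U lam e" and U: "U \<in> carrier_mat N N"
    and nz: "\<And>j. j \<in> {1..N} \<Longrightarrow> 1 + c * lam j \<noteq> 0"
    and v: "fv \<in> carrier_vec N" "z \<in> carrier_vec N"
  shows "risk_criterion N U (fv + z) c =
    DR N lam (\<lambda>j. fv \<bullet> e j) c + R1R N lam (\<lambda>j. fv \<bullet> e j) (\<lambda>j. z \<bullet> e j) c
      + R2R N lam (\<lambda>j. z \<bullet> e j) c + (\<Sum>j=1..N. (z \<bullet> e j)\<^sup>2 - 1)"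
proof -
  let ?r = "\<lambda>j. 1 / (1 + c * lam j)"
  have sq: "spec N e d ^\<^sub>m 2 = spec N e (\<lambda>j. d j * d j)" for d
    by (simp add: numeral_2_eq_2 spec_mult[OF ob])
  have ev: "e j \<in> carrier_vec N" if "j \<in> {1..N}" for j
    using ob that by (auto simp: orthonormal_eigenbasis_def)
  have S: "Sigma_inv N U c = spec N e ?r" by (rule Sigma_inv_spec[OF ob U nz])
  have "risk_criterion N U (fv + z) c
      = (\<Sum>j=1..N. (1 - ?r j) * (1 - ?r j)) - (\<Sum>j=1..N. ?r j * ?r j)
        + (\<Sum>j=1..N. ?r j * ?r j * ((fv + z) \<bullet> e j) * ((fv + z) \<bullet> e j))"
    using v unfolding risk_criterion_def S
    by (subst spec_one[OF ob]) (simp only: spec_diff sq tr_spec[OF ob], subst spec_mult_vec[OF ob], auto)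
  also have "\<dots> = (\<Sum>j=1..N. (1 - ?r j) * (1 - ?r j) - ?r j * ?r j + ?r j * ?r j * (fv \<bullet> e j + z \<bullet> e j)\<^sup>2)"
    unfolding sum.distrib sum_subtractf
    by (simp add: power2_eq_square, intro sum.cong refl)
       (use v ev in \<open>simp add: add_scalar_prod_distrib[of _ N]\<close>)
  also have "\<dots> = (\<Sum>j=1..N. ((fv \<bullet> e j)\<^sup>2 / (1 + c * lam j)\<^sup>2 + (c * lam j)\<^sup>2 / (1 + c * lam j)\<^sup>2)
       + 2 * ((z \<bullet> e j) * (fv \<bullet> e j) / (1 + c * lam j)\<^sup>2)
       + ((z \<bullet> e j)\<^sup>2 - 1) * (1 / (1 + c * lam j)\<^sup>2 - 1) + ((z \<bullet> e j)\<^sup>2 - 1))"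
  proof (intro sum.cong refl)
    fix j assume "j \<in> {1..N}"
    note nz[OF this]
    define r where "r = ?r j"
    have t: "c * lam j / (1 + c * lam j) = 1 - r" using \<open>1 + c * lam j \<noteq> 0\<close> by (simp add: r_def field_simps)
    have rr: "(fv \<bullet> e j)\<^sup>2 / (1 + c * lam j)\<^sup>2 = (fv \<bullet> e j)\<^sup>2 * r\<^sup>2" "1 / (1 + c * lam j)\<^sup>2 = r\<^sup>2"
      "(z \<bullet> e j) * (fv \<bullet> e j) / (1 + c * lam j)\<^sup>2 = (z \<bullet> e j) * (fv \<bullet> e j) * r\<^sup>2"
      by (simp_all add: r_def power_divide)
    have tt: "(c * lam j)\<^sup>2 / (1 + c * lam j)\<^sup>2 = (1 - r)\<^sup>2" by (simp add: t[symmetric] power_divide)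
    show "(1 - ?r j) * (1 - ?r j) - ?r j * ?r j + ?r j * ?r j * (fv \<bullet> e j + z \<bullet> e j)\<^sup>2 =
       ((fv \<bullet> e j)\<^sup>2 / (1 + c * lam j)\<^sup>2 + (c * lam j)\<^sup>2 / (1 + c * lam j)\<^sup>2)
       + 2 * ((z \<bullet> e j) * (fv \<bullet> e j) / (1 + c * lam j)\<^sup>2)
       + ((z \<bullet> e j)\<^sup>2 - 1) * (1 / (1 + c * lam j)\<^sup>2 - 1) + ((z \<bullet> e j)\<^sup>2 - 1)"
      unfolding tt rr r_def[symmetric] by (simp add: power2_eq_square algebra_simps)
  qed
  also have "\<dots> = DR N lam (\<lambda>j. fv \<bullet> e j) c + R1R N lam (\<lambda>j. fv \<bullet> e j) (\<lambda>j. z \<bullet> e j) c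
      + R2R N lam (\<lambda>j. z \<bullet> e j) c + (\<Sum>j=1..N. (z \<bullet> e j)\<^sup>2 - 1)"
    unfolding DR_def D1R_def D2R_def R1R_def R2R_def by (simp add: sum.distrib sum_distrib_left)
  finally show ?thesis .
qed

lemma fhat_eigen:
  assumes ob: "orthonormal_eigenbasis N U lam e" and U: "U \<in> carrier_mat N N"
    and nz: "\<And>j. j \<in> {1..N} \<Longrightarrow> 1 + c * lam j \<noteq> 0"
    and v: "fv \<in> carrier_vec N" "z \<in> carrier_vec N"
  shows "sqnorm (fhat N U c (fv + z) - fv)
    = (\<Sum>j=1..N. (c * lam j / (1 + c * lam j) * (fv \<bullet> e j + z \<bullet> e j) - fv \<bullet> e j)\<^sup>2)"
proof -
  have ev: "e j \<in> carrier_vec N" if "j \<in> {1..N}" for j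
    using ob that by (auto simp: orthonormal_eigenbasis_def)
  have fh: "fhat N U c (fv + z) = spec N e (\<lambda>j. 1 - 1 / (1 + c * lam j)) *\<^sub>v (fv + z)"
    unfolding fhat_def by (subst Sigma_inv_spec[OF ob U nz]) (auto simp: spec_one[OF ob] spec_diff)
  have fc: "fhat N U c (fv + z) \<in> carrier_vec N"
    unfolding fh using v by (auto intro!: mult_mat_vec_carrier)
  have "sqnorm (fhat N U c (fv + z) - fv) = (\<Sum>j=1..N. ((fhat N U c (fv + z) - fv) \<bullet> e j)\<^sup>2)"
    unfolding sqnorm_def power2_eq_square using fc v by (intro eigenbasis_parseval[OF ob]) auto
  also have "\<dots> = (\<Sum>j=1..N. (c * lam j / (1 + c * lam j) * (fv \<bullet> e j + z \<bullet> e j) - fv \<bullet> e j)\<^sup>2)"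
  proof (intro sum.cong refl)
    fix j assume j: "j \<in> {1..N}"
    have "(fhat N U c (fv + z) - fv) \<bullet> e j = fhat N U c (fv + z) \<bullet> e j - fv \<bullet> e j"
      using fc v ev[OF j] by (intro minus_scalar_prod_distrib) auto
    also have "fhat N U c (fv + z) \<bullet> e j = (1 - 1 / (1 + c * lam j)) * ((fv + z) \<bullet> e j)"
      unfolding fh by (rule spec_mult_vec_eigen[OF ob _ j]) (use v in auto)
    also have "1 - 1 / (1 + c * lam j) = c * lam j / (1 + c * lam j)"
      using nz[OF j] by (simp add: field_simps)
    also have "(fv + z) \<bullet> e j = fv \<bullet> e j + z \<bullet> e j"
      using v ev[OF j] by (intro add_scalar_prod_distrib) auto
    finally show "((fhat N U c (fv + z) - fv) \<bullet> e j)\<^sup>2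
       = (c * lam j / (1 + c * lam j) * (fv \<bullet> e j + z \<bullet> e j) - fv \<bullet> e j)\<^sup>2" by simp
  qed
  finally show ?thesis .
qed

section \<open>Quadratic exponential moments of Gaussian variables\<close>

text \<open>The weight turns the standard normal density into a multiple of the normal density with
  variance \<open>1 / (1 + s)\<close>. Rescaling by \<open>q\<close> leaves the standard normal
  characteristic function at \<open>t * q\<close>. The case \<open>s = 0\<close> serves to linearise
  a square, \<open>s = a * tau k\<close> to integrate the auxiliary variable out again.\<close>

lemma gaussian_smoothing_integral:
  fixes s :: real
  assumes "s \<ge> 0"
  shows "(\<integral>z. of_real (exp (- s * z\<^sup>2 / 2)) * iexp (t * z) \<partial>std_normal_distribution)
    = of_real (exp (- t\<^sup>2 / (2 * (1 + s))) / sqrt (1 + s))"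
proof -
  define q where "q = 1 / sqrt (1 + s)"
  have q: "q > 0" "q\<^sup>2 * (1 + s) = 1" using assms by (auto simp: q_def power_divide)
  have "(\<integral>z. of_real (exp (- s * z\<^sup>2 / 2)) * iexp (t * z) \<partial>std_normal_distribution)
     = (\<integral>z. std_normal_density z *\<^sub>R (of_real (exp (- s * z\<^sup>2 / 2)) * iexp (t * z)) \<partial>lborel)"
    by (subst integral_density) (auto simp: normal_density_nonneg)
  also have "\<dots> = q *\<^sub>R (\<integral>z. std_normal_density (0 + q * z) *\<^sub>R (of_real (exp (- s * (0 + q * z)\<^sup>2 / 2)) * iexp (t * (0 + q * z))) \<partial>lborel)"
    by (subst lborel_integral_real_affine[where c = q and t = 0]) (use q in auto)
  also have "\<dots> = q *\<^sub>R (\<integral>z. std_normal_density z *\<^sub>R iexp ((t * q) * z) \<partial>lborel)"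
  proof (intro arg_cong[where f = "\<lambda>x. q *\<^sub>R x"] Bochner_Integration.integral_cong refl)
    fix z
    have "q\<^sup>2 * z\<^sup>2 + s * (q\<^sup>2 * z\<^sup>2) = (q\<^sup>2 * (1 + s)) * z\<^sup>2" by (simp add: algebra_simps)
    then have "std_normal_density (0 + q * z) * exp (- s * (0 + q * z)\<^sup>2 / 2) = std_normal_density z"
      using q by (simp add: normal_density_def exp_add[symmetric] power_mult_distrib add_divide_distrib[symmetric]
        diff_divide_distrib[symmetric])
    then show "std_normal_density (0 + q * z) *\<^sub>R (of_real (exp (- s * (0 + q * z)\<^sup>2 / 2)) * iexp (t * (0 + q * z)))
       = std_normal_density z *\<^sub>R iexp ((t * q) * z)"
      by (simp add: scaleR_conv_of_real mult.assoc[symmetric] of_real_mult[symmetric] del: of_real_mult)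
  qed
  also have "(\<integral>z. std_normal_density z *\<^sub>R iexp ((t * q) * z) \<partial>lborel) = char std_normal_distribution (t * q)"
    unfolding char_def by (subst integral_density) (auto simp: normal_density_nonneg)
  also have "q *\<^sub>R \<dots> = of_real (exp (- t\<^sup>2 / (2 * (1 + s))) / sqrt (1 + s))"
    using assms by (simp add: char_std_normal_distribution q_def scaleR_conv_of_real power_mult_distrib power_divide mult.commute)
  finally show ?thesis .
qed

text \<open>The squares are linearised one at a time by writing \<open>exp (- a (v - b)\<^sup>2 / 2)\<close> as the
  characteristic function of a standard normal variable at \<open>sqrt a (v - b)\<close>.\<close>

lemma gaussian_quadratic_exp_aux:
  fixes V :: "'i \<Rightarrow> 'v \<Rightarrow> real"
  assumes M: "prob_space M" and a: "a \<ge> 0" and tau: "\<And>j. tau j \<ge> 0"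
    and meas: "\<And>j. V j \<in> borel_measurable M"
    and cf: "\<And>s A. finite A \<Longrightarrow> A \<subseteq> J \<Longrightarrow>
      (\<integral>v. iexp (\<Sum>j\<in>A. s j * V j v) \<partial>M) = of_real (exp (- (\<Sum>j\<in>A. tau j * (s j)\<^sup>2) / 2))"
    and "finite B" "finite A" "A \<inter> B = {}" "A \<subseteq> J" "B \<subseteq> J"
  shows "(\<integral>v. iexp (\<Sum>j\<in>A. s j * V j v) * of_real (exp (- a * (\<Sum>j\<in>B. (V j v - b j)\<^sup>2) / 2)) \<partial>M)
    = of_real (exp (- (\<Sum>j\<in>A. tau j * (s j)\<^sup>2) / 2) *
        (\<Prod>j\<in>B. exp (- a * (b j)\<^sup>2 / (2 * (1 + a * tau j))) / sqrt (1 + a * tau j)))"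
  using assms(6-10)
proof (induction B arbitrary: A s rule: finite_induct)
  case empty
  then show ?case using cf[of A s] by simp
next
  case (insert k B)
  interpret prob_space M by (rule M)
  interpret N: prob_space std_normal_distribution by (rule prob_space_normal_density) simp
  interpret pair_sigma_finite M std_normal_distribution ..
  note [measurable] = meas
  define L where "L = (\<lambda>v. \<Sum>j\<in>A. s j * V j v)"
  define Q where "Q = (\<lambda>v. exp (- a * (\<Sum>j\<in>B. (V j v - b j)\<^sup>2) / 2))"
  have [measurable]: "L \<in> borel_measurable M" "Q \<in> borel_measurable M"
    unfolding L_def Q_def by measurable
  have Q: "\<bar>Q v\<bar> \<le> 1" for v unfolding Q_def using a by (auto intro!: mult_nonneg_nonneg sum_nonneg)
  define ea where "ea = sqrt a"
  have ea: "ea\<^sup>2 = a" using a by (simp add: ea_def)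
  have sq: "(of_real (exp (- a * (V k v - b k)\<^sup>2 / 2)) :: complex)
      = (\<integral>z. iexp (ea * (V k v - b k) * z) \<partial>std_normal_distribution)" for v
    using gaussian_smoothing_integral[of 0 "ea * (V k v - b k)"] by (simp add: power_mult_distrib ea)
  have "(\<integral>v. iexp (\<Sum>j\<in>A. s j * V j v) * of_real (exp (- a * (\<Sum>j\<in>insert k B. (V j v - b j)\<^sup>2) / 2)) \<partial>M)
    = (\<integral>v. iexp (L v) * of_real (Q v) * of_real (exp (- a * (V k v - b k)\<^sup>2 / 2)) \<partial>M)"
  proof (intro Bochner_Integration.integral_cong refl)
    fix v
    have "exp (- a * (\<Sum>j\<in>insert k B. (V j v - b j)\<^sup>2) / 2) = Q v * exp (- a * (V k v - b k)\<^sup>2 / 2)"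
      using insert.hyps unfolding Q_def exp_add[symmetric]
      by (simp add: distrib_left diff_divide_distrib)
    then show "iexp (\<Sum>j\<in>A. s j * V j v) * of_real (exp (- a * (\<Sum>j\<in>insert k B. (V j v - b j)\<^sup>2) / 2))
       = iexp (L v) * of_real (Q v) * of_real (exp (- a * (V k v - b k)\<^sup>2 / 2))"
      by (simp only: L_def of_real_mult mult.assoc)
  qed
  also have "\<dots> = (\<integral>v. (\<integral>z. iexp (L v) * of_real (Q v) * iexp (ea * (V k v - b k) * z) \<partial>std_normal_distribution) \<partial>M)"
    unfolding sq by simp
  also have "\<dots> = (\<integral>z. (\<integral>v. iexp (L v) * of_real (Q v) * iexp (ea * (V k v - b k) * z) \<partial>M) \<partial>std_normal_distribution)"
  proof (rule Fubini_integral[symmetric])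
    interpret P: prob_space "M \<Otimes>\<^sub>M std_normal_distribution"
      by (rule prob_space_pair[OF prob_space_axioms N.prob_space_axioms])
    show "integrable (M \<Otimes>\<^sub>M std_normal_distribution)
      (\<lambda>(v, z). iexp (L v) * complex_of_real (Q v) * iexp (ea * (V k v - b k) * z))"
      by (rule P.integrable_const_bound[where B = 1]) (use Q in \<open>auto simp: norm_mult\<close>)
  qed
  \<comment> \<open>For fixed \<open>z\<close> the coordinate \<open>k\<close> enters linearly, with
    coefficient \<open>ea * z\<close>. It moves from the quadratic index set to the linear one,
    which is why the induction is over \<open>B\<close> with \<open>A\<close> and \<open>s\<close>
    arbitrary.\<close>
  also have "\<dots> = (\<integral>z. iexp (- (ea * b k) * z) *
      of_real (exp (- (\<Sum>j\<in>insert k A. tau j * ((s(k := ea * z)) j)\<^sup>2) / 2) *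
        (\<Prod>j\<in>B. exp (- a * (b j)\<^sup>2 / (2 * (1 + a * tau j))) / sqrt (1 + a * tau j))) \<partial>std_normal_distribution)"
  proof (intro Bochner_Integration.integral_cong refl)
    fix z
    have kA: "k \<notin> A" using insert.prems by auto
    have "(\<integral>v. iexp (L v) * of_real (Q v) * iexp (ea * (V k v - b k) * z) \<partial>M)
      = (\<integral>v. iexp (- (ea * b k) * z) * (iexp (\<Sum>j\<in>insert k A. (s(k := ea * z)) j * V j v) * of_real (Q v)) \<partial>M)"
    proof (intro Bochner_Integration.integral_cong refl)
      fix v
      have "(\<Sum>j\<in>A. (s(k := ea * z)) j * V j v) = L v"
        unfolding L_def using kA by (intro sum.cong) auto
      then have "(\<Sum>j\<in>insert k A. (s(k := ea * z)) j * V j v) = ea * z * V k v + L v"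
        using kA insert.prems by simp
      then have "iexp (L v) * iexp (ea * (V k v - b k) * z)
        = iexp (- (ea * b k) * z) * iexp (\<Sum>j\<in>insert k A. (s(k := ea * z)) j * V j v)"
        unfolding exp_add[symmetric] by (simp only:) (simp add: algebra_simps)
      note eq = arg_cong[OF this, of "\<lambda>x. x * of_real (Q v)"]
      have "iexp (L v) * of_real (Q v) * iexp (ea * (V k v - b k) * z)
        = iexp (L v) * iexp (ea * (V k v - b k) * z) * of_real (Q v)" by (simp only: mult_ac)
      also note eq
      finally show "iexp (L v) * of_real (Q v) * iexp (ea * (V k v - b k) * z)
        = iexp (- (ea * b k) * z) * (iexp (\<Sum>j\<in>insert k A. (s(k := ea * z)) j * V j v) * of_real (Q v))"
        by (simp only: mult.assoc)
    qed
    also have "\<dots> = iexp (- (ea * b k) * z) *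
       (\<integral>v. (iexp (\<Sum>j\<in>insert k A. (s(k := ea * z)) j * V j v) * of_real (Q v)) \<partial>M)"
      by simp
    also have "(\<integral>v. (iexp (\<Sum>j\<in>insert k A. (s(k := ea * z)) j * V j v) * of_real (Q v)) \<partial>M)
      = of_real (exp (- (\<Sum>j\<in>insert k A. tau j * ((s(k := ea * z)) j)\<^sup>2) / 2) *
        (\<Prod>j\<in>B. exp (- a * (b j)\<^sup>2 / (2 * (1 + a * tau j))) / sqrt (1 + a * tau j)))"
      unfolding Q_def by (rule insert.IH) (use insert.prems insert.hyps in auto)
    finally show "(\<integral>v. iexp (L v) * of_real (Q v) * iexp (ea * (V k v - b k) * z) \<partial>M)
      = iexp (- (ea * b k) * z) * of_real (exp (- (\<Sum>j\<in>insert k A. tau j * ((s(k := ea * z)) j)\<^sup>2) / 2) *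
        (\<Prod>j\<in>B. exp (- a * (b j)\<^sup>2 / (2 * (1 + a * tau j))) / sqrt (1 + a * tau j)))" .
  qed
  also have "\<dots> = (\<integral>z. of_real (exp (- (\<Sum>j\<in>A. tau j * (s j)\<^sup>2) / 2) *
        (\<Prod>j\<in>B. exp (- a * (b j)\<^sup>2 / (2 * (1 + a * tau j))) / sqrt (1 + a * tau j))) *
      (of_real (exp (- (a * tau k) * z\<^sup>2 / 2)) * iexp (- (ea * b k) * z)) \<partial>std_normal_distribution)"
  proof (intro Bochner_Integration.integral_cong refl)
    fix z
    have kA: "k \<notin> A" using insert.prems by auto
    have "(\<Sum>j\<in>A. tau j * ((s(k := ea * z)) j)\<^sup>2) = (\<Sum>j\<in>A. tau j * (s j)\<^sup>2)"
      using kA by (intro sum.cong) auto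
    then have *: "(\<Sum>j\<in>insert k A. tau j * ((s(k := ea * z)) j)\<^sup>2) = a * tau k * z\<^sup>2 + (\<Sum>j\<in>A. tau j * (s j)\<^sup>2)"
      using kA insert.prems by (simp add: power_mult_distrib ea mult_ac)
    have **: "exp (- (a * tau k * z\<^sup>2 + (\<Sum>j\<in>A. tau j * (s j)\<^sup>2)) / 2)
       = exp (- (a * tau k) * z\<^sup>2 / 2) * exp (- (\<Sum>j\<in>A. tau j * (s j)\<^sup>2) / 2)"
      by (simp add: exp_add[symmetric] diff_divide_distrib add_divide_distrib)
    show "iexp (- (ea * b k) * z) *
      of_real (exp (- (\<Sum>j\<in>insert k A. tau j * ((s(k := ea * z)) j)\<^sup>2) / 2) *
        (\<Prod>j\<in>B. exp (- a * (b j)\<^sup>2 / (2 * (1 + a * tau j))) / sqrt (1 + a * tau j)))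
     = of_real (exp (- (\<Sum>j\<in>A. tau j * (s j)\<^sup>2) / 2) *
        (\<Prod>j\<in>B. exp (- a * (b j)\<^sup>2 / (2 * (1 + a * tau j))) / sqrt (1 + a * tau j))) *
      (of_real (exp (- (a * tau k) * z\<^sup>2 / 2)) * iexp (- (ea * b k) * z))"
      unfolding * ** by (simp only: of_real_mult mult_ac)
  qed
  also have "\<dots> = of_real (exp (- (\<Sum>j\<in>A. tau j * (s j)\<^sup>2) / 2) *
        (\<Prod>j\<in>B. exp (- a * (b j)\<^sup>2 / (2 * (1 + a * tau j))) / sqrt (1 + a * tau j))) *
      (\<integral>z. of_real (exp (- (a * tau k) * z\<^sup>2 / 2)) * iexp (- (ea * b k) * z) \<partial>std_normal_distribution)"
    by (rule integral_mult_right_zero)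
  \<comment> \<open>What remains of the auxiliary variable is a Gaussian weight coming from the
    variance \<open>tau k\<close> and a character coming from the centre \<open>b k\<close>.\<close>
  also have "(\<integral>z. of_real (exp (- (a * tau k) * z\<^sup>2 / 2)) * iexp (- (ea * b k) * z) \<partial>std_normal_distribution)
     = of_real (exp (- a * (b k)\<^sup>2 / (2 * (1 + a * tau k))) / sqrt (1 + a * tau k))"
    by (subst gaussian_smoothing_integral) (use a tau in \<open>auto simp: power_mult_distrib ea\<close>)
  finally show ?case using insert.hyps by (simp add: mult_ac)
qed

text \<open>The case of an empty linear part; both sides are then real, so the complex identity
  descends to the reals.\<close>

lemma gaussian_quadratic_exp:
  fixes V :: "'i \<Rightarrow> 'v \<Rightarrow> real"
  assumes M: "prob_space M" and a: "a \<ge> 0" and tau: "\<And>j. tau j \<ge> 0"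
    and meas: "\<And>j. V j \<in> borel_measurable M"
    and cf: "\<And>s A. finite A \<Longrightarrow> A \<subseteq> J \<Longrightarrow>
      (\<integral>v. iexp (\<Sum>j\<in>A. s j * V j v) \<partial>M) = of_real (exp (- (\<Sum>j\<in>A. tau j * (s j)\<^sup>2) / 2))"
    and J: "finite J"
  shows "(\<integral>v. exp (- a * (\<Sum>j\<in>J. (V j v - b j)\<^sup>2) / 2) \<partial>M)
    = (\<Prod>j\<in>J. exp (- a * (b j)\<^sup>2 / (2 * (1 + a * tau j))) / sqrt (1 + a * tau j))"
proof -
  have "complex_of_real (\<integral>v. exp (- a * (\<Sum>j\<in>J. (V j v - b j)\<^sup>2) / 2) \<partial>M)
     = (\<integral>v. of_real (exp (- a * (\<Sum>j\<in>J. (V j v - b j)\<^sup>2) / 2)) \<partial>M)"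
    by (rule integral_complex_of_real[symmetric])
  also have "\<dots> = of_real (\<Prod>j\<in>J. exp (- a * (b j)\<^sup>2 / (2 * (1 + a * tau j))) / sqrt (1 + a * tau j))"
    using gaussian_quadratic_exp_aux[OF M a tau meas cf J finite.emptyI, where b = b and s = "\<lambda>_. 0"] by simp
  finally show ?thesis by (simp only: of_real_eq_iff)
qed

section \<open>Tail bound for the posterior\<close>

text \<open>A centred Gaussian variable is determined by its second moment. A point mass must sit at
  0; otherwise division by the standard deviation reduces everything to the standard normal
  law.\<close>

lemma gaussian_rv_centered:
  assumes M: "prob_space M" and X: "gaussian_rv M X" and mean: "(\<integral>v. X v \<partial>M) = 0"
  shows "integrable M (\<lambda>v. (X v)\<^sup>2)" "integrable M X"
    "(\<integral>v. iexp (X v) \<partial>M) = of_real (exp (- (\<integral>v. (X v)\<^sup>2 \<partial>M) / 2))"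
proof -
  interpret prob_space M by (rule M)
  have meas [measurable]: "X \<in> borel_measurable M" using X by (simp add: gaussian_rv_def)
  from X obtain mu sig where sig: "sig \<ge> 0"
    and d: "distr M borel X = (if sig = 0 then return borel mu else density lborel (normal_density mu sig))"
    by (auto simp: gaussian_rv_def)
  have "integrable M (\<lambda>v. (X v)\<^sup>2) \<and> integrable M X \<and>
    (\<integral>v. iexp (X v) \<partial>M) = of_real (exp (- (\<integral>v. (X v)\<^sup>2 \<partial>M) / 2))"
  proof (cases "sig = 0")
    case True
    then have d: "distr M borel X = return borel mu" using d by simp
    have eq: "(\<integral>v. h (X v) \<partial>M) = h mu" if [measurable]: "h \<in> borel_measurable borel"
      for h :: "real \<Rightarrow> 'b :: {banach, second_countable_topology}"
      using integral_distr[OF meas, of h] by (simp add: d integral_return)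
    have int: "integrable M (\<lambda>v. h (X v))" if [measurable]: "h \<in> borel_measurable borel" for h :: "real \<Rightarrow> real"
    proof -
      have "integrable (distr M borel X) h"
        unfolding d by (subst integrable_iff_bounded) (simp add: nn_integral_return)
      then show ?thesis by (rule integrable_distr[OF meas])
    qed
    have "mu = 0" using mean eq[of "\<lambda>x. x"] by simp
    then show ?thesis
      using int[of "\<lambda>x. x\<^sup>2"] int[of "\<lambda>x. x"] eq[of "\<lambda>x. x\<^sup>2"] eq[of iexp] by simp
  next
    case False
    then have sp: "sig > 0" using sig by simp
    have "distr M lborel X = distr M borel X" by (rule distr_cong) auto
    then have D: "distributed M lborel X (normal_density mu sig)"
      unfolding distributed_def using d False by auto
    then have mu: "mu = 0" using normal_distributed_expectation[OF sp D] mean by simp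
    have var: "(\<integral>v. (X v)\<^sup>2 \<partial>M) = sig\<^sup>2" using normal_distributed_variance[OF sp D] mean by simp
    have D1: "distributed M lborel (\<lambda>v. X v / sig) std_normal_density"
      using D normal_standard_normal_convert[OF sp, of X mu] mu by simp
    have i1: "integrable M (\<lambda>v. X v / sig)"
      using distributed_integrable[OF D1, of "\<lambda>x. x"] integrable_std_normal_moment[of 1] by simp
    have i2: "integrable M (\<lambda>v. (X v / sig)\<^sup>2)"
      using distributed_integrable[OF D1, of "\<lambda>x. x\<^sup>2"] integrable_std_normal_moment[of 2] by simp
    have "(\<integral>v. iexp (X v) \<partial>M) = (\<integral>v. iexp (sig * (X v / sig)) \<partial>M)" using sp by simp
    also have "\<dots> = (\<integral>z. iexp (sig * z) \<partial>(distr M lborel (\<lambda>v. X v / sig)))"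
      by (subst integral_distr) auto
    also have "\<dots> = char std_normal_distribution sig"
      unfolding distributed_distr_eq_density[OF D1] by (simp add: char_def)
    finally have "(\<integral>v. iexp (X v) \<partial>M) = of_real (exp (- (\<integral>v. (X v)\<^sup>2 \<partial>M) / 2))"
      by (simp add: char_std_normal_distribution var)
    moreover have "integrable M X" using integrable_mult_left[OF i1, of sig] sp by simp
    moreover have "integrable M (\<lambda>v. (X v)\<^sup>2)"
      using integrable_mult_left[OF i2, of "sig\<^sup>2"] sp by (simp add: power_divide)
    ultimately show ?thesis by blast
  qed
  then show "integrable M (\<lambda>v. (X v)\<^sup>2)" "integrable M X"
    "(\<integral>v. iexp (X v) \<partial>M) = of_real (exp (- (\<integral>v. (X v)\<^sup>2 \<partial>M) / 2))" by auto
qed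

section \<open>Linear combinations of the process and the covariance matrix\<close>

lemma integrable_product_of_squares:
  fixes X Y :: "'v \<Rightarrow> real"
  assumes "X \<in> borel_measurable M" "Y \<in> borel_measurable M"
    "integrable M (\<lambda>v. (X v)\<^sup>2)" "integrable M (\<lambda>v. (Y v)\<^sup>2)"
  shows "integrable M (\<lambda>v. X v * Y v)"
proof (rule Bochner_Integration.integrable_bound)
  show "integrable M (\<lambda>v. (X v)\<^sup>2 + (Y v)\<^sup>2)" using assms by auto
  show "AE v in M. norm (X v * Y v) \<le> norm ((X v)\<^sup>2 + (Y v)\<^sup>2)"
  proof (rule AE_I2)
    fix v
    have "2 * (\<bar>X v\<bar> * \<bar>Y v\<bar>) \<le> (X v)\<^sup>2 + (Y v)\<^sup>2"
      using sum_squares_bound[of "\<bar>X v\<bar>" "\<bar>Y v\<bar>"] by simp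
    moreover have "0 \<le> \<bar>X v\<bar> * \<bar>Y v\<bar>" by simp
    ultimately have "\<bar>X v\<bar> * \<bar>Y v\<bar> \<le> (X v)\<^sup>2 + (Y v)\<^sup>2" by linarith
    then show "norm (X v * Y v) \<le> norm ((X v)\<^sup>2 + (Y v)\<^sup>2)" by (simp add: abs_mult)
  qed
qed (use assms in measurable)

lemma gp_linear_combination:
  fixes W :: "'x \<Rightarrow> 'v \<Rightarrow> real" and N :: nat and x :: "nat \<Rightarrow> 'x"
  assumes gp: "centered_gaussian_process MW W"
  defines "X \<equiv> \<lambda>\<alpha> v. \<Sum>i<N. \<alpha> i * W (x (Suc i)) v"
  shows "X \<alpha> \<in> borel_measurable MW"
    "(\<integral>v. (X \<alpha> v)\<^sup>2 \<partial>MW) = (\<Sum>i<N. \<Sum>k<N. \<alpha> i * \<alpha> k * cov_mat MW W N x $$ (i, k))"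
    "(\<integral>v. iexp (X \<alpha> v) \<partial>MW)
      = of_real (exp (- (\<Sum>i<N. \<Sum>k<N. \<alpha> i * \<alpha> k * cov_mat MW W N x $$ (i, k)) / 2))"
proof -
  have M: "prob_space MW" using gp by (simp add: centered_gaussian_process_def)
  have lin: "gaussian_rv MW (\<lambda>v. \<Sum>p\<in>S. a p * W p v)" if "finite S" for S a
    using gp that by (simp add: centered_gaussian_process_def)
  have W: "gaussian_rv MW (W p)" for p using lin[of "{p}" "\<lambda>_. 1"] by simp
  have W0: "(\<integral>v. W p v \<partial>MW) = 0" for p using gp by (simp add: centered_gaussian_process_def)
  note WI = gaussian_rv_centered[OF M W W0]
  have Wm [measurable]: "W p \<in> borel_measurable MW" for p using W[of p] by (simp add: gaussian_rv_def)
  show "X \<alpha> \<in> borel_measurable MW" unfolding X_def by measurable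
  have G: "gaussian_rv MW (X \<alpha>)"
  proof -
    \<comment> \<open>Design points may coincide, while the definition of the process speaks of sums
      over a set of points. The weights of equal points are therefore collected first.\<close>
    have "X \<alpha> = (\<lambda>v. \<Sum>p\<in>(\<lambda>i. x (Suc i)) ` {..<N}. (\<Sum>i\<in>{i\<in>{..<N}. x (Suc i) = p}. \<alpha> i) * W p v)"
    proof
      fix v
      have "X \<alpha> v = (\<Sum>p\<in>(\<lambda>i. x (Suc i)) ` {..<N}. \<Sum>i\<in>{i\<in>{..<N}. x (Suc i) = p}. \<alpha> i * W (x (Suc i)) v)"
        unfolding X_def by (rule sum.image_gen) simp
      also have "\<dots> = (\<Sum>p\<in>(\<lambda>i. x (Suc i)) ` {..<N}. (\<Sum>i\<in>{i\<in>{..<N}. x (Suc i) = p}. \<alpha> i) * W p v)"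
        by (intro sum.cong refl) (simp add: sum_distrib_right)
      finally show "X \<alpha> v = \<dots>" .
    qed
    then show ?thesis using lin[of "(\<lambda>i. x (Suc i)) ` {..<N}"] by simp
  qed
  have X0: "(\<integral>v. X \<alpha> v \<partial>MW) = 0"
    unfolding X_def using WI(2) W0 by (subst Bochner_Integration.integral_sum) auto
  have WW: "integrable MW (\<lambda>v. W p v * W q v)" for p q
    by (rule integrable_product_of_squares) (use WI(1) in auto)
  have "(\<integral>v. (X \<alpha> v)\<^sup>2 \<partial>MW)
     = (\<integral>v. (\<Sum>i<N. \<Sum>k<N. (\<alpha> i * \<alpha> k) * (W (x (Suc i)) v * W (x (Suc k)) v)) \<partial>MW)"
    unfolding X_def power2_eq_square sum_product by (simp add: mult_ac)
  also have "\<dots> = (\<Sum>i<N. \<Sum>k<N. (\<alpha> i * \<alpha> k) * (\<integral>v. W (x (Suc i)) v * W (x (Suc k)) v \<partial>MW))"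
    using WW by (subst Bochner_Integration.integral_sum | simp)+
  also have "\<dots> = (\<Sum>i<N. \<Sum>k<N. \<alpha> i * \<alpha> k * cov_mat MW W N x $$ (i, k))"
    by (simp add: cov_mat_def)
  finally show v: "(\<integral>v. (X \<alpha> v)\<^sup>2 \<partial>MW) = (\<Sum>i<N. \<Sum>k<N. \<alpha> i * \<alpha> k * cov_mat MW W N x $$ (i, k))" .
  show "(\<integral>v. iexp (X \<alpha> v) \<partial>MW)
      = of_real (exp (- (\<Sum>i<N. \<Sum>k<N. \<alpha> i * \<alpha> k * cov_mat MW W N x $$ (i, k)) / 2))"
    unfolding v[symmetric] by (rule gaussian_rv_centered(3)[OF M G X0])
qed

text \<open>The weight vector is a combination of eigenvectors, whose coordinate along
  \<open>e p\<close> is \<open>s p\<close> for \<open>p\<close> in \<open>A\<close> and 0 otherwise,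
  so the form is diagonal. In probabilistic terms, the coordinates of the process in the eigenbasis
  are uncorrelated with variances \<open>lam j\<close>.\<close>

lemma cov_quadratic_form:
  assumes ob: "orthonormal_eigenbasis N U lam e" and U: "U \<in> carrier_mat N N"
    and A: "A \<subseteq> {1..N}"
  shows "(\<Sum>i<N. \<Sum>k<N. (\<Sum>j\<in>A. s j * e j $ i) * (\<Sum>j\<in>A. s j * e j $ k) * U $$ (i, k))
    = (\<Sum>j\<in>A. lam j * (s j)\<^sup>2)"
proof -
  define \<alpha> where "\<alpha> i = (\<Sum>j\<in>A. s j * e j $ i)" for i
  have on: "(\<Sum>l<N. e j $ l * e p $ l) = (if j = p then 1 else 0)"
    if "j \<in> {1..N}" "p \<in> {1..N}" for j p
  proof -
    have "e j \<bullet> e p = (if j = p then 1 else 0)" "dim_vec (e p) = N"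
      using ob that by (auto simp: orthonormal_eigenbasis_def)
    then show ?thesis by (simp add: scalar_prod_def lessThan_atLeast0)
  qed
  have fA: "finite A" using A finite_subset by blast
  have \<alpha>: "(\<Sum>i<N. \<alpha> i * e p $ i) = (if p \<in> A then s p else 0)" if "p \<in> {1..N}" for p
  proof -
    have "(\<Sum>i<N. \<alpha> i * e p $ i) = (\<Sum>j\<in>A. s j * (\<Sum>i<N. e j $ i * e p $ i))"
      unfolding \<alpha>_def sum_distrib_right sum_distrib_left by (subst sum.swap) (simp add: mult_ac)
    also have "\<dots> = (\<Sum>j\<in>A. s j * (if j = p then 1 else 0))"
      using A that by (intro sum.cong refl) (subst on, auto)
    also have "\<dots> = (if p \<in> A then s p else 0)" using fA by (simp add: if_distrib cong: if_cong)
    finally show ?thesis .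
  qed
  have "(\<Sum>i<N. \<Sum>k<N. \<alpha> i * \<alpha> k * U $$ (i, k))
     = (\<Sum>i<N. \<Sum>k<N. \<Sum>p=1..N. lam p * (\<alpha> i * e p $ i) * (\<alpha> k * e p $ k))"
    unfolding spec_eigen[OF ob U] by (intro sum.cong refl) (simp add: spec_def sum_distrib_left mult_ac)
  also have "\<dots> = (\<Sum>p=1..N. \<Sum>i<N. \<Sum>k<N. lam p * (\<alpha> i * e p $ i) * (\<alpha> k * e p $ k))"
    by (rule sum_rotate)
  also have "\<dots> = (\<Sum>p=1..N. lam p * ((\<Sum>i<N. \<alpha> i * e p $ i) * (\<Sum>i<N. \<alpha> i * e p $ i)))"
    unfolding sum_product by (simp add: sum_distrib_left mult_ac)
  also have "\<dots> = (\<Sum>p=1..N. if p \<in> A then lam p * (s p)\<^sup>2 else 0)"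
    by (intro sum.cong refl) (simp only: \<alpha>, simp add: power2_eq_square)
  also have "\<dots> = (\<Sum>j\<in>A. lam j * (s j)\<^sup>2)"
    using A by (simp add: sum.inter_restrict[symmetric] Int_absorb1)
  finally show ?thesis by (simp add: \<alpha>_def)
qed

lemma cov_mat_carrier [simp]: "cov_mat MW W N x \<in> carrier_mat N N"
  by (simp add: cov_mat_def)

text \<open>The eigenvalue is the second moment of the linear combination of the process with
  weights \<open>e j\<close>.\<close>

lemma cov_eigenvalue_nonneg:
  assumes gp: "centered_gaussian_process MW W"
    and ob: "orthonormal_eigenbasis N (cov_mat MW W N x) lam e" and j: "j \<in> {1..N}"
  shows "lam j \<ge> 0"
proof -
  have "0 \<le> (\<integral>v. (\<Sum>i<N. e j $ i * W (x (Suc i)) v)\<^sup>2 \<partial>MW)" by simp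
  also have "\<dots> = (\<Sum>i<N. \<Sum>k<N. e j $ i * e j $ k * cov_mat MW W N x $$ (i, k))"
    by (rule gp_linear_combination(2)[OF gp])
  also have "\<dots> = lam j"
    using cov_quadratic_form[OF ob cov_mat_carrier, of "{j}" "\<lambda>_. 1"] j by simp
  finally show ?thesis .
qed

text \<open>In the eigenbasis the prior has the joint characteristic function of independent centred
  normal coordinates with variances \<open>c * lam j\<close>, which is the input of
  \<open>gaussian_quadratic_exp\<close>.\<close>

lemma gp_quadratic_exp:
  assumes gp: "centered_gaussian_process MW W"
    and ob: "orthonormal_eigenbasis N (cov_mat MW W N x) lam e"
    and c: "c \<ge> 0" and a: "a \<ge> 0"
  shows "(\<integral>v. exp (- a * (\<Sum>j=1..N. (nvec N (\<lambda>i. sqrt c * W (x i) v) \<bullet> e j - b j)\<^sup>2) / 2) \<partial>MW)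
    = (\<Prod>j=1..N. exp (- a * (b j)\<^sup>2 / (2 * (1 + a * (c * lam j)))) / sqrt (1 + a * (c * lam j)))"
proof -
  define V where "V = (\<lambda>j v. \<Sum>i<N. (sqrt c * e j $ i) * W (x (Suc i)) v)"
  \<comment> \<open>Outside \<open>{1..N}\<close> nothing is known about the sign of
    \<open>lam j\<close>, whereas \<open>gaussian_quadratic_exp\<close> asks for nonnegative
    variances at every index; hence the value 0 there.\<close>
  define tau where "tau j = (if j \<in> {1..N} then c * lam j else 0)" for j
  have V: "nvec N (\<lambda>i. sqrt c * W (x i) v) \<bullet> e j = V j v" if "j \<in> {1..N}" for j v
  proof -
    have "dim_vec (e j) = N" using ob that by (auto simp: orthonormal_eigenbasis_def)
    then show ?thesis by (simp add: nvec_def V_def scalar_prod_def lessThan_atLeast0 mult_ac)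
  qed
  have cf: "(\<integral>v. iexp (\<Sum>j\<in>A. s j * V j v) \<partial>MW) = of_real (exp (- (\<Sum>j\<in>A. tau j * (s j)\<^sup>2) / 2))"
    if "finite A" "A \<subseteq> {1..N}" for A s
  proof -
    have "(\<Sum>j\<in>A. s j * V j v) = (\<Sum>i<N. (\<Sum>j\<in>A. (sqrt c * s j) * e j $ i) * W (x (Suc i)) v)" for v
      unfolding V_def sum_distrib_left sum_distrib_right by (subst sum.swap) (simp add: mult_ac)
    then have "(\<integral>v. iexp (\<Sum>j\<in>A. s j * V j v) \<partial>MW)
       = of_real (exp (- (\<Sum>j\<in>A. lam j * (sqrt c * s j)\<^sup>2) / 2))"
      using gp_linear_combination(3)[OF gp, where \<alpha> = "\<lambda>i. \<Sum>j\<in>A. (sqrt c * s j) * e j $ i" and N = N and x = x]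
        cov_quadratic_form[OF ob cov_mat_carrier that(2), of "\<lambda>j. sqrt c * s j"] by simp
    also have "(\<Sum>j\<in>A. lam j * (sqrt c * s j)\<^sup>2) = (\<Sum>j\<in>A. tau j * (s j)\<^sup>2)"
      using that(2) c by (intro sum.cong refl) (auto simp: tau_def power_mult_distrib subset_iff)
    finally show ?thesis .
  qed
  have "(\<integral>v. exp (- a * (\<Sum>j=1..N. (V j v - b j)\<^sup>2) / 2) \<partial>MW)
    = (\<Prod>j=1..N. exp (- a * (b j)\<^sup>2 / (2 * (1 + a * tau j))) / sqrt (1 + a * tau j))"
  proof (rule gaussian_quadratic_exp)
    show "prob_space MW" using gp by (simp add: centered_gaussian_process_def)
    show "tau j \<ge> 0" for j using c cov_eigenvalue_nonneg[OF gp ob] by (simp add: tau_def)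
    show "V j \<in> borel_measurable MW" for j unfolding V_def by (rule gp_linear_combination(1)[OF gp])
  qed (use a cf in auto)
  moreover have "(\<Sum>j=1..N. (nvec N (\<lambda>i. sqrt c * W (x i) v) \<bullet> e j - b j)\<^sup>2) = (\<Sum>j=1..N. (V j v - b j)\<^sup>2)" for v
    by (intro sum.cong refl) (simp only: V)
  moreover have "(\<Prod>j=1..N. exp (- a * (b j)\<^sup>2 / (2 * (1 + a * tau j))) / sqrt (1 + a * tau j))
     = (\<Prod>j=1..N. exp (- a * (b j)\<^sup>2 / (2 * (1 + a * (c * lam j)))) / sqrt (1 + a * (c * lam j)))"
    by (intro prod.cong refl) (simp add: tau_def)
  ultimately show ?thesis by (simp only:)
qed

text \<open>Up to the slack in \<open>sqrt (1 + 2 \<theta> t) \<le> exp (\<theta> t)\<close> and \<open>1 + 2 \<theta> t \<ge> 1\<close> this is the Laplace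
  transform of \<open>(v - f)\<^sup>2\<close> for the posterior of one coordinate, normal with mean \<open>t y\<close> and variance \<open>t\<close>.\<close>

lemma posterior_coordinate_laplace:
  fixes \<theta> \<tau> y f :: real
  assumes th: "\<theta> \<ge> 0" and tau: "\<tau> \<ge> 0"
  defines "a \<equiv> 1 + 2 * \<theta>" and "t \<equiv> \<tau> / (1 + \<tau>)"
  shows "exp (- \<theta> * (t + (t * y - f)\<^sup>2)) * (exp (- y\<^sup>2 / (2 * (1 + \<tau>))) / sqrt (1 + \<tau>))
    \<le> exp (- \<theta> * (y - f)\<^sup>2 / a) * (exp (- a * ((y + 2 * \<theta> * f) / a)\<^sup>2 / (2 * (1 + a * \<tau>))) / sqrt (1 + a * \<tau>))"
proof -
  have a: "a > 0" "1 + a * \<tau> > 0" "1 + \<tau> > 0" using th tau by (auto simp: a_def add_pos_nonneg)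
  have t0: "t \<ge> 0" using tau by (simp add: t_def)
  \<comment> \<open>The ratio of the two normalising factors is
    \<open>sqrt (1 + 2 * \<theta> * t)\<close>, the factor from the Laplace transform of a squared
    normal variable of variance \<open>t\<close>.\<close>
  have r: "1 + a * \<tau> = (1 + \<tau>) * (1 + 2 * \<theta> * t)" using a by (simp add: t_def a_def field_simps)
  have "1 + 2 * \<theta> * t \<le> exp (2 * \<theta> * t)" by simp
  also have "\<dots> = (exp (\<theta> * t))\<^sup>2" by (simp add: power2_eq_square exp_add[symmetric])
  finally have "sqrt (1 + 2 * \<theta> * t) \<le> exp (\<theta> * t)" by (intro real_le_lsqrt) auto
  then have s: "sqrt (1 + a * \<tau>) \<le> sqrt (1 + \<tau>) * exp (\<theta> * t)"
    unfolding r real_sqrt_mult using a by (intro mult_left_mono) auto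
  have 1: "exp (- (\<theta> * t)) / sqrt (1 + \<tau>) \<le> 1 / sqrt (1 + a * \<tau>)"
    using s a by (simp add: exp_minus divide_simps mult_ac)
  have ts: "t * y - f = (\<tau> * y - (1 + \<tau>) * f) / (1 + \<tau>)"
    using a by (simp add: t_def field_simps)
  \<comment> \<open>Subtracting the exponent of the marginal density of \<open>y\<close> leaves the
    noncentral part of that Laplace transform, with mean \<open>t * y - f\<close>.\<close>
  have "\<theta> * (y - f)\<^sup>2 / a + a * ((y + 2 * \<theta> * f) / a)\<^sup>2 / (2 * (1 + a * \<tau>)) - y\<^sup>2 / (2 * (1 + \<tau>))
     = \<theta> * (\<tau> * y - (1 + \<tau>) * f)\<^sup>2 / ((1 + \<tau>) * (1 + a * \<tau>))"
  proof -
    have "2 * \<theta> * (y - f)\<^sup>2 * (1 + a * \<tau>) * (1 + \<tau>) + (y + 2 * \<theta> * f)\<^sup>2 * (1 + \<tau>) - y\<^sup>2 * a * (1 + a * \<tau>)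
      = 2 * a * \<theta> * (\<tau> * y - (1 + \<tau>) * f)\<^sup>2"
      unfolding a_def by (simp add: power2_eq_square algebra_simps)
    moreover have "\<theta> * u / a + X / (2 * a * p) - Y / (2 * q) = (2 * \<theta> * u * p * q + X * q - Y * a * p) / (2 * a * p * q)"
      if "p > 0" "q > 0" for p q u X Y :: real
      using that a(1) by (simp add: field_simps)
    note this[OF a(2,3), of "(y - f)\<^sup>2" "(y + 2 * \<theta> * f)\<^sup>2" "y\<^sup>2"]
    moreover have "a * ((y + 2 * \<theta> * f) / a)\<^sup>2 / (2 * (1 + a * \<tau>)) = (y + 2 * \<theta> * f)\<^sup>2 / (2 * a * (1 + a * \<tau>))"
      using a(1) by (simp add: power_divide power2_eq_square)
    ultimately show ?thesis using a by simp
  qed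
  also have "\<dots> = \<theta> * (t * y - f)\<^sup>2 / (1 + 2 * \<theta> * t)"
    unfolding ts r using a by (simp add: power_divide field_simps power2_eq_square)
  also have "\<dots> \<le> \<theta> * (t * y - f)\<^sup>2"
    using divide_left_mono[of 1 "1 + 2 * \<theta> * t" "\<theta> * (t * y - f)\<^sup>2"] th t0 by (simp add: add_pos_nonneg)
  finally have "- \<theta> * (t * y - f)\<^sup>2 - y\<^sup>2 / (2 * (1 + \<tau>))
      \<le> - \<theta> * (y - f)\<^sup>2 / a - a * ((y + 2 * \<theta> * f) / a)\<^sup>2 / (2 * (1 + a * \<tau>))" by simp
  then have "exp (- \<theta> * (t * y - f)\<^sup>2 - y\<^sup>2 / (2 * (1 + \<tau>))) * (exp (- (\<theta> * t)) / sqrt (1 + \<tau>))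
      \<le> exp (- \<theta> * (y - f)\<^sup>2 / a - a * ((y + 2 * \<theta> * f) / a)\<^sup>2 / (2 * (1 + a * \<tau>))) * (1 / sqrt (1 + a * \<tau>))"
    using 1 a by (intro mult_mono) auto
  then show ?thesis
    by (simp add: exp_add[symmetric] exp_diff exp_minus distrib_left divide_inverse mult_ac exp_add)
qed


section \<open>Measurability of the prior and evaluation of the likelihood\<close>

lemma measurable_prior_map:
  assumes "centered_gaussian_process MW W"
  shows "(\<lambda>v x. sqrt c * W x v) \<in> measurable MW (Pi\<^sub>M UNIV (\<lambda>_. borel))"
proof -
  have lin: "gaussian_rv MW (\<lambda>v. \<Sum>q\<in>S. a q * W q v)" if "finite S" for S a
    using assms that by (simp add: centered_gaussian_process_def)
  have [measurable]: "W p \<in> borel_measurable MW" for p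
    using lin[of "{p}" "\<lambda>_. 1"] by (simp add: gaussian_rv_def)
  show ?thesis by (rule measurable_PiM_single') auto
qed

lemma sqnorm_nvec_diff:
  assumes "y \<in> carrier_vec N"
  shows "sqnorm (nvec N h - y) = (\<Sum>i<N. (h (Suc i) - y $ i)\<^sup>2)"
  using assms by (auto simp: sqnorm_def nvec_def scalar_prod_def lessThan_atLeast0 power2_eq_square intro!: sum.cong)

lemma likelihood_eq_exp:
  assumes "y \<in> carrier_vec N"
  shows "likelihood N x y w = (1 / sqrt (2 * pi)) ^ N * exp (- sqnorm (nvec N (\<lambda>i. w (x i)) - y) / 2)"
proof -
  have "likelihood N x y w = (\<Prod>i<N. 1 / sqrt (2 * pi) * exp (- (y $ i - w (x (Suc i)))\<^sup>2 / 2))"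
    by (simp add: likelihood_def normal_density_def)
  also have "\<dots> = (1 / sqrt (2 * pi)) ^ N * exp (\<Sum>i<N. - (y $ i - w (x (Suc i)))\<^sup>2 / 2)"
    by (subst prod.distrib) (simp add: exp_sum)
  also have "(\<Sum>i<N. - (y $ i - w (x (Suc i)))\<^sup>2 / 2) = - sqnorm (nvec N (\<lambda>i. w (x i)) - y) / 2"
    unfolding sqnorm_nvec_diff[OF assms]
    by (simp add: sum_negf sum_divide_distrib power2_commute[of "y $ _"])
  finally show ?thesis .
qed

lemma measurable_sqnorm_evaluation:
  assumes "y \<in> carrier_vec N"
  shows "(\<lambda>w. sqnorm (nvec N (\<lambda>i. w (x i)) - y)) \<in> borel_measurable (Pi\<^sub>M UNIV (\<lambda>_. borel))"
  unfolding sqnorm_nvec_diff[OF assms] by measurable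

text \<open>The sum on the right is the posterior mean of the squared error \<open>S\<close>,
  variance plus squared bias in each coordinate. Working with \<open>1 - exp (- S / s)\<close> costs
  the factor 2 compared with Markov's inequality for \<open>S\<close>, and keeps all integrands
  bounded.\<close>

lemma posterior_tail_bound:
  assumes gp: "centered_gaussian_process MW W"
    and ob: "orthonormal_eigenbasis N (cov_mat MW W N x) lam e"
    and c: "c \<ge> 0" and y: "y \<in> carrier_vec N" and fv: "fv \<in> carrier_vec N" and s: "s > 0"
  shows "measure (posterior MW W N x c y) {w. sqnorm (nvec N (\<lambda>i. w (x i)) - fv) \<ge> s}
    \<le> 2 * (\<Sum>j=1..N. c * lam j / (1 + c * lam j)
         + (c * lam j / (1 + c * lam j) * (y \<bullet> e j) - fv \<bullet> e j)\<^sup>2) / s"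
proof -
  define Pr where "Pr = prior MW W c"
  interpret MW: prob_space MW using gp by (simp add: centered_gaussian_process_def)
  note T = measurable_prior_map[OF gp, of c]
  interpret Pr: prob_space Pr unfolding Pr_def prior_def by (rule MW.prob_space_distr[OF T])
  have setsPr [measurable_cong]: "sets Pr = sets (Pi\<^sub>M UNIV (\<lambda>_. borel))" by (simp add: Pr_def prior_def)
  define Q where "Q w = sqnorm (nvec N (\<lambda>i. w (x i)) - y)" for w
  define S where "S w = sqnorm (nvec N (\<lambda>i. w (x i)) - fv)" for w
  have meas [measurable]: "Q \<in> borel_measurable (Pi\<^sub>M UNIV (\<lambda>_. borel))" "S \<in> borel_measurable (Pi\<^sub>M UNIV (\<lambda>_. borel))"
    unfolding Q_def[abs_def] S_def[abs_def] by (intro measurable_sqnorm_evaluation y fv)+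
  have QS: "Q w \<ge> 0" "S w \<ge> 0" for w
    unfolding Q_def S_def sqnorm_nvec_diff[OF y] sqnorm_nvec_diff[OF fv] by (intro sum_nonneg; simp)+
  \<comment> \<open>On the event in question \<open>th * S\<close> is then at least 1. The number
    \<open>a\<close> is twice the coefficient of the squared coordinate in the combined exponent
    \<open>Q / 2 + th * S\<close>.\<close>
  define th a where "th = 1 / s" and "a = 1 + 2 * th"
  have th: "th > 0" and a: "a > 0" using s by (auto simp: th_def a_def add_pos_pos)
  have tau0: "c * lam j \<ge> 0" if "j \<in> {1..N}" for j using c cov_eigenvalue_nonneg[OF gp ob that] by simp
  define t where "t j = c * lam j / (1 + c * lam j)" for j
  define B where "B = (\<Sum>j=1..N. t j + (t j * (y \<bullet> e j) - fv \<bullet> e j)\<^sup>2)"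
  define h0 where "h0 j = exp (- (y \<bullet> e j)\<^sup>2 / (2 * (1 + c * lam j))) / sqrt (1 + c * lam j)" for j
  define b where "b j = (y \<bullet> e j + 2 * th * (fv \<bullet> e j)) / a" for j
  define h1 where "h1 j = exp (- a * (b j)\<^sup>2 / (2 * (1 + a * (c * lam j)))) / sqrt (1 + a * (c * lam j))" for j
  define d where "d j = exp (- th * (y \<bullet> e j - fv \<bullet> e j)\<^sup>2 / a)" for j
  have pars: "sqnorm (nvec N (\<lambda>i. sqrt c * W (x i) v) - z)
     = (\<Sum>j=1..N. (nvec N (\<lambda>i. sqrt c * W (x i) v) \<bullet> e j - z \<bullet> e j)\<^sup>2)" if z: "z \<in> carrier_vec N" for z v
  proof -
    have n: "nvec N (\<lambda>i. sqrt c * W (x i) v) \<in> carrier_vec N" by (simp add: nvec_def)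
    have "sqnorm (nvec N (\<lambda>i. sqrt c * W (x i) v) - z) = (\<Sum>j=1..N. ((nvec N (\<lambda>i. sqrt c * W (x i) v) - z) \<bullet> e j)\<^sup>2)"
      unfolding sqnorm_def power2_eq_square using n z by (intro eigenbasis_parseval[OF ob]) auto
    also have "\<dots> = (\<Sum>j=1..N. (nvec N (\<lambda>i. sqrt c * W (x i) v) \<bullet> e j - z \<bullet> e j)\<^sup>2)"
    proof (intro sum.cong refl)
      fix j assume "j \<in> {1..N}"
      then have "e j \<in> carrier_vec N" using ob by (auto simp: orthonormal_eigenbasis_def)
      then show "((nvec N (\<lambda>i. sqrt c * W (x i) v) - z) \<bullet> e j)\<^sup>2 = (nvec N (\<lambda>i. sqrt c * W (x i) v) \<bullet> e j - z \<bullet> e j)\<^sup>2"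
        using n z by (simp add: minus_scalar_prod_distrib[of _ N])
    qed
    finally show ?thesis .
  qed
  have H0: "(\<integral>w. exp (- Q w / 2) \<partial>Pr) = (\<Prod>j=1..N. h0 j)"
  proof -
    have "(\<integral>w. exp (- Q w / 2) \<partial>Pr) = (\<integral>v. exp (- Q (\<lambda>p. sqrt c * W p v) / 2) \<partial>MW)"
      unfolding Pr_def prior_def by (rule integral_distr[OF T]) measurable
    also have "\<dots> = (\<Prod>j=1..N. h0 j)"
      using gp_quadratic_exp[OF gp ob c, of 1 "\<lambda>j. y \<bullet> e j"] by (simp add: Q_def pars[OF y] h0_def)
    finally show ?thesis .
  qed
  have H1: "(\<integral>w. exp (- Q w / 2 - th * S w) \<partial>Pr) = (\<Prod>j=1..N. d j * h1 j)"
  proof -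
    have "(\<integral>w. exp (- Q w / 2 - th * S w) \<partial>Pr)
       = (\<integral>v. exp (- Q (\<lambda>p. sqrt c * W p v) / 2 - th * S (\<lambda>p. sqrt c * W p v)) \<partial>MW)"
      unfolding Pr_def prior_def by (rule integral_distr[OF T]) measurable
    also have "\<dots> = (\<integral>v. (\<Prod>j=1..N. d j) *
        exp (- a * (\<Sum>j=1..N. (nvec N (\<lambda>i. sqrt c * W (x i) v) \<bullet> e j - b j)\<^sup>2) / 2) \<partial>MW)"
    proof (intro Bochner_Integration.integral_cong refl)
      fix v
      let ?v = "\<lambda>j. nvec N (\<lambda>i. sqrt c * W (x i) v) \<bullet> e j"
      \<comment> \<open>Completing the square: \<open>b j\<close> is the average of the observation
        and the truth, weighted by \<open>1 / a\<close> and \<open>2 * th / a\<close>, and the part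
        independent of the coordinate of the process goes into \<open>d j\<close>.\<close>
      have sq: "(?v j - y \<bullet> e j)\<^sup>2 / 2 + th * (?v j - fv \<bullet> e j)\<^sup>2
         = th * (y \<bullet> e j - fv \<bullet> e j)\<^sup>2 / a + a * (?v j - b j)\<^sup>2 / 2" for j
      proof -
        have *: "a * ((V - Y)\<^sup>2 + 2 * th * (V - F)\<^sup>2) = 2 * th * (Y - F)\<^sup>2 + (a * V - (Y + 2 * th * F))\<^sup>2" for V Y F :: real
          unfolding a_def by (simp add: power2_eq_square algebra_simps)
        have "a * (?v j - b j) = a * ?v j - (y \<bullet> e j + 2 * th * (fv \<bullet> e j))"
          using a by (simp add: b_def field_simps)
        moreover have "a * (a * (?v j - b j)\<^sup>2) = (a * (?v j - b j))\<^sup>2"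
          by (simp add: power2_eq_square mult_ac)
        ultimately have "a * (a * (?v j - b j)\<^sup>2) = (a * ?v j - (y \<bullet> e j + 2 * th * (fv \<bullet> e j)))\<^sup>2"
          by (simp only:)
        with *[of "?v j" "y \<bullet> e j" "fv \<bullet> e j"] a show ?thesis by (simp add: field_simps)
      qed
      have "- Q (\<lambda>p. sqrt c * W p v) / 2 - th * S (\<lambda>p. sqrt c * W p v)
         = - (\<Sum>j=1..N. (?v j - y \<bullet> e j)\<^sup>2 / 2 + th * (?v j - fv \<bullet> e j)\<^sup>2)"
        unfolding Q_def S_def pars[OF y] pars[OF fv] by (simp add: sum.distrib sum_divide_distrib sum_distrib_left)
      also have "\<dots> = (\<Sum>j=1..N. - th * (y \<bullet> e j - fv \<bullet> e j)\<^sup>2 / a) + - a * (\<Sum>j=1..N. (?v j - b j)\<^sup>2) / 2"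
        unfolding sq by (simp add: sum.distrib sum_divide_distrib sum_distrib_left sum_negf)
      finally show "exp (- Q (\<lambda>p. sqrt c * W p v) / 2 - th * S (\<lambda>p. sqrt c * W p v))
         = (\<Prod>j=1..N. d j) * exp (- a * (\<Sum>j=1..N. (?v j - b j)\<^sup>2) / 2)"
        unfolding d_def by (simp only: exp_add exp_sum finite_atLeastAtMost)
    qed
    also have "\<dots> = (\<Prod>j=1..N. d j) * (\<Prod>j=1..N. h1 j)"
      using gp_quadratic_exp[OF gp ob c, of a b] a by (simp add: h1_def)
    finally show ?thesis by (simp add: prod.distrib)
  qed
  define H0v where "H0v = (\<Prod>j=1..N. h0 j)"
  have H0pos: "H0v > 0"
    unfolding H0v_def h0_def using tau0 by (intro prod_pos) (auto intro!: divide_pos_pos add_pos_nonneg)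
  \<comment> \<open>Jensen's inequality for the posterior mean of \<open>exp (- th * S)\<close>,
    multiplied by the normalising constant; it is assembled from the explicit coordinate
    formulas.\<close>
  have "exp (- th * B) * H0v = (\<Prod>j=1..N. exp (- th * (t j + (t j * (y \<bullet> e j) - fv \<bullet> e j)\<^sup>2)) * h0 j)"
    unfolding prod.distrib H0v_def B_def sum_distrib_left by (simp add: exp_sum)
  also have "\<dots> \<le> (\<Prod>j=1..N. d j * h1 j)"
  proof (intro prod_mono conjI)
    fix j assume j: "j \<in> {1..N}"
    show "exp (- th * (t j + (t j * (y \<bullet> e j) - fv \<bullet> e j)\<^sup>2)) * h0 j \<le> d j * h1 j"
      unfolding t_def h0_def d_def h1_def b_def a_def
      by (rule posterior_coordinate_laplace) (use th tau0[OF j] in auto)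
    show "0 \<le> exp (- th * (t j + (t j * (y \<bullet> e j) - fv \<bullet> e j)\<^sup>2)) * h0 j"
      unfolding h0_def using tau0[OF j] by simp
  qed
  finally have HH: "exp (- th * B) * H0v \<le> (\<integral>w. exp (- Q w / 2 - th * S w) \<partial>Pr)" unfolding H1 .
  define K where "K = (1 / sqrt (2 * pi)) ^ N"
  have K: "K > 0" by (simp add: K_def)
  have L: "likelihood N x y w = K * exp (- Q w / 2)" for w
    unfolding K_def Q_def by (rule likelihood_eq_exp[OF y])
  have Z: "(\<integral>w. likelihood N x y w \<partial>Pr) = K * H0v" unfolding L H0v_def H0[symmetric] by simp
  have dens: "likelihood N x y w / (\<integral>w. likelihood N x y w \<partial>Pr) = exp (- Q w / 2) / H0v" for w
    by (subst Z) (use K in \<open>simp add: L\<close>)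
  have post: "posterior MW W N x c y = density Pr (\<lambda>w. ennreal (exp (- Q w / 2) / H0v))"
    unfolding posterior_def Pr_def[symmetric] dens ..
  define A where "A = {w. S w \<ge> s}"
  have "A = {w \<in> space Pr. S w \<ge> s}" by (auto simp: A_def Pr_def prior_def space_PiM)
  then have A [measurable]: "A \<in> sets Pr" by simp
  \<comment> \<open>On \<open>A\<close> the factor \<open>2 * (1 - exp (- th * S))\<close> is at
    least 1, because \<open>exp (- 1)\<close> is at most \<open>1 / 2\<close>; so \<open>G\<close>
    dominates the posterior density there.\<close>
  define G where "G w = 2 * (exp (- Q w / 2) - exp (- Q w / 2 - th * S w)) / H0v" for w
  have G0: "G w \<ge> 0" for w using H0pos th QS by (simp add: G_def)
  have G: "exp (- Q w / 2) / H0v * indicator A w \<le> G w" for w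
  proof (cases "w \<in> A")
    case True
    then have "1 \<le> th * S w" using s by (simp add: A_def th_def)
    have "exp (- (th * S w)) \<le> exp (- 1)" using \<open>1 \<le> th * S w\<close> by simp
    also have "\<dots> \<le> 1 / (2::real)" using exp_ge_add_one_self[of 1] by (simp add: exp_minus divide_simps)
    finally have "1 \<le> 2 * (1 - exp (- (th * S w)))" by simp
    then have "exp (- Q w / 2) * 1 \<le> exp (- Q w / 2) * (2 * (1 - exp (- (th * S w))))"
      by (intro mult_left_mono) auto
    also have "\<dots> = 2 * (exp (- Q w / 2) - exp (- Q w / 2 - th * S w))"
    proof -
      have "exp (- Q w / 2 - th * S w) = exp (- Q w / 2) * exp (- (th * S w))" by (simp flip: exp_add)
      then show ?thesis by (simp only:) (simp add: algebra_simps)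
    qed
    finally show ?thesis using True H0pos by (simp add: G_def divide_right_mono)
  qed (use G0 in auto)
  have i1: "integrable Pr (\<lambda>w. exp (- Q w / 2))"
    by (rule Pr.integrable_const_bound[where B = 1]) (use QS in auto)
  have i2: "integrable Pr (\<lambda>w. exp (- Q w / 2 - th * S w))"
  proof (rule Pr.integrable_const_bound[where B = 1])
    have "- Q w / 2 - th * S w \<le> 0" for w using QS[of w] th mult_nonneg_nonneg[of th "S w"] by linarith
    then show "AE w in Pr. norm (exp (- Q w / 2 - th * S w)) \<le> 1" by simp
  qed simp
  have "emeasure (posterior MW W N x c y) A = (\<integral>\<^sup>+w. ennreal (exp (- Q w / 2) / H0v) * indicator A w \<partial>Pr)"
    unfolding post by (rule emeasure_density) measurable
  also have "\<dots> \<le> (\<integral>\<^sup>+w. ennreal (G w) \<partial>Pr)"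
  proof (intro nn_integral_mono)
    fix w
    show "ennreal (exp (- Q w / 2) / H0v) * indicator A w \<le> ennreal (G w)"
      using G[of w] by (cases "w \<in> A") (auto intro: ennreal_leI)
  qed
  also have "\<dots> = ennreal (\<integral>w. G w \<partial>Pr)"
    unfolding G_def using i1 i2 G0[unfolded G_def] by (intro nn_integral_eq_integral) auto
  finally have "measure (posterior MW W N x c y) A \<le> (\<integral>w. G w \<partial>Pr)"
    unfolding measure_def using G0 by (intro enn2real_leI) auto
  also have "\<dots> = 2 * (H0v - (\<integral>w. exp (- Q w / 2 - th * S w) \<partial>Pr)) / H0v"
    unfolding G_def using i1 i2 H0 by (simp add: H0v_def)
  also have "\<dots> \<le> 2 * (H0v - exp (- th * B) * H0v) / H0v"
    using HH H0pos by (intro divide_right_mono) auto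
  also have "\<dots> = 2 * (1 - exp (- th * B))" using H0pos by (simp add: field_simps)
  also have "\<dots> \<le> 2 * (th * B)" using exp_ge_add_one_self[of "- th * B"] by simp
  finally show ?thesis by (simp add: A_def S_def th_def B_def t_def)
qed

section \<open>Spectral sums\<close>

text \<open>The shrinkage factor of a coordinate with signal-to-noise ratio \<open>x\<close>. Both
  \<open>s2\<close> and \<open>D2R\<close> are sums over it, of first and second powers, so
  \<open>s2 = O(D2R)\<close> says that the values strictly between 0 and 1 do not dominate.\<close>

definition sat :: "real \<Rightarrow> real" where "sat x = x / (1 + x)"

lemma sat_nonneg: "x \<ge> 0 \<Longrightarrow> sat x \<ge> 0" and sat_le_1: "x \<ge> 0 \<Longrightarrow> sat x \<le> 1"
  and sat_le: "x \<ge> 0 \<Longrightarrow> sat x \<le> x" and sat_ge_half: "x \<ge> 1 \<Longrightarrow> sat x \<ge> 1 / 2"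
  by (auto simp: sat_def field_simps)

lemma sat_mono: "0 \<le> x \<Longrightarrow> x \<le> y \<Longrightarrow> sat x \<le> sat y"
  by (auto simp: sat_def field_simps)

lemma sat_scale_le: "x \<ge> 0 \<Longrightarrow> a \<ge> 1 \<Longrightarrow> sat (a * x) \<le> a * sat x"
  unfolding sat_def times_divide_eq_right
  by (intro divide_left_mono mult_nonneg_nonneg mult_pos_pos add_pos_nonneg)
     (auto simp: mult_le_cancel_right1)

lemma sat_scale_ge: "x \<ge> 0 \<Longrightarrow> 0 \<le> a \<Longrightarrow> a \<le> 1 \<Longrightarrow> sat (a * x) \<ge> a * sat x"
  unfolding sat_def times_divide_eq_right
  by (intro divide_left_mono mult_nonneg_nonneg mult_pos_pos add_pos_nonneg)
     (auto simp: mult_left_le_one_le)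

section \<open>Tail sums of negative powers\<close>

lemma powr_neg_telescope:
  fixes a :: real
  assumes "a > 1" "j \<ge> (2::nat)"
  shows "(a - 1) * real j powr (- a) \<le> real (j - 1) powr (1 - a) - real j powr (1 - a)"
proof -
  have "\<exists>z. real (j - 1) < z \<and> z < real j \<and>
     real j powr (1 - a) - real (j - 1) powr (1 - a) = (real j - real (j - 1)) * ((1 - a) * z powr (1 - a - 1))"
    using assms by (intro MVT2) (auto intro!: derivative_eq_intros simp: of_nat_diff)
  then obtain z where z: "real (j - 1) < z" "z < real j"
    "real j powr (1 - a) - real (j - 1) powr (1 - a) = (1 - a) * z powr (- a)"
    using assms by (auto simp: of_nat_diff)
  have "z > 0" using z(1) by (meson le_less_trans of_nat_0_le_iff)
  then have "real j powr (- a) \<le> z powr (- a)" using z assms by (intro powr_mono2') auto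
  then have "(a - 1) * real j powr (- a) \<le> (a - 1) * z powr (- a)" using assms by simp
  then show ?thesis using z(3) by (simp add: algebra_simps)
qed

lemma powr_neg_tail_sum:
  fixes a :: real
  assumes "a > 1" "J \<ge> (1::nat)"
  shows "(\<Sum>j\<in>{J<..n}. real j powr (- a)) \<le> real J powr (1 - a) / (a - 1)"
proof (cases "J \<le> n")
  case True
  have "(a - 1) * (\<Sum>j\<in>{J<..n}. real j powr (- a)) \<le> real J powr (1 - a) - real n powr (1 - a)"
    using True
  proof (induction n rule: dec_induct)
    case base then show ?case by simp
  next
    case (step n)
    have "{J<..Suc n} = insert (Suc n) {J<..n}" using step by auto
    then show ?case using step powr_neg_telescope[of a "Suc n"] assms by (simp add: algebra_simps)
  qed
  also have "\<dots> \<le> real J powr (1 - a)" by simp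
  finally show ?thesis using assms by (simp add: field_simps)
qed (use assms in auto)

lemma nat_floor_bounds:
  fixes K :: real
  assumes "K \<ge> 1"
  shows "nat \<lfloor>K\<rfloor> \<ge> 1" "real (nat \<lfloor>K\<rfloor>) \<le> K" "K \<le> 2 * real (nat \<lfloor>K\<rfloor>)"
proof -
  have "1 \<le> \<lfloor>K\<rfloor>" using assms by simp
  moreover from this have "real (nat \<lfloor>K\<rfloor>) = of_int \<lfloor>K\<rfloor>" "1 \<le> real_of_int \<lfloor>K\<rfloor>" by auto
  moreover have "of_int \<lfloor>K\<rfloor> \<le> K" "K < of_int \<lfloor>K\<rfloor> + 1" by linarith+
  ultimately show "nat \<lfloor>K\<rfloor> \<ge> 1" "real (nat \<lfloor>K\<rfloor>) \<le> K" "K \<le> 2 * real (nat \<lfloor>K\<rfloor>)"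
    by linarith+
qed

text \<open>Comparison with the integral of \<open>x powr (- a)\<close> beyond \<open>K\<close>,
  which gives a bound linear in \<open>K\<close>. Starting the sum at the floor of \<open>K\<close>,
  which is at least \<open>K / 2\<close>, costs the factor \<open>2 powr (a - 1)\<close>.\<close>

lemma powr_ratio_tail_sum:
  fixes a K :: real
  assumes a: "a > 1" and K: "K \<ge> 1"
  shows "(\<Sum>j | j \<in> {1..n} \<and> real j > K. (K / real j) powr a) \<le> 2 powr (a - 1) / (a - 1) * K"
proof -
  define J where "J = nat \<lfloor>K\<rfloor>"
  have J: "J \<ge> 1" "real J \<le> K" "K \<le> 2 * real J" unfolding J_def by (rule nat_floor_bounds[OF K])+
  have "{j \<in> {1..n}. real j > K} = {J<..n}"
    using K unfolding J_def by (auto; linarith)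
  then have "(\<Sum>j | j \<in> {1..n} \<and> real j > K. (K / real j) powr a) = (\<Sum>j\<in>{J<..n}. K powr a * real j powr (- a))"
    using K by (auto simp: powr_divide powr_minus_divide intro!: sum.cong)
  also have "\<dots> \<le> K powr a * (real J powr (1 - a) / (a - 1))"
    unfolding sum_distrib_left[symmetric] using powr_neg_tail_sum[OF a J(1)] by (intro mult_left_mono) auto
  also have "real J powr (1 - a) \<le> (K / 2) powr (1 - a)"
    using J a K by (intro powr_mono2') auto
  then have "K powr a * (real J powr (1 - a) / (a - 1)) \<le> K powr a * ((K / 2) powr (1 - a) / (a - 1))"
    using a by (intro mult_left_mono divide_right_mono) auto
  also have "\<dots> = (K powr a * K powr (1 - a)) * (2 powr (a - 1) / (a - 1))"
    using K powr_minus[of 2 "a - 1"] by (simp add: powr_divide divide_simps mult.commute)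
  also have "K powr a * K powr (1 - a) = K" using K by (simp add: powr_add[symmetric])
  finally show ?thesis by (simp add: mult.commute)
qed

lemma card_le_floor:
  fixes K :: real
  assumes "K \<ge> 1" "K \<le> real n"
  shows "K / 2 \<le> real (card {j \<in> {1..n}. real j \<le> K})"
proof -
  have "{j \<in> {1..n}. real j \<le> K} = {1..nat \<lfloor>K\<rfloor>}" using assms by (auto; linarith)
  then have "card {j \<in> {1..n}. real j \<le> K} = nat \<lfloor>K\<rfloor>" by simp
  then show "K / 2 \<le> real (card {j \<in> {1..n}. real j \<le> K})"
    using nat_floor_bounds[OF assms(1)] by auto
qed

lemma sum_split_threshold:
  fixes h :: "nat \<Rightarrow> real" and K :: real
  shows "(\<Sum>j=1..n. h j) = (\<Sum>j | j \<in> {1..n} \<and> real j \<le> K. h j) + (\<Sum>j | j \<in> {1..n} \<and> real j > K. h j)"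
proof -
  have "{1..n} = {j. j \<in> {1..n} \<and> real j \<le> K} \<union> {j. j \<in> {1..n} \<and> real j > K}" by auto
  then show ?thesis by (subst \<open>{1..n} = _\<close>, intro sum.union_disjoint) auto
qed

text \<open>Up to the threshold \<open>K\<close> the factor \<open>sat\<close> is at least
  \<open>1 / 2\<close>, so the weight there is at most 4 times the sum of squares. Beyond
  \<open>K\<close> it is at most its argument, so a tail controlled by the weight up to
  \<open>K\<close> is harmless. Unit weights serve for a single row, weights \<open>j\<close> for
  pairs with maximum \<open>j\<close>.\<close>

lemma weighted_sat_sum:
  fixes m :: real and w :: "nat \<Rightarrow> real"
  assumes K: "K \<ge> 1" and w: "\<And>j. w j \<ge> 0" and C: "C \<ge> 0" and m: "m > 0"
    and tail: "K \<le> real n \<Longrightarrow> (\<Sum>j | j \<in> {1..n} \<and> real j > K. w j * (K / real j) powr m)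
       \<le> C * (\<Sum>j | j \<in> {1..n} \<and> real j \<le> K. w j)"
  shows "(\<Sum>j=1..n. w j * sat ((K / real j) powr m)) \<le> (4 + 4 * C) * (\<Sum>j=1..n. w j * (sat ((K / real j) powr m))\<^sup>2)"
    and "(\<Sum>j | j \<in> {1..n} \<and> real j \<le> K. w j) \<le> 4 * (\<Sum>j=1..n. w j * (sat ((K / real j) powr m))\<^sup>2)"
proof -
  let ?s = "\<lambda>j. sat ((K / real j) powr m)" and ?L = "{j. j \<in> {1..n} \<and> real j \<le> K}"
  have "w j \<le> 4 * (w j * (?s j)\<^sup>2)" if "j \<in> ?L" for j
  proof -
    have "1 powr m \<le> (K / real j) powr m" using that m by (intro powr_mono2) auto
    then have "?s j \<ge> 1 / 2" by (intro sat_ge_half) simp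
    then have "(?s j)\<^sup>2 \<ge> (1/2)\<^sup>2" by (intro power_mono) auto
    then have "w j * (1/2)\<^sup>2 \<le> w j * (?s j)\<^sup>2" using w by (intro mult_left_mono) auto
    then show ?thesis by (simp add: power_divide)
  qed
  then have "(\<Sum>j\<in>?L. w j) \<le> (\<Sum>j\<in>?L. 4 * (w j * (?s j)\<^sup>2))" by (rule sum_mono)
  also have "\<dots> \<le> (\<Sum>j=1..n. 4 * (w j * (?s j)\<^sup>2))" using w by (intro sum_mono2) auto
  finally show low: "(\<Sum>j\<in>?L. w j) \<le> 4 * (\<Sum>j=1..n. w j * (?s j)\<^sup>2)" by (simp add: sum_distrib_left)
  have up: "(\<Sum>j | j \<in> {1..n} \<and> real j > K. w j * ?s j) \<le> C * (\<Sum>j\<in>?L. w j)"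
  proof (cases "K \<le> real n")
    case True
    have "(\<Sum>j | j \<in> {1..n} \<and> real j > K. w j * ?s j) \<le> (\<Sum>j | j \<in> {1..n} \<and> real j > K. w j * (K / real j) powr m)"
      using w by (intro sum_mono mult_left_mono sat_le) auto
    then show ?thesis using tail[OF True] by linarith
  next
    case False
    then have "{j. j \<in> {1..n} \<and> real j > K} = {}" by auto
    then show ?thesis using w C by (simp only: sum.empty) (intro mult_nonneg_nonneg sum_nonneg, auto)
  qed
  have "(\<Sum>j\<in>?L. w j * ?s j) \<le> (\<Sum>j\<in>?L. w j * 1)"
    using w by (intro sum_mono mult_left_mono sat_le_1) auto
  then have "(\<Sum>j=1..n. w j * ?s j) \<le> (1 + C) * (\<Sum>j\<in>?L. w j)"
    using up sum_split_threshold[of "\<lambda>j. w j * ?s j" n K] by (simp add: algebra_simps)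
  also have "\<dots> \<le> (1 + C) * (4 * (\<Sum>j=1..n. w j * (?s j)\<^sup>2))" using low C by (intro mult_left_mono) auto
  finally show "(\<Sum>j=1..n. w j * ?s j) \<le> (4 + 4 * C) * (\<Sum>j=1..n. w j * (?s j)\<^sup>2)"
    by (simp add: algebra_simps)
qed

definition tail_const :: "real \<Rightarrow> real" where "tail_const a = 2 powr (a - 1) / (a - 1)"

lemma row_sat_sum:
  fixes m K :: real
  assumes m: "m > 1" and K: "K \<ge> 1"
  shows "(\<Sum>j=1..n. sat ((K / real j) powr m)) \<le> (4 + 8 * tail_const m) * (\<Sum>j=1..n. (sat ((K / real j) powr m))\<^sup>2)"
    and "K \<le> real n \<Longrightarrow> K \<le> 8 * (\<Sum>j=1..n. (sat ((K / real j) powr m))\<^sup>2)"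
proof -
  have c0: "tail_const m \<ge> 0" using m by (simp add: tail_const_def)
  \<comment> \<open>The factor 2 is the loss from rounding: at least \<open>K / 2\<close> indices
    lie below \<open>K\<close>.\<close>
  have t: "(\<Sum>j | j \<in> {1..n} \<and> real j > K. 1 * (K / real j) powr m) \<le> 2 * tail_const m * (\<Sum>j | j \<in> {1..n} \<and> real j \<le> K. 1)"
    if Kn: "K \<le> real n"
  proof -
    have "tail_const m * (K / 2) \<le> tail_const m * real (card {j \<in> {1..n}. real j \<le> K})"
      using c0 card_le_floor[OF K Kn] by (intro mult_left_mono) auto
    then show ?thesis using powr_ratio_tail_sum[OF m K, of n, folded tail_const_def] by simp
  qed
  note * = weighted_sat_sum[where w = "\<lambda>_. 1" and C = "2 * tail_const m", OF K _ _ _ t]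
  show "(\<Sum>j=1..n. sat ((K / real j) powr m)) \<le> (4 + 8 * tail_const m) * (\<Sum>j=1..n. (sat ((K / real j) powr m))\<^sup>2)"
    using *(1) c0 m by simp
  show "K \<le> 8 * (\<Sum>j=1..n. (sat ((K / real j) powr m))\<^sup>2)" if "K \<le> real n"
    using *(2) c0 m card_le_floor[OF K that] by simp
qed

text \<open>Rows with \<open>i \<le> K\<close> are compared one by one; the remaining rows together contribute \<open>O(K)\<close>,
  which the first row alone outweighs.\<close>

lemma product_sat_sum:
  fixes m K :: real
  assumes m: "m > 1" and K: "K \<ge> 1" and n: "n \<ge> 1"
  defines "s \<equiv> \<lambda>i j. sat ((K / (real i * real j)) powr m)"
  shows "(\<Sum>i=1..n. \<Sum>j=1..n. s i j) \<le>
     (4 + 8 * tail_const m + 8 * tail_const m * (1 + tail_const m)) * (\<Sum>i=1..n. \<Sum>j=1..n. (s i j)\<^sup>2)"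
    and "K \<le> (real n)\<^sup>2 \<Longrightarrow> sqrt K \<le> 8 * (\<Sum>i=1..n. \<Sum>j=1..n. (s i j)\<^sup>2)"
proof -
  let ?T = "tail_const m"
  have c0: "?T \<ge> 0" using m by (simp add: tail_const_def)
  have s: "s i j = sat ((K / real i / real j) powr m)" for i j by (simp add: s_def)
  have first: "(\<Sum>j=1..n. (s 1 j)\<^sup>2) \<le> (\<Sum>i=1..n. \<Sum>j=1..n. (s i j)\<^sup>2)"
    using n by (intro member_le_sum) (auto intro!: sum_nonneg)
  have low: "(\<Sum>i | i \<in> {1..n} \<and> real i \<le> K. \<Sum>j=1..n. s i j) \<le> (4 + 8 * ?T) * (\<Sum>i=1..n. \<Sum>j=1..n. (s i j)\<^sup>2)"
  proof -
    have "(\<Sum>i | i \<in> {1..n} \<and> real i \<le> K. \<Sum>j=1..n. s i j)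
      \<le> (\<Sum>i | i \<in> {1..n} \<and> real i \<le> K. (4 + 8 * ?T) * (\<Sum>j=1..n. (s i j)\<^sup>2))"
      unfolding s by (intro sum_mono row_sat_sum(1) m) (auto simp: field_simps)
    also have "\<dots> \<le> (\<Sum>i=1..n. (4 + 8 * ?T) * (\<Sum>j=1..n. (s i j)\<^sup>2))"
      using c0 by (intro sum_mono2) (auto intro!: mult_nonneg_nonneg sum_nonneg)
    finally show ?thesis by (simp add: sum_distrib_left)
  qed
  have high: "(\<Sum>i | i \<in> {1..n} \<and> real i > K. \<Sum>j=1..n. s i j)
      \<le> 8 * ?T * (1 + ?T) * (\<Sum>i=1..n. \<Sum>j=1..n. (s i j)\<^sup>2)"
  proof (cases "K \<le> real n")
    case True
    \<comment> \<open>The crude bound of \<open>sat\<close> by its argument: the sum of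
      \<open>1 / j powr m\<close> is 1 from the first term plus the tail constant at threshold
      1.\<close>
    have row: "(\<Sum>j=1..n. s i j) \<le> (1 + ?T) * (K / real i) powr m" if "i \<ge> 1" for i
    proof -
      have "(\<Sum>j=1..n. s i j) \<le> (\<Sum>j=1..n. (K / real i) powr m * (1 / real j) powr m)"
      proof (rule sum_mono)
        fix j
        show "s i j \<le> (K / real i) powr m * (1 / real j) powr m"
          unfolding s by (rule order_trans[OF sat_le]) (use K in \<open>auto simp flip: powr_mult\<close>)
      qed
      also have "\<dots> = (K / real i) powr m * ((\<Sum>j | j \<in> {1..n} \<and> real j \<le> 1. (1 / real j) powr m)
           + (\<Sum>j | j \<in> {1..n} \<and> real j > 1. (1 / real j) powr m))"
        unfolding sum_distrib_left[symmetric] sum_split_threshold[where K = 1] ..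
      also have "{j. j \<in> {1..n} \<and> real j \<le> 1} = {1}" using n by auto
      also have "(K / real i) powr m * ((\<Sum>j\<in>{1}. (1 / real j) powr m) + (\<Sum>j | j \<in> {1..n} \<and> real j > 1. (1 / real j) powr m))
         \<le> (K / real i) powr m * (1 + ?T)"
        using powr_ratio_tail_sum[OF m, of 1 n] by (intro mult_left_mono add_mono) (auto simp: tail_const_def)
      finally show ?thesis by (simp add: mult.commute)
    qed
    have "(\<Sum>i | i \<in> {1..n} \<and> real i > K. \<Sum>j=1..n. s i j) \<le> (\<Sum>i | i \<in> {1..n} \<and> real i > K. (1 + ?T) * (K / real i) powr m)"
      by (intro sum_mono row) auto
    also have "\<dots> \<le> (1 + ?T) * (?T * K)"
      unfolding sum_distrib_left[symmetric] using c0 powr_ratio_tail_sum[OF m K, of n]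
      by (intro mult_left_mono) (auto simp: tail_const_def)
    also have "K \<le> 8 * (\<Sum>j=1..n. (s 1 j)\<^sup>2)" unfolding s using row_sat_sum(2)[OF m K True] by simp
    then have "(1 + ?T) * (?T * K) \<le> (1 + ?T) * (?T * (8 * (\<Sum>i=1..n. \<Sum>j=1..n. (s i j)\<^sup>2)))"
      using c0 first by (intro mult_left_mono) auto
    finally show ?thesis by (simp add: algebra_simps)
  next
    case False
    then have "{i. i \<in> {1..n} \<and> real i > K} = {}" by auto
    then show ?thesis using c0 by (simp only: sum.empty) (intro mult_nonneg_nonneg sum_nonneg, auto)
  qed
  show "(\<Sum>i=1..n. \<Sum>j=1..n. s i j) \<le> (4 + 8 * ?T + 8 * ?T * (1 + ?T)) * (\<Sum>i=1..n. \<Sum>j=1..n. (s i j)\<^sup>2)"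
    using low high sum_split_threshold[of "\<lambda>i. \<Sum>j=1..n. s i j" n K] by (simp add: algebra_simps)
  \<comment> \<open>Here \<open>K\<close> may be as large as \<open>n\<^sup>2\<close>, beyond the
    length of a row. The first row is therefore tested at the smaller threshold
    \<open>sqrt K\<close>, which is at most \<open>n\<close>.\<close>
  show "sqrt K \<le> 8 * (\<Sum>i=1..n. \<Sum>j=1..n. (s i j)\<^sup>2)" if "K \<le> (real n)\<^sup>2"
  proof -
    have k: "1 \<le> sqrt K" "sqrt K \<le> real n" using K that by (auto intro: real_le_lsqrt)
    have kK: "sqrt K \<le> K" using K by (intro real_le_lsqrt) (auto simp: power2_eq_square)
    have "sqrt K \<le> 8 * (\<Sum>j=1..n. (sat ((sqrt K / real j) powr m))\<^sup>2)" by (rule row_sat_sum(2)[OF m k])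
    also have "\<dots> \<le> 8 * (\<Sum>j=1..n. (s 1 j)\<^sup>2)"
      unfolding s using kK m K by (intro mult_left_mono sum_mono power_mono sat_mono powr_mono2 sat_nonneg)
        (auto intro!: divide_right_mono)
    finally show ?thesis using first by linarith
  qed
qed

text \<open>There are \<open>2 * l - 1\<close> pairs with maximum \<open>l\<close>, hence between
  \<open>l\<close> and \<open>2 * l\<close>. The double sum thus reduces, up to a factor 2, to a
  single sum with weights \<open>l\<close>.\<close>

lemma max_sat_sum:
  fixes m k :: real
  assumes m: "m > 1" and k: "k \<ge> 1"
  defines "s \<equiv> \<lambda>i j. sat ((k / real (max i j)) powr (2 * m))"
  shows "(\<Sum>i=1..n. \<Sum>j=1..n. s i j) \<le> (8 + 128 * tail_const (2 * m - 1)) * (\<Sum>i=1..n. \<Sum>j=1..n. (s i j)\<^sup>2)"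
    and "k \<le> real n \<Longrightarrow> k \<le> 32 * (\<Sum>i=1..n. \<Sum>j=1..n. (s i j)\<^sup>2)"
proof -
  let ?T = "tail_const (2 * m - 1)"
  have c0: "?T \<ge> 0" using m by (simp add: tail_const_def)
  define G where "G = (\<lambda>j. sat ((k / real j) powr (2 * m)))"
  have G0: "G j \<ge> 0" for j by (simp add: G_def sat_nonneg)
  have s: "s i j = G (max i j)" for i j by (simp add: s_def G_def)
  have sum_le: "(\<Sum>j=1..n. if j \<le> i then h else 0) = real i * h" if "i \<le> n" for i h
  proof -
    have "(\<Sum>j=1..n. if j \<le> i then h else 0) = (\<Sum>j\<in>{j\<in>{1..n}. j \<le> i}. h)"
      by (simp add: sum.inter_filter[symmetric])
    moreover have "{j\<in>{1..n}. j \<le> i} = {1..i}" using that by auto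
    ultimately show ?thesis by simp
  qed
  have up: "(\<Sum>i=1..n. \<Sum>j=1..n. s i j) \<le> 2 * (\<Sum>i=1..n. real i * G i)"
  proof -
    have "(\<Sum>i=1..n. \<Sum>j=1..n. s i j) \<le> (\<Sum>i=1..n. \<Sum>j=1..n. (if j \<le> i then G i else 0) + (if i \<le> j then G j else 0))"
      unfolding s using G0 by (intro sum_mono) (auto simp: max_def)
    also have "\<dots> = (\<Sum>i=1..n. \<Sum>j=1..n. if j \<le> i then G i else 0) + (\<Sum>j=1..n. \<Sum>i=1..n. if i \<le> j then G j else 0)"
      unfolding sum.distrib by (subst (3) sum.swap) simp
    also have "\<dots> = (\<Sum>i=1..n. real i * G i) + (\<Sum>j=1..n. real j * G j)"
      by (intro arg_cong2[where f = "(+)"] sum.cong refl sum_le) auto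
    also have "\<dots> = 2 * (\<Sum>i=1..n. real i * G i)" by simp
    finally show ?thesis .
  qed
  have dn: "(\<Sum>i=1..n. real i * (G i)\<^sup>2) \<le> (\<Sum>i=1..n. \<Sum>j=1..n. (s i j)\<^sup>2)"
  proof -
    have "(\<Sum>i=1..n. real i * (G i)\<^sup>2) = (\<Sum>i=1..n. \<Sum>j=1..n. if j \<le> i then (G i)\<^sup>2 else 0)"
      by (intro sum.cong refl sum_le[symmetric]) auto
    also have "\<dots> \<le> (\<Sum>i=1..n. \<Sum>j=1..n. (s i j)\<^sup>2)" unfolding s by (intro sum_mono) (auto simp: max_def)
    finally show ?thesis .
  qed
  \<comment> \<open>The sum of the integers up to \<open>J\<close> is at least half of
    \<open>J\<^sup>2\<close>, and \<open>J\<close> is at least \<open>k / 2\<close>.\<close>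
  have area: "k\<^sup>2 / 8 \<le> (\<Sum>j | j \<in> {1..n} \<and> real j \<le> k. real j)" if kn: "k \<le> real n"
  proof -
    define J where "J = nat \<lfloor>k\<rfloor>"
    have J: "J \<ge> 1" "real J \<le> k" "k / 2 \<le> real J" using nat_floor_bounds[OF k] unfolding J_def by auto
    have "{j. j \<in> {1..n} \<and> real j \<le> k} = {1..J}" using k kn unfolding J_def by (auto; linarith)
    moreover have "(\<Sum>j=1..J. real j) = real J * (real J + 1) / 2" by (induction J) (auto simp: field_simps)
    moreover have "(k / 2)\<^sup>2 \<le> (real J)\<^sup>2" using J k by (intro power_mono) auto
    ultimately show ?thesis by (simp add: power2_eq_square algebra_simps)
  qed
  have t: "(\<Sum>j | j \<in> {1..n} \<and> real j > k. real j * (k / real j) powr (2 * m))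
     \<le> 8 * ?T * (\<Sum>j | j \<in> {1..n} \<and> real j \<le> k. real j)" if kn: "k \<le> real n"
  proof -
    \<comment> \<open>One factor \<open>k / j\<close> absorbs the weight \<open>j\<close> into
      \<open>k\<close>, so the tail has exponent \<open>2 * m - 1\<close>, which still exceeds
      1.\<close>
    have "(\<Sum>j | j \<in> {1..n} \<and> real j > k. real j * (k / real j) powr (2 * m))
       = (\<Sum>j | j \<in> {1..n} \<and> real j > k. k * (k / real j) powr (2 * m - 1))"
    proof (intro sum.cong refl)
      fix j assume "j \<in> {j. j \<in> {1..n} \<and> real j > k}"
      then have "j > 0" by auto
      then show "real j * (k / real j) powr (2 * m) = k * (k / real j) powr (2 * m - 1)"
        using k powr_add[of "k / real j" "2 * m - 1" 1] by simp
    qed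
    also have "\<dots> \<le> k * (?T * k)"
      unfolding sum_distrib_left[symmetric] using k m powr_ratio_tail_sum[of "2 * m - 1" k n]
      by (intro mult_left_mono) (auto simp: tail_const_def)
    finally show ?thesis using mult_left_mono[OF area[OF kn] c0] by (simp add: power2_eq_square mult_ac)
  qed
  have 1: "(\<Sum>j=1..n. real j * G j) \<le> (4 + 4 * (8 * ?T)) * (\<Sum>j=1..n. real j * (G j)\<^sup>2)"
    and 2: "(\<Sum>j | j \<in> {1..n} \<and> real j \<le> k. real j) \<le> 4 * (\<Sum>j=1..n. real j * (G j)\<^sup>2)"
    unfolding G_def using weighted_sat_sum[where w = real and C = "8 * ?T", OF k _ _ _ t] c0 m by auto
  have "(4 + 4 * (8 * ?T)) * (\<Sum>j=1..n. real j * (G j)\<^sup>2) \<le> (4 + 4 * (8 * ?T)) * (\<Sum>i=1..n. \<Sum>j=1..n. (s i j)\<^sup>2)"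
    using dn c0 by (intro mult_left_mono) auto
  then have "(\<Sum>i=1..n. \<Sum>j=1..n. s i j) \<le> 2 * ((4 + 4 * (8 * ?T)) * (\<Sum>i=1..n. \<Sum>j=1..n. (s i j)\<^sup>2))"
    using up 1 by linarith
  also have "\<dots> = (8 + 64 * ?T) * (\<Sum>i=1..n. \<Sum>j=1..n. (s i j)\<^sup>2)" by (simp add: algebra_simps)
  also have "\<dots> \<le> (8 + 128 * ?T) * (\<Sum>i=1..n. \<Sum>j=1..n. (s i j)\<^sup>2)"
    using c0 by (intro mult_right_mono sum_nonneg) auto
  finally show "(\<Sum>i=1..n. \<Sum>j=1..n. s i j) \<le> (8 + 128 * ?T) * (\<Sum>i=1..n. \<Sum>j=1..n. (s i j)\<^sup>2)" .
  show "k \<le> 32 * (\<Sum>i=1..n. \<Sum>j=1..n. (s i j)\<^sup>2)" if "k \<le> real n"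
  proof -
    have "k \<le> k\<^sup>2" using k by (simp add: power2_eq_square)
    then show ?thesis using area[OF that] 2 dn by linarith
  qed
qed

section \<open>Comparison of the remainders with the risk\<close>

text \<open>Splitting \<open>(Z j)\<^sup>2\<close> into 1 and its centred part produces a
  deterministic sum and exactly \<open>- R2R\<close>. The deterministic sum is at most
  \<open>2 * s2\<close>, since \<open>1 - r\<^sup>2 \<le> 2 * (1 - r)\<close>.\<close>

lemma weighted_squares_le:
  assumes lam: "\<And>j. j \<in> {1..N} \<Longrightarrow> lam j \<ge> 0" and c: "c \<ge> 0"
  shows "(\<Sum>j=1..N. (1 - 1 / (1 + c * lam j)\<^sup>2) * (Z j)\<^sup>2) \<le> 2 * s2 N lam c + \<bar>R2R N lam Z c\<bar>"
proof -
  have "(\<Sum>j=1..N. (1 - 1 / (1 + c * lam j)\<^sup>2) * (Z j)\<^sup>2)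
      \<le> (\<Sum>j=1..N. 2 * (c * lam j / (1 + c * lam j)) - ((Z j)\<^sup>2 - 1) * (1 / (1 + c * lam j)\<^sup>2 - 1))"
  proof (rule sum_mono)
    fix j assume "j \<in> {1..N}"
    then have p: "1 + c * lam j > 0" using lam[of j] c by (simp add: add_pos_nonneg)
    define r where "r = 1 / (1 + c * lam j)"
    have t: "c * lam j / (1 + c * lam j) = 1 - r" using p by (simp add: r_def field_simps)
    have r2: "1 / (1 + c * lam j)\<^sup>2 = r\<^sup>2" by (simp add: r_def power_divide)
    have "0 \<le> (1 - r)\<^sup>2" by simp
    then have "1 - r\<^sup>2 \<le> 2 * (1 - r)" by (simp add: power2_eq_square algebra_simps)
    then show "(1 - 1 / (1 + c * lam j)\<^sup>2) * (Z j)\<^sup>2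
      \<le> 2 * (c * lam j / (1 + c * lam j)) - ((Z j)\<^sup>2 - 1) * (1 / (1 + c * lam j)\<^sup>2 - 1)"
      unfolding t r2 by (simp add: algebra_simps)
  qed
  also have "\<dots> = 2 * s2 N lam c - R2R N lam Z c"
    by (simp add: s2_def R2R_def sum_subtractf sum_distrib_left)
  finally show ?thesis by linarith
qed

text \<open>The error of the posterior mean is \<open>(1 - r) * Z - r * g\<close>. Its square is
  split by \<open>(u - v)\<^sup>2 \<le> 2 * u\<^sup>2 + 2 * v\<^sup>2\<close>, and
  \<open>(1 - r)\<^sup>2 \<le> 1 - r\<^sup>2\<close> brings the noise part under
  \<open>weighted_squares_le\<close>. The 5 is 1 for the posterior variance and 4 for the
  noise.\<close>

lemma posterior_second_moment_le:
  assumes lam: "\<And>j. j \<in> {1..N} \<Longrightarrow> lam j \<ge> 0" and c: "c \<ge> 0"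
  shows "(\<Sum>j=1..N. c * lam j / (1 + c * lam j) + (c * lam j / (1 + c * lam j) * (g j + Z j) - g j)\<^sup>2)
    \<le> 5 * s2 N lam c + 2 * D1R N lam g c + 2 * \<bar>R2R N lam Z c\<bar>"
proof -
  have "(\<Sum>j=1..N. c * lam j / (1 + c * lam j) + (c * lam j / (1 + c * lam j) * (g j + Z j) - g j)\<^sup>2)
    \<le> (\<Sum>j=1..N. c * lam j / (1 + c * lam j) + 2 * ((g j)\<^sup>2 / (1 + c * lam j)\<^sup>2)
         + 2 * ((1 - 1 / (1 + c * lam j)\<^sup>2) * (Z j)\<^sup>2))"
  proof (rule sum_mono)
    fix j assume "j \<in> {1..N}"
    then have p: "1 + c * lam j \<ge> 1" using lam[of j] c by simp
    define r where "r = 1 / (1 + c * lam j)"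
    have t: "c * lam j / (1 + c * lam j) = 1 - r" using p by (simp add: r_def field_simps)
    have r2: "(g j)\<^sup>2 / (1 + c * lam j)\<^sup>2 = r\<^sup>2 * (g j)\<^sup>2" "1 / (1 + c * lam j)\<^sup>2 = r\<^sup>2"
      by (simp_all add: r_def power_divide)
    have r: "0 \<le> r" "r \<le> 1" using p by (auto simp: r_def)
    have "0 \<le> 2 * r * (1 - r) * (Z j)\<^sup>2" using r by simp
    then have "(1 - r)\<^sup>2 * (Z j)\<^sup>2 \<le> (1 - r\<^sup>2) * (Z j)\<^sup>2" by (simp add: power2_eq_square algebra_simps)
    moreover have "((1 - r) * (g j + Z j) - g j)\<^sup>2 \<le> 2 * (r\<^sup>2 * (g j)\<^sup>2) + 2 * ((1 - r)\<^sup>2 * (Z j)\<^sup>2)"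
    proof -
      have "0 \<le> ((1 - r) * Z j + r * g j)\<^sup>2" by simp
      then show ?thesis by (simp add: power2_eq_square algebra_simps)
    qed
    ultimately show "c * lam j / (1 + c * lam j) + (c * lam j / (1 + c * lam j) * (g j + Z j) - g j)\<^sup>2
      \<le> c * lam j / (1 + c * lam j) + 2 * ((g j)\<^sup>2 / (1 + c * lam j)\<^sup>2)
         + 2 * ((1 - 1 / (1 + c * lam j)\<^sup>2) * (Z j)\<^sup>2)"
      unfolding t r2 by linarith
  qed
  also have "\<dots> = s2 N lam c + 2 * D1R N lam g c + 2 * (\<Sum>j=1..N. (1 - 1 / (1 + c * lam j)\<^sup>2) * (Z j)\<^sup>2)"
    by (simp add: s2_def D1R_def sum.distrib sum_distrib_left)
  also have "\<dots> \<le> s2 N lam c + 2 * D1R N lam g c + 2 * (2 * s2 N lam c + \<bar>R2R N lam Z c\<bar>)"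
    using weighted_squares_le[where N = N and lam = lam and Z = Z, OF lam c] by simp
  finally show ?thesis by simp
qed

section \<open>Dependence of the risk and of the remainders on \<open>c\<close>\<close>

lemma D1R_nonneg: "D1R N lam g c \<ge> 0" and D2R_nonneg: "D2R N lam c \<ge> 0"
  by (auto simp: D1R_def D2R_def intro!: sum_nonneg)

lemma s2_nonneg:
  assumes "\<And>j. j \<in> {1..N} \<Longrightarrow> lam j \<ge> 0" "c \<ge> 0"
  shows "s2 N lam c \<ge> 0"
  unfolding s2_def using assms by (intro sum_nonneg divide_nonneg_nonneg) auto

lemma D2R_mono:
  assumes lam: "\<And>j. j \<in> {1..N} \<Longrightarrow> lam j \<ge> 0" and c: "0 \<le> c" "c \<le> c'"
  shows "D2R N lam c \<le> D2R N lam c'"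
  unfolding D2R_def
proof (rule sum_mono)
  fix j assume "j \<in> {1..N}"
  then have "sat (c * lam j) \<le> sat (c' * lam j)" "0 \<le> sat (c * lam j)"
    using lam c by (auto intro!: sat_mono sat_nonneg mult_right_mono)
  then have "(sat (c * lam j))\<^sup>2 \<le> (sat (c' * lam j))\<^sup>2" by (intro power_mono)
  then show "(c * lam j)\<^sup>2 / (1 + c * lam j)\<^sup>2 \<le> (c' * lam j)\<^sup>2 / (1 + c' * lam j)\<^sup>2"
    by (simp add: sat_def power_divide)
qed

text \<open>Since \<open>1 + q * x \<le> q * (1 + x)\<close> for \<open>q \<ge> 1\<close>, enlarging
  \<open>c\<close> by a factor \<open>q\<close> shrinks each term by at most
  \<open>q\<^sup>2\<close>.\<close>

lemma D1R_scale:
  assumes lam: "\<And>j. j \<in> {1..N} \<Longrightarrow> lam j \<ge> 0" and c: "0 \<le> c" "c \<le> q * c0" "0 \<le> c0" "1 \<le> q"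
  shows "D1R N lam g c0 \<le> q\<^sup>2 * D1R N lam g c"
  unfolding D1R_def sum_distrib_left
proof (rule sum_mono)
  fix j assume "j \<in> {1..N}"
  then have l: "lam j \<ge> 0" by (rule lam)
  have p: "1 + c * lam j > 0" "1 + c0 * lam j > 0" using l c by (auto intro!: add_pos_nonneg)
  have "c * lam j \<le> q * c0 * lam j" using c l by (intro mult_right_mono) auto
  then have "1 + c * lam j \<le> q * (1 + c0 * lam j)" using c by (simp add: algebra_simps)
  then have "(1 + c * lam j)\<^sup>2 \<le> (q * (1 + c0 * lam j))\<^sup>2" using p by (intro power_mono) auto
  then have "(g j)\<^sup>2 * (1 + c * lam j)\<^sup>2 \<le> (g j)\<^sup>2 * (q\<^sup>2 * (1 + c0 * lam j)\<^sup>2)"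
    by (intro mult_left_mono) (auto simp: power_mult_distrib)
  then show "(g j)\<^sup>2 / (1 + c0 * lam j)\<^sup>2 \<le> q\<^sup>2 * ((g j)\<^sup>2 / (1 + c * lam j)\<^sup>2)"
    using p by (simp add: divide_simps mult_ac)
qed

text \<open>With \<open>r = 1 / (1 + c * lam j)\<close> the relative decrease of \<open>r\<close>
  from \<open>c0\<close> to \<open>c\<close> is at most \<open>\<eta> * (1 - r c0 j)\<close>. The
  factor \<open>1 - r c0 j\<close> is what makes the noise summable. The bounds involve values at
  \<open>c0\<close> only, so control at a grid point covers the whole interval to its right.\<close>

lemma remainder_increments:
  assumes lam: "\<And>j. j \<in> {1..N} \<Longrightarrow> lam j \<ge> 0" and c: "0 \<le> c0" "c0 \<le> c" "c \<le> (1 + \<eta>) * c0" and eta: "\<eta> \<ge> 0"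
  shows "\<bar>R1R N lam g Z c - R1R N lam g Z c0\<bar> \<le> 2 * \<eta> * (2 * s2 N lam c0 + \<bar>R2R N lam Z c0\<bar> + D1R N lam g c0)"
    and "\<bar>R2R N lam Z c - R2R N lam Z c0\<bar> \<le> 2 * \<eta> * (3 * s2 N lam c0 + \<bar>R2R N lam Z c0\<bar>)"
proof -
  define r where "r c j = 1 / (1 + c * lam j)" for c j
  have t: "c0 * lam j / (1 + c0 * lam j) = 1 - r c0 j" and r2: "1 / (1 + c * lam j)\<^sup>2 = (r c j)\<^sup>2"
    and rng: "0 \<le> r c0 j" "r c0 j \<le> 1"
    and diff: "\<bar>(r c j)\<^sup>2 - (r c0 j)\<^sup>2\<bar> \<le> 2 * \<eta> * ((1 - r c0 j) * (r c0 j)\<^sup>2)"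
    if j: "j \<in> {1..N}" for j
  proof -
    have p: "1 + c0 * lam j \<ge> 1" "1 + c * lam j \<ge> 1" using lam[OF j] c by auto
    show t: "c0 * lam j / (1 + c0 * lam j) = 1 - r c0 j" using p by (simp add: r_def field_simps)
    show "1 / (1 + c * lam j)\<^sup>2 = (r c j)\<^sup>2" by (simp add: r_def power_divide)
    show rng: "0 \<le> r c0 j" "r c0 j \<le> 1" using p by (auto simp: r_def)
    have rc: "0 \<le> r c j" using p by (auto simp: r_def)
    have le: "r c j \<le> r c0 j"
      unfolding r_def using p lam[OF j] c by (intro divide_left_mono) (auto intro!: mult_right_mono mult_pos_pos add_pos_nonneg)
    have eq: "r c0 j - r c j = (c * lam j - c0 * lam j) * (r c0 j * r c j)"
      using p by (simp add: r_def divide_simps)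
    have "c * lam j \<le> (1 + \<eta>) * c0 * lam j" using c lam[OF j] by (intro mult_right_mono) auto
    then have "c * lam j - c0 * lam j \<le> \<eta> * (c0 * lam j)" by (simp add: algebra_simps)
    then have "r c0 j - r c j \<le> \<eta> * (c0 * lam j) * (r c0 j * r c j)"
      unfolding eq using rng rc by (intro mult_right_mono) auto
    also have "\<dots> = \<eta> * (1 - r c0 j) * r c j" unfolding t[symmetric] by (simp add: r_def)
    also have "\<dots> \<le> \<eta> * (1 - r c0 j) * r c0 j" using le eta rng by (intro mult_left_mono) auto
    finally have 1: "r c0 j - r c j \<le> \<eta> * (1 - r c0 j) * r c0 j" .
    have "(r c0 j - r c j) * (r c0 j + r c j) \<le> (\<eta> * (1 - r c0 j) * r c0 j) * (2 * r c0 j)"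
      using 1 le rc rng eta by (intro mult_mono) auto
    moreover have "\<bar>(r c j)\<^sup>2 - (r c0 j)\<^sup>2\<bar> = (r c0 j - r c j) * (r c0 j + r c j)"
    proof -
      have "(r c j)\<^sup>2 \<le> (r c0 j)\<^sup>2" using le rc by (intro power_mono)
      then show ?thesis by (simp add: power2_eq_square algebra_simps)
    qed
    ultimately show "\<bar>(r c j)\<^sup>2 - (r c0 j)\<^sup>2\<bar> \<le> 2 * \<eta> * ((1 - r c0 j) * (r c0 j)\<^sup>2)"
      by (simp add: power2_eq_square algebra_simps)
  qed
  have r20: "1 / (1 + c0 * lam j)\<^sup>2 = (r c0 j)\<^sup>2" for j by (simp add: r_def power_divide)
  define Q where "Q = (\<Sum>j=1..N. (1 - (r c0 j)\<^sup>2) * (Z j)\<^sup>2)"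
  have Q: "Q \<le> 2 * s2 N lam c0 + \<bar>R2R N lam Z c0\<bar>"
    using weighted_squares_le[where N = N and lam = lam and Z = Z, OF lam c(1)] unfolding Q_def r20 by simp
  have "\<bar>R1R N lam g Z c - R1R N lam g Z c0\<bar> = \<bar>\<Sum>j=1..N. 2 * (Z j * g j * ((r c j)\<^sup>2 - (r c0 j)\<^sup>2))\<bar>"
    unfolding R1R_def by (simp add: sum_distrib_left sum_subtractf r_def power_divide algebra_simps)
  also have "\<dots> \<le> (\<Sum>j=1..N. \<bar>2 * (Z j * g j * ((r c j)\<^sup>2 - (r c0 j)\<^sup>2))\<bar>)" by (rule sum_abs)
  also have "\<dots> \<le> (\<Sum>j=1..N. 2 * \<eta> * ((1 - (r c0 j)\<^sup>2) * (Z j)\<^sup>2 + (g j)\<^sup>2 / (1 + c0 * lam j)\<^sup>2))"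
  proof (rule sum_mono)
    fix j assume j: "j \<in> {1..N}"
    define a where "a = (1 - r c0 j) * r c0 j"
    note rg = rng[OF j]
    have a: "0 \<le> a" "a \<le> 1 - r c0 j" using rg by (auto simp: a_def mult_left_le)
    have "a\<^sup>2 \<le> (1 - r c0 j)\<^sup>2" using a by (intro power_mono)
    also have "\<dots> \<le> 1 - (r c0 j)\<^sup>2" using rg mult_left_le[of "r c0 j" "r c0 j"] by (simp add: power2_eq_square algebra_simps)
    finally have a2: "a\<^sup>2 * (Z j)\<^sup>2 \<le> (1 - (r c0 j)\<^sup>2) * (Z j)\<^sup>2" by (rule mult_right_mono) simp
    have "\<bar>2 * (Z j * g j * ((r c j)\<^sup>2 - (r c0 j)\<^sup>2))\<bar> = 2 * (\<bar>Z j\<bar> * \<bar>g j\<bar>) * \<bar>(r c j)\<^sup>2 - (r c0 j)\<^sup>2\<bar>"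
      by (simp add: abs_mult)
    also have "\<dots> \<le> 2 * (\<bar>Z j\<bar> * \<bar>g j\<bar>) * (2 * \<eta> * ((1 - r c0 j) * (r c0 j)\<^sup>2))"
      by (intro mult_left_mono diff j) auto
    \<comment> \<open>The product is distributed so that the arithmetic-geometric inequality pairs
      \<open>g j\<close> with the weight of \<open>D1R\<close> and \<open>Z j\<close> with a weight
      whose square is at most \<open>1 - (r c0 j)\<^sup>2\<close>.\<close>
    also have "\<dots> = 2 * \<eta> * (2 * (a * \<bar>Z j\<bar>) * (r c0 j * \<bar>g j\<bar>))" by (simp add: a_def power2_eq_square)
    also have "\<dots> \<le> 2 * \<eta> * ((a * \<bar>Z j\<bar>)\<^sup>2 + (r c0 j * \<bar>g j\<bar>)\<^sup>2)"
      using eta by (intro mult_left_mono sum_squares_bound) auto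
    also have "\<dots> \<le> 2 * \<eta> * ((1 - (r c0 j)\<^sup>2) * (Z j)\<^sup>2 + (g j)\<^sup>2 / (1 + c0 * lam j)\<^sup>2)"
      using eta a2 by (intro mult_left_mono add_mono) (auto simp: power_mult_distrib r_def power_divide)
    finally show "\<bar>2 * (Z j * g j * ((r c j)\<^sup>2 - (r c0 j)\<^sup>2))\<bar>
      \<le> 2 * \<eta> * ((1 - (r c0 j)\<^sup>2) * (Z j)\<^sup>2 + (g j)\<^sup>2 / (1 + c0 * lam j)\<^sup>2)" .
  qed
  also have "\<dots> = 2 * \<eta> * (Q + D1R N lam g c0)"
    by (simp add: Q_def D1R_def sum_distrib_left sum.distrib distrib_left)
  also have "\<dots> \<le> 2 * \<eta> * (2 * s2 N lam c0 + \<bar>R2R N lam Z c0\<bar> + D1R N lam g c0)"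
    using Q eta by (intro mult_left_mono) auto
  finally show "\<bar>R1R N lam g Z c - R1R N lam g Z c0\<bar> \<le> 2 * \<eta> * (2 * s2 N lam c0 + \<bar>R2R N lam Z c0\<bar> + D1R N lam g c0)" .
  have "\<bar>R2R N lam Z c - R2R N lam Z c0\<bar> = \<bar>\<Sum>j=1..N. ((Z j)\<^sup>2 - 1) * ((r c j)\<^sup>2 - (r c0 j)\<^sup>2)\<bar>"
    unfolding R2R_def by (simp add: sum_subtractf[symmetric] r_def power_divide algebra_simps)
  also have "\<dots> \<le> (\<Sum>j=1..N. \<bar>((Z j)\<^sup>2 - 1) * ((r c j)\<^sup>2 - (r c0 j)\<^sup>2)\<bar>)" by (rule sum_abs)
  also have "\<dots> \<le> (\<Sum>j=1..N. 2 * \<eta> * ((1 - (r c0 j)\<^sup>2) * (Z j)\<^sup>2 + c0 * lam j / (1 + c0 * lam j)))"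
  proof (rule sum_mono)
    fix j assume j: "j \<in> {1..N}"
    note rg = rng[OF j]
    have le1: "(1 - r c0 j) * (r c0 j)\<^sup>2 \<le> (1 - r c0 j) * 1" using rg by (intro mult_left_mono power_le_one) auto
    have d: "\<bar>(r c j)\<^sup>2 - (r c0 j)\<^sup>2\<bar> \<le> 2 * \<eta> * (1 - r c0 j)"
      using diff[OF j] eta mult_left_mono[OF le1, of "2 * \<eta>"] by simp
    have z: "\<bar>(Z j)\<^sup>2 - 1\<bar> \<le> (Z j)\<^sup>2 + 1" using zero_le_power2[of "Z j"] by linarith
    have "1 - r c0 j \<le> 1 - (r c0 j)\<^sup>2" using rg mult_left_le[of "r c0 j" "r c0 j"] by (simp add: power2_eq_square)
    then have u: "(1 - r c0 j) * (Z j)\<^sup>2 \<le> (1 - (r c0 j)\<^sup>2) * (Z j)\<^sup>2" by (rule mult_right_mono) simp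
    have "\<bar>((Z j)\<^sup>2 - 1) * ((r c j)\<^sup>2 - (r c0 j)\<^sup>2)\<bar> \<le> ((Z j)\<^sup>2 + 1) * (2 * \<eta> * (1 - r c0 j))"
      unfolding abs_mult by (intro mult_mono z d) auto
    also have "\<dots> = 2 * \<eta> * ((1 - r c0 j) * (Z j)\<^sup>2 + (1 - r c0 j))" by (simp add: algebra_simps)
    also have "\<dots> \<le> 2 * \<eta> * ((1 - (r c0 j)\<^sup>2) * (Z j)\<^sup>2 + (1 - r c0 j))"
      using u eta by (intro mult_left_mono) auto
    finally show "\<bar>((Z j)\<^sup>2 - 1) * ((r c j)\<^sup>2 - (r c0 j)\<^sup>2)\<bar>
      \<le> 2 * \<eta> * ((1 - (r c0 j)\<^sup>2) * (Z j)\<^sup>2 + c0 * lam j / (1 + c0 * lam j))" unfolding t[OF j] .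
  qed
  also have "\<dots> = 2 * \<eta> * (Q + s2 N lam c0)"
    by (simp add: Q_def s2_def sum_distrib_left sum.distrib distrib_left)
  also have "\<dots> \<le> 2 * \<eta> * (3 * s2 N lam c0 + \<bar>R2R N lam Z c0\<bar>)"
    using Q eta by (intro mult_left_mono) auto
  finally show "\<bar>R2R N lam Z c - R2R N lam Z c0\<bar> \<le> 2 * \<eta> * (3 * s2 N lam c0 + \<bar>R2R N lam Z c0\<bar>)" .
qed

text \<open>Bookkeeping in units of the risk \<open>D\<close> at \<open>c0\<close>: the two
  remainders there take \<open>1 / 16\<close>, the increments at most
  \<open>2 * \<eta> * (5 * C + 2)\<close>, again at most \<open>1 / 16\<close>. The resulting
  \<open>D / 8\<close> suffices because \<open>D\<close> is at most 4 times the risk at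
  \<open>c\<close>: the \<open>D1R\<close> part loses at most \<open>(1 + \<eta>)\<^sup>2\<close>,
  the \<open>D2R\<close> part increases.\<close>

lemma remainder_bound_from_grid:
  assumes lam: "\<And>j. j \<in> {1..N} \<Longrightarrow> lam j \<ge> 0" and c: "0 \<le> c0" "c0 \<le> c" "c \<le> (1 + \<eta>) * c0"
    and eta: "0 \<le> \<eta>" "\<eta> \<le> 1" "8 * \<eta> * (5 * C + 2) \<le> 1 / 4"
    and s: "s2 N lam c0 \<le> C * D2R N lam c0" and C: "C \<ge> 0"
    and R: "\<bar>R1R N lam g Z c0\<bar> \<le> DR N lam g c0 / 32" "\<bar>R2R N lam Z c0\<bar> \<le> DR N lam g c0 / 32"
  shows "\<bar>R1R N lam g Z c\<bar> + \<bar>R2R N lam Z c\<bar> \<le> DR N lam g c / 2"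
proof -
  define D where "D = DR N lam g c0"
  have D1: "D1R N lam g c0 \<le> D" and D2: "D2R N lam c0 \<le> D" and D0: "D \<ge> 0"
    using D1R_nonneg[of N lam g c0] D2R_nonneg[of N lam c0] by (auto simp: D_def DR_def)
  have s: "s2 N lam c0 \<le> C * D" using s mult_left_mono[OF D2 C] by linarith
  have "\<bar>R1R N lam g Z c\<bar> + \<bar>R2R N lam Z c\<bar> \<le> \<bar>R1R N lam g Z c0\<bar> + \<bar>R2R N lam Z c0\<bar>
     + 2 * \<eta> * (5 * s2 N lam c0 + 2 * \<bar>R2R N lam Z c0\<bar> + D1R N lam g c0)"
    using remainder_increments(1)[where N = N and lam = lam and g = g and Z = Z, OF lam c eta(1)]
      remainder_increments(2)[where N = N and lam = lam and Z = Z, OF lam c eta(1)] by (simp add: algebra_simps)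
  also have "\<dots> \<le> D / 32 + D / 32 + 2 * \<eta> * (5 * (C * D) + 2 * (D / 32) + D)"
    using R s D1 eta by (intro add_mono mult_left_mono) (auto simp: D_def)
  also have "\<dots> \<le> D / 16 + 2 * \<eta> * ((5 * C + 2) * D)"
    using D0 eta by (intro add_mono mult_left_mono) (auto simp: algebra_simps)
  also have "\<dots> = (1 / 4 + 8 * \<eta> * (5 * C + 2)) * D / 4" by (simp add: algebra_simps)
  also have "\<dots> \<le> (1 / 2) * D / 4" using eta D0 by (intro divide_right_mono mult_right_mono) auto
  finally have 1: "\<bar>R1R N lam g Z c\<bar> + \<bar>R2R N lam Z c\<bar> \<le> D / 8" by simp
  have q: "(1 + \<eta>)\<^sup>2 \<le> 2\<^sup>2" using eta by (intro power_mono) auto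
  have "D1R N lam g c0 \<le> (1 + \<eta>)\<^sup>2 * D1R N lam g c"
    using c eta by (intro D1R_scale lam) auto
  also have "\<dots> \<le> 4 * D1R N lam g c" using q D1R_nonneg by (intro mult_right_mono) auto
  finally have "D1R N lam g c0 \<le> 4 * D1R N lam g c" .
  moreover have "D2R N lam c0 \<le> D2R N lam c" by (intro D2R_mono lam c(1,2))
  ultimately have "D \<le> 4 * DR N lam g c" using D2R_nonneg[of N lam c] by (simp add: D_def DR_def)
  then show ?thesis using 1 by simp
qed

text \<open>The criterion lies between half and three halves of the risk at both points, whence the
  factor 3. In \<open>5 * C + 3\<close> the summands come from \<open>s2\<close>, from
  \<open>2 * D1R\<close> and from \<open>2 * |R2R|\<close>, the last at most one multiple of the
  risk.\<close>

lemma empirical_minimiser_bound: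
  assumes lam: "\<And>j. j \<in> {1..N} \<Longrightarrow> lam j \<ge> 0" and h: "h \<ge> 0"
    and good: "\<bar>R1R N lam g Z h\<bar> + \<bar>R2R N lam Z h\<bar> \<le> DR N lam g h / 2"
      "\<bar>R1R N lam g Z c\<bar> + \<bar>R2R N lam Z c\<bar> \<le> DR N lam g c / 2"
    and min: "DR N lam g h + R1R N lam g Z h + R2R N lam Z h \<le> DR N lam g c + R1R N lam g Z c + R2R N lam Z c"
    and s: "s2 N lam h \<le> C * D2R N lam h" and C: "C \<ge> 0"
  shows "(\<Sum>j=1..N. h * lam j / (1 + h * lam j) + (h * lam j / (1 + h * lam j) * (g j + Z j) - g j)\<^sup>2)
    \<le> 3 * (5 * C + 3) * DR N lam g c"
proof -
  have D: "D1R N lam g h \<le> DR N lam g h" "D2R N lam h \<le> DR N lam g h" "DR N lam g h \<ge> 0"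
    using D1R_nonneg[of N lam g h] D2R_nonneg[of N lam h] by (auto simp: DR_def)
  have "s2 N lam h \<le> C * DR N lam g h" using s mult_left_mono[OF D(2) C] by linarith
  then have "(\<Sum>j=1..N. h * lam j / (1 + h * lam j) + (h * lam j / (1 + h * lam j) * (g j + Z j) - g j)\<^sup>2)
    \<le> 5 * (C * DR N lam g h) + 2 * DR N lam g h + DR N lam g h"
    using posterior_second_moment_le[where N = N and lam = lam and g = g and Z = Z, OF lam h] D good(1) by linarith
  also have "\<dots> = (5 * C + 3) * DR N lam g h" by (simp add: algebra_simps)
  also have "\<dots> \<le> (5 * C + 3) * (3 * DR N lam g c)"
    using good min C by (intro mult_left_mono) (auto simp: abs_if split: if_splits)
  finally show ?thesis by (simp only: mult_ac)
qed

section \<open>Moments of the noise coordinates\<close>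

lemma (in prob_space) std_normal_moments:
  assumes D: "distributed M lborel X std_normal_density"
  shows "integrable M (\<lambda>\<omega>. (X \<omega>) ^ k)" "expectation X = 0" "expectation (\<lambda>\<omega>. (X \<omega>)\<^sup>2) = 1"
    "expectation (\<lambda>\<omega>. (X \<omega>) ^ 4) = 3"
proof -
  show "integrable M (\<lambda>\<omega>. (X \<omega>) ^ k)"
    using distributed_integrable[OF D, of "\<lambda>x. x ^ k"] integrable_std_normal_moment[of k] by simp
  show "expectation X = 0" by (rule standard_normal_distributed_expectation[OF D])
  have e: "expectation (\<lambda>\<omega>. (X \<omega>) ^ (2 * k)) = fact (2 * k) / (2 ^ k * fact k)" for k
    using distributed_integral[OF D, of "\<lambda>x. x ^ (2 * k)"] integral_std_normal_moment_even[of k] by simp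
  show "expectation (\<lambda>\<omega>. (X \<omega>)\<^sup>2) = 1" using e[of 1] by simp
  show "expectation (\<lambda>\<omega>. (X \<omega>) ^ 4) = 3" using e[of 2] by (simp add: fact_numeral)
qed

lemma (in prob_space) normal_linear_moments:
  fixes X :: "'i \<Rightarrow> 'a \<Rightarrow> real" and b :: "'i \<Rightarrow> real"
  assumes ind: "indep_vars (\<lambda>_. borel) X S" and S: "finite S"
    and D: "\<And>i. i \<in> S \<Longrightarrow> distributed M lborel (X i) std_normal_density"
  defines "Y \<equiv> \<lambda>\<omega>. \<Sum>i\<in>S. b i * X i \<omega>" and "v \<equiv> \<Sum>i\<in>S. (b i)\<^sup>2"
  shows "integrable M (\<lambda>\<omega>. (Y \<omega>) ^ k)" "expectation Y = 0" "expectation (\<lambda>\<omega>. (Y \<omega>)\<^sup>2) = v"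
    "expectation (\<lambda>\<omega>. (Y \<omega>) ^ 4) = 3 * v\<^sup>2"
proof -
  \<comment> \<open>A zero coefficient gives a constant, which has no normal density, and the sum
    rule for independent normals needs a nonempty index set; so only nonzero coefficients are
    kept.\<close>
  define T where "T = {i\<in>S. b i \<noteq> 0}"
  have T: "T \<subseteq> S" "finite T" using S by (auto simp: T_def)
  have Y: "Y \<omega> = (\<Sum>i\<in>T. b i * X i \<omega>)" for \<omega>
    unfolding Y_def T_def using S by (intro sum.mono_neutral_right) auto
  have v: "v = (\<Sum>i\<in>T. (b i)\<^sup>2)"
    unfolding v_def T_def using S by (intro sum.mono_neutral_right) auto
  have "integrable M (\<lambda>\<omega>. (Y \<omega>) ^ k) \<and> expectation Y = 0 \<and> expectation (\<lambda>\<omega>. (Y \<omega>)\<^sup>2) = v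
    \<and> expectation (\<lambda>\<omega>. (Y \<omega>) ^ 4) = 3 * v\<^sup>2"
  proof (cases "T = {}")
    case True
    then have "Y = (\<lambda>_. 0)" "v = 0" using Y v by auto
    then show ?thesis by simp
  next
    case False
    have "indep_vars (\<lambda>_. borel) (\<lambda>i \<omega>. b i * X i \<omega>) T"
      by (rule indep_vars_compose2[OF indep_vars_subset[OF ind T(1)]]) simp
    moreover have "distributed M lborel (\<lambda>\<omega>. b i * X i \<omega>) (normal_density 0 \<bar>b i\<bar>)" if "i \<in> T" for i
      using normal_density_affine[OF D[of i], of "b i" 0] that by (auto simp: T_def)
    ultimately have "distributed M lborel (\<lambda>\<omega>. \<Sum>i\<in>T. b i * X i \<omega>)
        (normal_density (\<Sum>i\<in>T. 0) (sqrt (\<Sum>i\<in>T. \<bar>b i\<bar>\<^sup>2)))"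
      using T False by (intro sum_indep_normal) (auto simp: T_def)
    moreover define sg where "sg = sqrt v"
    ultimately have DY: "distributed M lborel Y (normal_density 0 sg)"
      unfolding Y[abs_def] sg_def v by simp
    have v0: "v > 0" unfolding v using False T by (intro sum_pos) (auto simp: T_def)
    then have sg: "sg > 0" "sg\<^sup>2 = v" by (auto simp: sg_def)
    have DZ: "distributed M lborel (\<lambda>\<omega>. Y \<omega> / sg) std_normal_density"
      using DY normal_standard_normal_convert[OF sg(1), of Y 0] by simp
    note m = std_normal_moments[OF DZ]
    have eq: "(Y \<omega>) ^ k = sg ^ k * (Y \<omega> / sg) ^ k" for k \<omega> using sg by (simp add: power_divide)
    have e: "expectation (\<lambda>\<omega>. (Y \<omega>) ^ k) = sg ^ k * expectation (\<lambda>\<omega>. (Y \<omega> / sg) ^ k)" for k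
      unfolding eq[of _ k] by (rule integral_mult_right_zero)
    have "integrable M (\<lambda>\<omega>. (Y \<omega>) ^ k)"
      unfolding eq[of _ k] using m(1)[of k] by (rule integrable_mult_right)
    moreover have "expectation Y = sg * expectation (\<lambda>\<omega>. Y \<omega> / sg)"
      using e[of 1] by (simp only: power_one_right)
    then have "expectation Y = 0" by (simp only: m(2) mult_zero_right)
    moreover have "expectation (\<lambda>\<omega>. (Y \<omega>)\<^sup>2) = v" unfolding e[of 2] m(3) using sg by simp
    moreover have "expectation (\<lambda>\<omega>. (Y \<omega>) ^ 4) = 3 * v\<^sup>2"
      unfolding e[of 4] m(4) by (simp flip: sg(2))
    ultimately show ?thesis by blast
  qed
  then show "integrable M (\<lambda>\<omega>. (Y \<omega>) ^ k)" "expectation Y = 0" "expectation (\<lambda>\<omega>. (Y \<omega>)\<^sup>2) = v"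
    "expectation (\<lambda>\<omega>. (Y \<omega>) ^ 4) = 3 * v\<^sup>2" by auto
qed

text \<open>The coordinates of the noise in an orthonormal basis are again standard normal and
  independent; second and fourth moments of linear combinations, combined by polarisation, are
  all that is needed of this.\<close>

lemma (in prob_space) noise_coordinates:
  assumes ind: "indep_vars (\<lambda>_. borel) eps {1..N}"
    and D: "\<forall>i\<in>{1..N}. distributed M lborel (eps i) std_normal_density"
    and ob: "orthonormal_eigenbasis N U lam e"
  defines "Z \<equiv> \<lambda>\<omega> j. nvec N (\<lambda>i. eps i \<omega>) \<bullet> e j"
  defines "Y \<equiv> \<lambda>a \<omega>. \<Sum>j=1..N. a j * Z \<omega> j"
  shows "integrable M (\<lambda>\<omega>. (Y a \<omega>) ^ k)" "expectation (Y a) = 0"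
    "expectation (\<lambda>\<omega>. (Y a \<omega>)\<^sup>2) = (\<Sum>j=1..N. (a j)\<^sup>2)"
    "expectation (\<lambda>\<omega>. (Y a \<omega>) ^ 4) = 3 * (\<Sum>j=1..N. (a j)\<^sup>2)\<^sup>2"
proof -
  \<comment> \<open>The weights \<open>a\<close> rewritten in the standard basis. The shift is
    needed because noise variables are numbered from 1 and vector entries from 0; orthonormality
    preserves the sum of squares.\<close>
  define b where "b i = (\<Sum>j=1..N. a j * e j $ (i - 1))" for i
  have dim: "dim_vec (e j) = N" if "j \<in> {1..N}" for j
    using ob that by (auto simp: orthonormal_eigenbasis_def)
  have on: "(\<Sum>l<N. e j $ l * e p $ l) = (if j = p then 1 else 0)"
    if "j \<in> {1..N}" "p \<in> {1..N}" for j p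
  proof -
    have "e j \<bullet> e p = (if j = p then 1 else 0)"
      using ob that by (auto simp: orthonormal_eigenbasis_def)
    then show ?thesis using dim[OF that(2)] by (simp add: scalar_prod_def lessThan_atLeast0)
  qed
  have Z: "Z \<omega> j = (\<Sum>i=1..N. eps i \<omega> * e j $ (i - 1))" if "j \<in> {1..N}" for \<omega> j
    using dim[OF that] unfolding Z_def
    by (simp add: nvec_def scalar_prod_def lessThan_atLeast0 sum.atLeast1_atMost_eq)
  have Y: "Y a = (\<lambda>\<omega>. \<Sum>i=1..N. b i * eps i \<omega>)"
  proof
    fix \<omega>
    have "Y a \<omega> = (\<Sum>j=1..N. \<Sum>i=1..N. a j * (eps i \<omega> * e j $ (i - 1)))"
      unfolding Y_def sum_distrib_left[symmetric] by (intro sum.cong refl) (simp only: Z)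
    also have "\<dots> = (\<Sum>i=1..N. b i * eps i \<omega>)"
      unfolding b_def sum_distrib_right by (subst sum.swap) (simp add: mult_ac)
    finally show "Y a \<omega> = (\<Sum>i=1..N. b i * eps i \<omega>)" .
  qed
  have v: "(\<Sum>i=1..N. (b i)\<^sup>2) = (\<Sum>j=1..N. (a j)\<^sup>2)"
  proof -
    have "(\<Sum>i=1..N. (b i)\<^sup>2) = (\<Sum>l<N. \<Sum>j=1..N. \<Sum>p=1..N. a j * a p * (e j $ l * e p $ l))"
      unfolding b_def power2_eq_square sum_product by (simp add: sum.atLeast1_atMost_eq mult_ac)
    also have "\<dots> = (\<Sum>j=1..N. \<Sum>p=1..N. \<Sum>l<N. a j * a p * (e j $ l * e p $ l))"
      by (rule sum_rotate[symmetric])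
    also have "\<dots> = (\<Sum>j=1..N. \<Sum>p=1..N. a j * a p * (if j = p then 1 else 0))"
      by (intro sum.cong refl) (simp only: sum_distrib_left[symmetric] on)
    also have "\<dots> = (\<Sum>j=1..N. (a j)\<^sup>2)"
      by (simp add: if_distrib power2_eq_square cong: if_cong)
    finally show ?thesis .
  qed
  note m = normal_linear_moments[OF ind _ bspec[OF D], of b]
  show "integrable M (\<lambda>\<omega>. (Y a \<omega>) ^ k)" "expectation (Y a) = 0"
    "expectation (\<lambda>\<omega>. (Y a \<omega>)\<^sup>2) = (\<Sum>j=1..N. (a j)\<^sup>2)"
    "expectation (\<lambda>\<omega>. (Y a \<omega>) ^ 4) = 3 * (\<Sum>j=1..N. (a j)\<^sup>2)\<^sup>2"
    unfolding Y v[symmetric] using m by simp_all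
qed

text \<open>Choosing \<open>a\<close> supported on one or two indices tests the moments along
  \<open>Z p\<close> and \<open>Z p + s * Z q\<close>. This shows that the variables
  \<open>(Z j)\<^sup>2 - 1\<close> are uncorrelated with variance 2, as for independent standard
  normals.\<close>

lemma (in prob_space) noise_chi_square_variance:
  fixes Z :: "'a \<Rightarrow> nat \<Rightarrow> real" and N :: nat
  defines "Y \<equiv> \<lambda>a \<omega>. \<Sum>j=1..N. a j * Z \<omega> j"
  assumes int: "\<And>a k. integrable M (\<lambda>\<omega>. (Y a \<omega>) ^ k)"
    and m2: "\<And>a. expectation (\<lambda>\<omega>. (Y a \<omega>)\<^sup>2) = (\<Sum>j=1..N. (a j)\<^sup>2)"
    and m4: "\<And>a. expectation (\<lambda>\<omega>. (Y a \<omega>) ^ 4) = 3 * (\<Sum>j=1..N. (a j)\<^sup>2)\<^sup>2"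
  shows "integrable M (\<lambda>\<omega>. (\<Sum>j=1..N. u j * ((Z \<omega> j)\<^sup>2 - 1))\<^sup>2)"
    "expectation (\<lambda>\<omega>. (\<Sum>j=1..N. u j * ((Z \<omega> j)\<^sup>2 - 1))\<^sup>2) = 2 * (\<Sum>j=1..N. (u j)\<^sup>2)"
proof -
  define dl where "dl p j = (if j = p then 1 else (0::real))" for p j :: nat
  have Y1: "Y (dl p) \<omega> = Z \<omega> p" if "p \<in> {1..N}" for p \<omega>
    using that unfolding Y_def dl_def by (simp add: if_distrib if_distribR cong: if_cong)
  have Y2: "Y (\<lambda>j. dl p j + s * dl q j) \<omega> = Z \<omega> p + s * Z \<omega> q" if "p \<in> {1..N}" "q \<in> {1..N}" for p q s \<omega>
  proof -
    have "Y (\<lambda>j. dl p j + s * dl q j) \<omega> = Y (dl p) \<omega> + s * Y (dl q) \<omega>"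
      unfolding Y_def by (simp add: algebra_simps sum.distrib sum_distrib_left)
    then show ?thesis using that by (simp only: Y1)
  qed
  have v1: "(\<Sum>j=1..N. (dl p j)\<^sup>2) = 1" if "p \<in> {1..N}" for p
  proof -
    have "(\<Sum>j=1..N. (dl p j)\<^sup>2) = (\<Sum>j=1..N. if j = p then 1 else 0)"
      by (intro sum.cong refl) (simp add: dl_def)
    then show ?thesis using that by simp
  qed
  have v2: "(\<Sum>j=1..N. (dl p j + s * dl q j)\<^sup>2) = 1 + s\<^sup>2" if "p \<in> {1..N}" "q \<in> {1..N}" "p \<noteq> q" for p q s
  proof -
    have "(dl p j + s * dl q j)\<^sup>2 = (dl p j)\<^sup>2 + s\<^sup>2 * (dl q j)\<^sup>2" for j
      using that(3) by (simp add: dl_def)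
    then have "(\<Sum>j=1..N. (dl p j + s * dl q j)\<^sup>2) = (\<Sum>j=1..N. (dl p j)\<^sup>2) + s\<^sup>2 * (\<Sum>j=1..N. (dl q j)\<^sup>2)"
      by (simp only: sum.distrib sum_distrib_left)
    then show ?thesis unfolding v1[OF that(1)] v1[OF that(2)] by simp
  qed
  have iZ: "integrable M (\<lambda>\<omega>. (Z \<omega> p) ^ k)" if "p \<in> {1..N}" for p k
    using int[of "dl p" k] by (simp only: Y1[OF that])
  have eZ2: "expectation (\<lambda>\<omega>. (Z \<omega> p)\<^sup>2) = 1" if "p \<in> {1..N}" for p
    using m2[of "dl p"] by (simp only: Y1[OF that] v1[OF that])
  have eZ4: "expectation (\<lambda>\<omega>. (Z \<omega> p) ^ 4) = 3" if "p \<in> {1..N}" for p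
    using m4[of "dl p"] unfolding Y1[OF that] v1[OF that] by simp
  \<comment> \<open>Polarisation of the fourth power with signs 1 and -1; the odd mixed terms
    cancel. In expectation it reads \<open>(12 + 12 - 6 - 6) / 12 = 1\<close>.\<close>
  have pol: "(Z \<omega> p)\<^sup>2 * (Z \<omega> q)\<^sup>2 = ((Z \<omega> p + 1 * Z \<omega> q) ^ 4 + (Z \<omega> p + (-1) * Z \<omega> q) ^ 4
       - 2 * (Z \<omega> p) ^ 4 - 2 * (Z \<omega> q) ^ 4) / 12" for p q \<omega>
    by (simp add: power4_eq_xxxx power2_eq_square algebra_simps)
  have iZZ: "integrable M (\<lambda>\<omega>. (Z \<omega> p)\<^sup>2 * (Z \<omega> q)\<^sup>2)"
    and eZZ: "p \<noteq> q \<Longrightarrow> expectation (\<lambda>\<omega>. (Z \<omega> p)\<^sup>2 * (Z \<omega> q)\<^sup>2) = 1"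
    if pq: "p \<in> {1..N}" "q \<in> {1..N}" for p q
  proof -
    have i: "integrable M (\<lambda>\<omega>. (Z \<omega> p + s * Z \<omega> q) ^ 4)" for s
      using int[of "\<lambda>j. dl p j + s * dl q j" 4] by (simp only: Y2[OF pq])
    show "integrable M (\<lambda>\<omega>. (Z \<omega> p)\<^sup>2 * (Z \<omega> q)\<^sup>2)"
      unfolding pol using i[of 1] i[of "-1"] iZ[OF pq(1), of 4] iZ[OF pq(2), of 4] by auto
    assume ne: "p \<noteq> q"
    have e: "expectation (\<lambda>\<omega>. (Z \<omega> p + s * Z \<omega> q) ^ 4) = 3 * (1 + s\<^sup>2)\<^sup>2" for s
      using m4[of "\<lambda>j. dl p j + s * dl q j"] by (simp only: Y2[OF pq] v2[OF pq ne])
    show "expectation (\<lambda>\<omega>. (Z \<omega> p)\<^sup>2 * (Z \<omega> q)\<^sup>2) = 1"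
      unfolding pol using i[of 1] i[of "-1"] iZ[OF pq(1), of 4] iZ[OF pq(2), of 4]
        e[of 1] e[of "-1"] eZ4[OF pq(1)] eZ4[OF pq(2)] by simp
  qed
  have i1: "integrable M (\<lambda>\<omega>. ((Z \<omega> p)\<^sup>2 - 1) * ((Z \<omega> q)\<^sup>2 - 1))"
    and e1: "expectation (\<lambda>\<omega>. ((Z \<omega> p)\<^sup>2 - 1) * ((Z \<omega> q)\<^sup>2 - 1)) = (if p = q then 2 else 0)"
    if pq: "p \<in> {1..N}" "q \<in> {1..N}" for p q
  proof -
    have ex: "((Z \<omega> p)\<^sup>2 - 1) * ((Z \<omega> q)\<^sup>2 - 1) = (Z \<omega> p)\<^sup>2 * (Z \<omega> q)\<^sup>2 - (Z \<omega> p)\<^sup>2 - (Z \<omega> q)\<^sup>2 + 1" for \<omega>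
      by (simp add: algebra_simps)
    note I = iZZ[OF pq] iZ[OF pq(1), of 2] iZ[OF pq(2), of 2]
    show "integrable M (\<lambda>\<omega>. ((Z \<omega> p)\<^sup>2 - 1) * ((Z \<omega> q)\<^sup>2 - 1))" unfolding ex using I by auto
    have "expectation (\<lambda>\<omega>. ((Z \<omega> p)\<^sup>2 - 1) * ((Z \<omega> q)\<^sup>2 - 1)) = expectation (\<lambda>\<omega>. (Z \<omega> p)\<^sup>2 * (Z \<omega> q)\<^sup>2) - 1"
      unfolding ex using I eZ2[OF pq(1)] eZ2[OF pq(2)] by (simp add: prob_space)
    also have "expectation (\<lambda>\<omega>. (Z \<omega> p)\<^sup>2 * (Z \<omega> q)\<^sup>2) = (if p = q then 3 else 1)"
      using eZZ[OF pq] eZ4[OF pq(1)] by (auto simp flip: power_add)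
    finally show "expectation (\<lambda>\<omega>. ((Z \<omega> p)\<^sup>2 - 1) * ((Z \<omega> q)\<^sup>2 - 1)) = (if p = q then 2 else 0)" by simp
  qed
  have ex: "(\<Sum>j=1..N. u j * ((Z \<omega> j)\<^sup>2 - 1))\<^sup>2
     = (\<Sum>p=1..N. \<Sum>q=1..N. (u p * u q) * (((Z \<omega> p)\<^sup>2 - 1) * ((Z \<omega> q)\<^sup>2 - 1)))" for \<omega>
    unfolding power2_eq_square sum_product by (simp add: mult_ac)
  show "integrable M (\<lambda>\<omega>. (\<Sum>j=1..N. u j * ((Z \<omega> j)\<^sup>2 - 1))\<^sup>2)"
    unfolding ex using i1 by (intro Bochner_Integration.integrable_sum integrable_mult_right) auto
  have "expectation (\<lambda>\<omega>. (\<Sum>j=1..N. u j * ((Z \<omega> j)\<^sup>2 - 1))\<^sup>2)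
     = (\<Sum>p=1..N. \<Sum>q=1..N. (u p * u q) * expectation (\<lambda>\<omega>. ((Z \<omega> p)\<^sup>2 - 1) * ((Z \<omega> q)\<^sup>2 - 1)))"
    unfolding ex using i1
    by (subst Bochner_Integration.integral_sum, force intro!: Bochner_Integration.integrable_sum integrable_mult_right,
        intro sum.cong refl, subst Bochner_Integration.integral_sum, force intro!: integrable_mult_right, simp)
  also have "\<dots> = (\<Sum>p=1..N. \<Sum>q=1..N. (u p * u q) * (if p = q then 2 else 0))"
    by (intro sum.cong refl) (simp only: e1)
  also have "\<dots> = 2 * (\<Sum>j=1..N. (u j)\<^sup>2)"
    by (simp add: if_distrib power2_eq_square sum_distrib_left mult_ac cong: if_cong)
  finally show "expectation (\<lambda>\<omega>. (\<Sum>j=1..N. u j * ((Z \<omega> j)\<^sup>2 - 1))\<^sup>2) = 2 * (\<Sum>j=1..N. (u j)\<^sup>2)" .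
qed

section \<open>The three eigenvalue conditions\<close>

text \<open>Row-major numbering is a bijection of the square onto \<open>{1..n\<^sup>2}\<close>; its
  inverse is division with remainder, applied to \<open>k - 1\<close> because both numberings start
  at 1.\<close>

lemma sum_grid_pos:
  fixes h :: "nat \<Rightarrow> real"
  shows "(\<Sum>p\<in>{1..n}\<times>{1..n}. h (grid_pos n p)) = (\<Sum>j=1..n\<^sup>2. h j)"
proof (rule sum.reindex_bij_witness[where j = "grid_pos n" and i = "\<lambda>k. (Suc ((k - 1) div n), Suc ((k - 1) mod n))"])
    fix p assume "p \<in> {1..n} \<times> {1..n}"
    then obtain i j where p: "p = (Suc i, Suc j)" "i < n" "j < n"
      by (cases p; cases "fst p"; cases "snd p") auto
    have "i * n + j < n * n"
    proof -
      have "Suc i * n \<le> n * n" using p by (intro mult_right_mono) auto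
      then show ?thesis using p by simp
    qed
    then show "grid_pos n p \<in> {1..n\<^sup>2}" using p by (simp add: grid_pos_def power2_eq_square)
    show "(Suc ((grid_pos n p - 1) div n), Suc ((grid_pos n p - 1) mod n)) = p"
      using p by (simp add: grid_pos_def)
  next
    fix k assume k: "k \<in> {1..n\<^sup>2}"
    then have n: "n > 0" by (cases n) auto
    have "(k - 1) div n < n" using k n by (intro less_mult_imp_div_less) (auto simp: power2_eq_square)
    then show "(Suc ((k - 1) div n), Suc ((k - 1) mod n)) \<in> {1..n} \<times> {1..n}"
      using mod_less_divisor[OF n, of "k - 1"] by (auto simp: Suc_le_eq)
    show "grid_pos n (Suc ((k - 1) div n), Suc ((k - 1) mod n)) = k"
      using k div_mult_mod_eq[of "k - 1" n] by (simp add: grid_pos_def)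
qed simp

text \<open>Multiplying the argument by a factor changes \<open>sat\<close> by at most that factor,
  in the direction of the change. Hence an upper constant counts only if it exceeds 1, a lower one
  only if it is below 1.\<close>

lemma sat_sum_comparison:
  assumes "finite A" and dl: "0 < dl" and du: "0 < du" and z: "\<And>p. p \<in> A \<Longrightarrow> 0 \<le> z p"
    and l: "\<And>p. p \<in> A \<Longrightarrow> dl * z p \<le> y p \<and> y p \<le> du * z p"
  shows "(\<Sum>p\<in>A. sat (y p)) \<le> max 1 du * (\<Sum>p\<in>A. sat (z p))"
    and "(min 1 dl)\<^sup>2 * (\<Sum>p\<in>A. (sat (z p))\<^sup>2) \<le> (\<Sum>p\<in>A. (sat (y p))\<^sup>2)"
proof -
  have y0: "0 \<le> y p" if "p \<in> A" for p
    using l[OF that] z[OF that] dl by (meson mult_nonneg_nonneg less_imp_le order_trans)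
  show "(\<Sum>p\<in>A. sat (y p)) \<le> max 1 du * (\<Sum>p\<in>A. sat (z p))"
    unfolding sum_distrib_left
  proof (rule sum_mono)
    fix p assume p: "p \<in> A"
    have "du * z p \<le> max 1 du * z p" using z[OF p] by (intro mult_right_mono) auto
    then have "sat (y p) \<le> sat (max 1 du * z p)" using l[OF p] y0[OF p] by (intro sat_mono) auto
    also have "\<dots> \<le> max 1 du * sat (z p)" using z[OF p] by (intro sat_scale_le) auto
    finally show "sat (y p) \<le> max 1 du * sat (z p)" .
  qed
  show "(min 1 dl)\<^sup>2 * (\<Sum>p\<in>A. (sat (z p))\<^sup>2) \<le> (\<Sum>p\<in>A. (sat (y p))\<^sup>2)"
    unfolding sum_distrib_left
  proof (rule sum_mono)
    fix p assume p: "p \<in> A"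
    have "min 1 dl * z p \<le> dl * z p" using z[OF p] by (intro mult_right_mono) auto
    then have "sat (min 1 dl * z p) \<le> sat (y p)"
      using l[OF p] z[OF p] dl by (intro sat_mono) auto
    moreover have "min 1 dl * sat (z p) \<le> sat (min 1 dl * z p)" using z[OF p] dl by (intro sat_scale_ge) auto
    ultimately have "(min 1 dl * sat (z p))\<^sup>2 \<le> (sat (y p))\<^sup>2"
      using dl z[OF p] by (intro power_mono mult_nonneg_nonneg sat_nonneg) auto
    then show "(min 1 dl)\<^sup>2 * (sat (z p))\<^sup>2 \<le> (sat (y p))\<^sup>2" by (simp add: power_mult_distrib)
  qed
qed

section \<open>Reduction of the three spectra to model sequences\<close>

lemma s2_sat: "s2 N lam c = (\<Sum>j=1..N. sat (c * lam j))"
  and D2R_sat: "D2R N lam c = (\<Sum>j=1..N. (sat (c * lam j))\<^sup>2)"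
  by (simp_all add: s2_def D2R_def sat_def power_divide)

lemma s2_grid: "s2 (n\<^sup>2) lam c = (\<Sum>p\<in>{1..n}\<times>{1..n}. sat (c * lam (grid_pos n p)))"
  and D2R_grid: "D2R (n\<^sup>2) lam c = (\<Sum>p\<in>{1..n}\<times>{1..n}. (sat (c * lam (grid_pos n p)))\<^sup>2)"
  unfolding s2_sat D2R_sat by (rule sum_grid_pos[symmetric])+

text \<open>The common interface of the three examples. The values of \<open>c\<close> considered
  include \<open>c_range m N\<close> as soon as \<open>ln N \<ge> 1\<close>. The power
  \<open>1 / (2 * m)\<close> is the square root of the threshold
  \<open>K = (c * N) powr (1 / m)\<close>, a growth rate that all three spectra attain.\<close>

definition regular_spectrum :: "real \<Rightarrow> nat \<Rightarrow> (nat \<Rightarrow> real) \<Rightarrow> real \<Rightarrow> real \<Rightarrow> bool" where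
  "regular_spectrum m N lam C b \<longleftrightarrow> (\<forall>c. 1 \<le> c * real N \<and> c * real N \<le> real N powr m \<longrightarrow>
     s2 N lam c \<le> C * D2R N lam c \<and> b * (c * real N) powr (1 / (2 * m)) \<le> D2R N lam c)"

text \<open>For a model spectrum \<open>N / kap p powr m\<close> one has
  \<open>c * lam = (K / kap p) powr m\<close>, so both claims become statements about the threshold
  \<open>K\<close>; \<open>sat_sum_comparison\<close> then transfers them to the actual
  eigenvalues.\<close>

lemma regular_spectrumI:
  assumes A: "finite A" and dl: "0 < dl" "0 < du" and m: "m > 1"
    and s: "\<And>c. s2 N lam c = (\<Sum>p\<in>A. sat (c * l p))" "\<And>c. D2R N lam c = (\<Sum>p\<in>A. (sat (c * l p))\<^sup>2)"
    and k: "\<And>p. p \<in> A \<Longrightarrow> kap p > 0"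
    and l: "\<And>p. p \<in> A \<Longrightarrow> dl * (real N / kap p powr m) \<le> l p \<and> l p \<le> du * (real N / kap p powr m)"
    and C: "C \<ge> 0" "b \<ge> 0"
    and K: "\<And>K. 1 \<le> K \<Longrightarrow> K \<le> real N \<Longrightarrow>
      (\<Sum>p\<in>A. sat ((K / kap p) powr m)) \<le> C * (\<Sum>p\<in>A. (sat ((K / kap p) powr m))\<^sup>2) \<and>
      sqrt K \<le> b * (\<Sum>p\<in>A. (sat ((K / kap p) powr m))\<^sup>2)"
  shows "regular_spectrum m N lam (max 1 du * C / (min 1 dl)\<^sup>2) ((min 1 dl)\<^sup>2 / (b + 1))"
  unfolding regular_spectrum_def
proof (intro allI impI)
  fix c assume c: "1 \<le> c * real N \<and> c * real N \<le> real N powr m"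
  then have N: "N > 0" by (cases "N = 0") auto
  have cp: "c > 0"
  proof -
    have "0 < c * real N" using c by linarith
    then show ?thesis using N by (simp add: zero_less_mult_iff)
  qed
  define x where "x = c * real N"
  \<comment> \<open>The condition on \<open>c\<close> translates exactly into
    \<open>1 \<le> K\<close> and \<open>K \<le> N\<close>.\<close>
  define K where "K = x powr (1 / m)"
  have x: "1 \<le> x" "x \<le> real N powr m" using c by (auto simp: x_def)
  have Km: "K powr m = x" using x m by (simp add: K_def powr_powr)
  have K1: "1 \<le> K" using x m by (simp add: K_def ge_one_powr_ge_zero)
  have "x powr (1 / m) \<le> (real N powr m) powr (1 / m)" using x m by (intro powr_mono2) auto
  then have K2: "K \<le> real N" using m by (simp add: K_def powr_powr)
  define S1 S2 where "S1 = (\<Sum>p\<in>A. sat ((K / kap p) powr m))" and "S2 = (\<Sum>p\<in>A. (sat ((K / kap p) powr m))\<^sup>2)"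
  have KS: "S1 \<le> C * S2" "sqrt K \<le> b * S2" using K[OF K1 K2] by (auto simp: S1_def S2_def)
  have z: "(K / kap p) powr m = c * (real N / kap p powr m)" if "p \<in> A" for p
    using k[OF that] K1 Km by (simp add: powr_divide x_def)
  have l': "dl * (K / kap p) powr m \<le> c * l p \<and> c * l p \<le> du * (K / kap p) powr m" if "p \<in> A" for p
  proof -
    have "c * (dl * (real N / kap p powr m)) \<le> c * l p" "c * l p \<le> c * (du * (real N / kap p powr m))"
      using l[OF that] cp by (auto simp only: mult_le_cancel_left_pos)
    then show ?thesis unfolding z[OF that] by (simp only: mult.left_commute[of c])
  qed
  have "s2 N lam c \<le> max 1 du * S1" and D: "(min 1 dl)\<^sup>2 * S2 \<le> D2R N lam c"
    unfolding s S1_def S2_def using sat_sum_comparison[OF A dl _ l'] by auto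
  have mp: "(min 1 dl)\<^sup>2 > 0" using dl by simp
  have "S2 \<le> D2R N lam c / (min 1 dl)\<^sup>2" using D mp by (simp add: pos_le_divide_eq mult.commute)
  then have "max 1 du * (C * S2) \<le> max 1 du * (C * (D2R N lam c / (min 1 dl)\<^sup>2))"
    using C by (intro mult_left_mono) auto
  moreover have "max 1 du * S1 \<le> max 1 du * (C * S2)" using KS by (intro mult_left_mono) auto
  ultimately have "s2 N lam c \<le> max 1 du * (C * (D2R N lam c / (min 1 dl)\<^sup>2))"
    using \<open>s2 N lam c \<le> max 1 du * S1\<close> by linarith
  then have 1: "s2 N lam c \<le> max 1 du * C / (min 1 dl)\<^sup>2 * D2R N lam c" by simp
  have S20: "S2 \<ge> 0" unfolding S2_def by (intro sum_nonneg) auto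
  have "(c * real N) powr (1 / (2 * m)) = sqrt K"
    using x m by (simp add: K_def x_def powr_half_sqrt[symmetric] powr_powr mult.commute)
  \<comment> \<open>Passing to \<open>b + 1\<close> keeps the divisor positive even when
    \<open>b = 0\<close>.\<close>
  also have "\<dots> \<le> (b + 1) * S2" using KS S20 by (simp add: algebra_simps)
  finally have "(min 1 dl)\<^sup>2 / (b + 1) * (c * real N) powr (1 / (2 * m)) \<le> (min 1 dl)\<^sup>2 / (b + 1) * ((b + 1) * S2)"
    using C by (intro mult_left_mono) auto
  also have "\<dots> = (min 1 dl)\<^sup>2 * S2" using C by simp
  finally have 2: "(min 1 dl)\<^sup>2 / (b + 1) * (c * real N) powr (1 / (2 * m)) \<le> D2R N lam c" using D by linarith
  show "s2 N lam c \<le> max 1 du * C / (min 1 dl)\<^sup>2 * D2R N lam c \<and>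
     (min 1 dl)\<^sup>2 / (b + 1) * (c * real N) powr (1 / (2 * m)) \<le> D2R N lam c"
    using 1 2 by blast
qed

lemma sqrt_le_self: "K \<ge> 1 \<Longrightarrow> sqrt K \<le> (K::real)"
  by (intro real_le_lsqrt) (auto simp: power2_eq_square)

lemma regular_spectrum_polynomial:
  assumes "polynomial_eigenvalues m lam" "m > 1"
  shows "\<exists>C b. C \<ge> 0 \<and> b > 0 \<and> (\<forall>n. regular_spectrum m n (lam n) C b)"
proof -
  from assms(1) obtain dl du where d: "0 < dl" "dl \<le> du"
    and l: "\<And>n j. j \<in> {1..n} \<Longrightarrow> dl * real n / real j powr m \<le> lam n j \<and> lam n j \<le> du * real n / real j powr m"
    unfolding polynomial_eigenvalues_def by blast
  have T: "tail_const m \<ge> 0" using assms(2) by (simp add: tail_const_def)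
  have "regular_spectrum m n (lam n) (max 1 du * (4 + 8 * tail_const m) / (min 1 dl)\<^sup>2) ((min 1 dl)\<^sup>2 / (8 + 1))" for n
  proof (rule regular_spectrumI[where A = "{1..n}" and l = "lam n" and kap = real])
    fix K assume K: "1 \<le> K" "K \<le> real n"
    show "(\<Sum>p=1..n. sat ((K / real p) powr m)) \<le> (4 + 8 * tail_const m) * (\<Sum>p=1..n. (sat ((K / real p) powr m))\<^sup>2) \<and>
      sqrt K \<le> 8 * (\<Sum>p=1..n. (sat ((K / real p) powr m))\<^sup>2)"
      using row_sat_sum[OF assms(2) K(1), of n] K sqrt_le_self[OF K(1)] by linarith
  qed (use l d assms(2) T s2_sat D2R_sat in auto)
  then show ?thesis using d T
    by (intro exI[of _ "max 1 du * (4 + 8 * tail_const m) / (min 1 dl)\<^sup>2"] exI[of _ "(min 1 dl)\<^sup>2 / (8 + 1)"]) auto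
qed

lemma asymp_unif_bounds:
  assumes "asymp_unif S a b" and pos: "\<And>n t. t \<in> S n \<Longrightarrow> b n t > 0"
  obtains dl du where "0 < dl" "0 < du"
    "\<forall>\<^sub>F n in sequentially. \<forall>t\<in>S n. dl * b n t \<le> a n t \<and> a n t \<le> du * b n t"
proof -
  from assms(1) obtain A B where A: "A > 0"
    and ev: "\<forall>\<^sub>F n in sequentially. \<forall>t\<in>S n. A \<le> a n t / b n t \<and> a n t / b n t \<le> B"
    unfolding asymp_unif_def by blast
  \<comment> \<open>The definition leaves the sign of the upper constant \<open>B\<close> open;
    \<open>max 1 B\<close> is positive in any case.\<close>
  from ev have "\<forall>\<^sub>F n in sequentially. \<forall>t\<in>S n. A * b n t \<le> a n t \<and> a n t \<le> max 1 B * b n t"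
  proof eventually_elim
    case (elim n)
    show ?case
    proof
      fix t assume t: "t \<in> S n"
      have 1: "A * b n t \<le> a n t" "a n t \<le> B * b n t"
        using elim[rule_format, OF t] pos[OF t] by (auto simp: pos_le_divide_eq pos_divide_le_eq)
      have "B * b n t \<le> max 1 B * b n t" using pos[OF t] by (intro mult_right_mono) auto
      then show "A * b n t \<le> a n t \<and> a n t \<le> max 1 B * b n t" using 1 by linarith
    qed
  qed
  then show thesis using A by (intro that[of A "max 1 B"]) auto
qed

lemma regular_spectrum_product:
  assumes "product_eigenvalues m lam" "m > 1"
  shows "\<exists>C b. C \<ge> 0 \<and> b > 0 \<and> (\<forall>\<^sub>F n in sequentially. regular_spectrum m (n\<^sup>2) (lam n) C b)"
proof -
  have pos: "(case t of (i, j) \<Rightarrow> (real n)\<^sup>2 / (real i powr m * real j powr m)) > 0" if "t \<in> grid n" for n t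
    using that by (auto simp: grid_def)
  from assms(1) obtain dl du where d: "0 < dl" "0 < du"
    and ev: "\<forall>\<^sub>F n in sequentially. \<forall>t\<in>grid n.
      dl * (case t of (i, j) \<Rightarrow> (real n)\<^sup>2 / (real i powr m * real j powr m)) \<le> lam n (grid_pos n t) \<and>
      lam n (grid_pos n t) \<le> du * (case t of (i, j) \<Rightarrow> (real n)\<^sup>2 / (real i powr m * real j powr m))"
    unfolding product_eigenvalues_def by (rule asymp_unif_bounds[OF _ pos])
  define C where "C = 4 + 8 * tail_const m + 8 * tail_const m * (1 + tail_const m)"
  have T: "C \<ge> 0" using assms(2) by (simp add: C_def tail_const_def)
  have "\<forall>\<^sub>F n in sequentially. regular_spectrum m (n\<^sup>2) (lam n) (max 1 du * C / (min 1 dl)\<^sup>2) ((min 1 dl)\<^sup>2 / (8 + 1))"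
    using ev eventually_ge_at_top[of 1]
  proof eventually_elim
    case (elim n)
    show ?case
    proof (rule regular_spectrumI[where A = "{1..n} \<times> {1..n}" and l = "\<lambda>p. lam n (grid_pos n p)" and kap = "\<lambda>(i, j). real i * real j"])
      fix K assume K: "1 \<le> K" "K \<le> real (n\<^sup>2)"
      show "(\<Sum>p\<in>{1..n}\<times>{1..n}. sat ((K / (case p of (i, j) \<Rightarrow> real i * real j)) powr m))
          \<le> C * (\<Sum>p\<in>{1..n}\<times>{1..n}. (sat ((K / (case p of (i, j) \<Rightarrow> real i * real j)) powr m))\<^sup>2) \<and>
        sqrt K \<le> 8 * (\<Sum>p\<in>{1..n}\<times>{1..n}. (sat ((K / (case p of (i, j) \<Rightarrow> real i * real j)) powr m))\<^sup>2)"
        using product_sat_sum[OF assms(2) K(1) elim(2)] K(2)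
        by (simp add: C_def sum.cartesian_product split_beta)
    next
      fix p assume "p \<in> {1..n} \<times> {1..n}"
      then show "dl * (real (n\<^sup>2) / (case p of (i, j) \<Rightarrow> real i * real j) powr m) \<le> lam n (grid_pos n p) \<and>
         lam n (grid_pos n p) \<le> du * (real (n\<^sup>2) / (case p of (i, j) \<Rightarrow> real i * real j) powr m)"
        using elim(1)[rule_format, of p] by (auto simp: grid_def powr_mult)
    qed (use d assms(2) T s2_grid D2R_grid in auto)
  qed
  then show ?thesis using d T
    by (intro exI[of _ "max 1 du * C / (min 1 dl)\<^sup>2"] exI[of _ "(min 1 dl)\<^sup>2 / (8 + 1)"]) auto
qed

text \<open>Here \<open>i\<^sup>2 + j\<^sup>2\<close> is replaced by \<open>(max i j)\<^sup>2\<close> at the cost of a factor \<open>2 powr m\<close>.\<close>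

lemma regular_spectrum_sobolev:
  assumes "sobolev_eigenvalues m lam" "m > 1"
  shows "\<exists>C b. C \<ge> 0 \<and> b > 0 \<and> (\<forall>\<^sub>F n in sequentially. regular_spectrum m (n\<^sup>2) (lam n) C b)"
proof -
  have pos: "(case t of (i, j) \<Rightarrow> (real n)\<^sup>2 / ((real i)\<^sup>2 + (real j)\<^sup>2) powr m) > 0" if "t \<in> grid n" for n t
    using that by (auto simp: grid_def add_pos_pos)
  from assms(1) obtain dl du where d: "0 < dl" "0 < du"
    and ev: "\<forall>\<^sub>F n in sequentially. \<forall>t\<in>grid n.
      dl * (case t of (i, j) \<Rightarrow> (real n)\<^sup>2 / ((real i)\<^sup>2 + (real j)\<^sup>2) powr m) \<le> lam n (grid_pos n t) \<and>
      lam n (grid_pos n t) \<le> du * (case t of (i, j) \<Rightarrow> (real n)\<^sup>2 / ((real i)\<^sup>2 + (real j)\<^sup>2) powr m)"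
    unfolding sobolev_eigenvalues_def by (rule asymp_unif_bounds[OF _ pos])
  define C where "C = 8 + 128 * tail_const (2 * m - 1)"
  define dl' where "dl' = dl / 2 powr m"
  have T: "C \<ge> 0" using assms(2) by (simp add: C_def tail_const_def)
  have d': "dl' > 0" using d by (simp add: dl'_def)
  have "\<forall>\<^sub>F n in sequentially. regular_spectrum m (n\<^sup>2) (lam n) (max 1 du * C / (min 1 dl')\<^sup>2) ((min 1 dl')\<^sup>2 / (32 + 1))"
    using ev eventually_ge_at_top[of 1]
  proof eventually_elim
    case (elim n)
    show ?case
    proof (rule regular_spectrumI[where A = "{1..n} \<times> {1..n}" and l = "\<lambda>p. lam n (grid_pos n p)" and kap = "\<lambda>(i, j). (real (max i j))\<^sup>2"])
      fix K assume K: "1 \<le> K" "K \<le> real (n\<^sup>2)"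
      \<comment> \<open>In terms of \<open>max i j\<close> the threshold is \<open>sqrt K\<close>:
        there are \<open>n\<^sup>2\<close> design points, so \<open>K \<le> n\<^sup>2\<close>
        becomes \<open>sqrt K \<le> n\<close>, as \<open>max_sat_sum\<close> requires.\<close>
      have k: "sqrt K \<ge> 1" "sqrt K \<le> real n" using K by (auto intro: real_le_lsqrt)
      have pw: "(K / (real (max i j))\<^sup>2) powr m = (sqrt K / real (max i j)) powr (2 * m)" for i j :: nat
      proof -
        have "K / (real (max i j))\<^sup>2 = (sqrt K / real (max i j))\<^sup>2" using K by (simp add: power_divide)
        also have "\<dots> powr m = (sqrt K / real (max i j)) powr (2 * m)"
          using k by (cases "max i j = 0") (simp_all add: powr_powr flip: powr_numeral)
        finally show ?thesis .
      qed
      have cp: "(\<Sum>p\<in>{1..n}\<times>{1..n}. h (case p of (i, j) \<Rightarrow> (real (max i j))\<^sup>2)) = (\<Sum>i=1..n. \<Sum>j=1..n. h ((real (max i j))\<^sup>2))"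
        for h :: "real \<Rightarrow> real"
        by (simp add: sum.cartesian_product split_beta)
      show "(\<Sum>p\<in>{1..n}\<times>{1..n}. sat ((K / (case p of (i, j) \<Rightarrow> (real (max i j))\<^sup>2)) powr m))
          \<le> C * (\<Sum>p\<in>{1..n}\<times>{1..n}. (sat ((K / (case p of (i, j) \<Rightarrow> (real (max i j))\<^sup>2)) powr m))\<^sup>2) \<and>
        sqrt K \<le> 32 * (\<Sum>p\<in>{1..n}\<times>{1..n}. (sat ((K / (case p of (i, j) \<Rightarrow> (real (max i j))\<^sup>2)) powr m))\<^sup>2)"
        unfolding cp[of "\<lambda>x. sat ((K / x) powr m)"] cp[of "\<lambda>x. (sat ((K / x) powr m))\<^sup>2"] pw C_def
        using max_sat_sum[OF assms(2) k(1), of n] k(2) by blast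
    next
      fix p assume "p \<in> {1..n} \<times> {1..n}"
      then obtain i j where p: "p = (i, j)" "i \<in> {1..n}" "j \<in> {1..n}" by auto
      define M q where "M = (real (max i j))\<^sup>2" and "q = (real i)\<^sup>2 + (real j)\<^sup>2"
      have M: "M > 0" "M \<le> q" "q \<le> 2 * M"
        using p by (auto simp: M_def q_def max_def power_mono)
      have "M powr m \<le> q powr m" "q powr m \<le> (2 * M) powr m" using M assms(2) by (auto intro!: powr_mono2)
      then have q: "real (n\<^sup>2) / q powr m \<le> real (n\<^sup>2) / M powr m"
        "real (n\<^sup>2) / (2 powr m * M powr m) \<le> real (n\<^sup>2) / q powr m"
        using M by (auto intro!: divide_left_mono simp: powr_mult)
      have "dl * (real (n\<^sup>2) / q powr m) \<le> lam n (grid_pos n p)" "lam n (grid_pos n p) \<le> du * (real (n\<^sup>2) / q powr m)"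
        using elim(1)[rule_format, of p] p by (auto simp: grid_def q_def)
      moreover have "du * (real (n\<^sup>2) / q powr m) \<le> du * (real (n\<^sup>2) / M powr m)"
        using q d by (intro mult_left_mono) auto
      moreover have "dl * (real (n\<^sup>2) / (2 powr m * M powr m)) \<le> dl * (real (n\<^sup>2) / q powr m)"
        using q d by (intro mult_left_mono) auto
      ultimately have "dl' * (real (n\<^sup>2) / M powr m) \<le> lam n (grid_pos n p) \<and> lam n (grid_pos n p) \<le> du * (real (n\<^sup>2) / M powr m)"
        by (simp add: dl'_def)
      then show "dl' * (real (n\<^sup>2) / (case p of (i, j) \<Rightarrow> (real (max i j))\<^sup>2) powr m) \<le> lam n (grid_pos n p) \<and>
         lam n (grid_pos n p) \<le> du * (real (n\<^sup>2) / (case p of (i, j) \<Rightarrow> (real (max i j))\<^sup>2) powr m)"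
        by (simp add: p M_def)
    qed (use d d' assms(2) T s2_grid D2R_grid in auto)
  qed
  then show ?thesis using d d' T
    by (intro exI[of _ "max 1 du * C / (min 1 dl')\<^sup>2"] exI[of _ "(min 1 dl')\<^sup>2 / (32 + 1)"]) auto
qed

section \<open>Uniform control of the remainders\<close>

lemma (in prob_space) noise_coordinate:
  assumes ind: "indep_vars (\<lambda>_. borel) eps {1..N}"
    and D: "\<forall>i\<in>{1..N}. distributed M lborel (eps i) std_normal_density"
    and ob: "orthonormal_eigenbasis N U lam e" and p: "p \<in> {1..N}"
  defines "Z \<equiv> \<lambda>\<omega> j. nvec N (\<lambda>i. eps i \<omega>) \<bullet> e j"
  shows "integrable M (\<lambda>\<omega>. (Z \<omega> p) ^ k)" "expectation (\<lambda>\<omega>. Z \<omega> p) = 0" "expectation (\<lambda>\<omega>. (Z \<omega> p)\<^sup>2) = 1"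
proof -
  let ?a = "\<lambda>j. if j = p then 1 else 0 :: real"
  have Y: "(\<lambda>\<omega>. \<Sum>j=1..N. ?a j * Z \<omega> j) = (\<lambda>\<omega>. Z \<omega> p)"
    using p by (simp add: if_distribR if_distrib cong: if_cong)
  have v: "(\<Sum>j=1..N. (?a j)\<^sup>2) = 1"
  proof -
    have "(\<Sum>j=1..N. (?a j)\<^sup>2) = (\<Sum>j=1..N. ?a j)" by (intro sum.cong refl) auto
    then show ?thesis using p by simp
  qed
  have Zd: "nvec N (\<lambda>i. eps i \<omega>) \<bullet> e j = Z \<omega> j" for \<omega> j by (simp add: Z_def)
  note n = noise_coordinates[OF ind D ob, of ?a, unfolded Zd]
  show "integrable M (\<lambda>\<omega>. (Z \<omega> p) ^ k)" using n(1)[of k] unfolding fun_cong[OF Y] by simp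
  show "expectation (\<lambda>\<omega>. Z \<omega> p) = 0" using n(2) unfolding Y by simp
  show "expectation (\<lambda>\<omega>. (Z \<omega> p)\<^sup>2) = 1" using n(3) unfolding fun_cong[OF Y] v by simp
qed

text \<open>Bias-variance decomposition in each coordinate: the error is
  \<open>(t - 1) * g + t * Z\<close>, the cross term has mean 0, and
  \<open>1 - t = 1 / (1 + c * lam j)\<close> turns the squared bias into \<open>D1R\<close> and the
  variance into \<open>D2R\<close>.\<close>

lemma (in prob_space) expected_risk:
  assumes ind: "indep_vars (\<lambda>_. borel) eps {1..N}"
    and D: "\<forall>i\<in>{1..N}. distributed M lborel (eps i) std_normal_density"
    and ob: "orthonormal_eigenbasis N U lam e" and U: "U \<in> carrier_mat N N"
    and lam: "\<And>j. j \<in> {1..N} \<Longrightarrow> lam j \<ge> 0" and c: "c \<ge> 0" and fv: "fv \<in> carrier_vec N"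
  shows "expectation (\<lambda>\<omega>. sqnorm (fhat N U c (fv + nvec N (\<lambda>i. eps i \<omega>)) - fv)) = DR N lam (\<lambda>j. fv \<bullet> e j) c"
proof -
  define Z where "Z = (\<lambda>\<omega> j. nvec N (\<lambda>i. eps i \<omega>) \<bullet> e j)"
  define t where "t j = c * lam j / (1 + c * lam j)" for j
  define g where "g j = fv \<bullet> e j" for j
  have nz: "1 + c * lam j > 0" if "j \<in> {1..N}" for j using lam[OF that] c by (intro add_pos_nonneg) auto
  have nv: "nvec N h \<in> carrier_vec N" for h by (simp add: nvec_def)
  have eq: "sqnorm (fhat N U c (fv + nvec N (\<lambda>i. eps i \<omega>)) - fv)
     = (\<Sum>j=1..N. (t j - 1)\<^sup>2 * (g j)\<^sup>2 + 2 * (t j - 1) * g j * t j * Z \<omega> j + (t j)\<^sup>2 * (Z \<omega> j)\<^sup>2)" for \<omega>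
  proof -
    have "sqnorm (fhat N U c (fv + nvec N (\<lambda>i. eps i \<omega>)) - fv)
      = (\<Sum>j=1..N. (t j * (g j + Z \<omega> j) - g j)\<^sup>2)"
      unfolding t_def g_def Z_def using nz by (intro fhat_eigen[OF ob U _ fv nv]) force
    then show ?thesis by (simp add: power2_eq_square algebra_simps)
  qed
  have Zd: "nvec N (\<lambda>i. eps i \<omega>) \<bullet> e j = Z \<omega> j" for \<omega> j by (simp add: Z_def)
  note n = noise_coordinate[OF ind D ob, unfolded Zd]
  have i: "integrable M (\<lambda>\<omega>. Z \<omega> j)" "integrable M (\<lambda>\<omega>. (Z \<omega> j)\<^sup>2)" if "j \<in> {1..N}" for j
    using n(1)[OF that, of 1] n(1)[OF that, of 2] by auto
  have "expectation (\<lambda>\<omega>. \<Sum>j=1..N. (t j - 1)\<^sup>2 * (g j)\<^sup>2 + 2 * (t j - 1) * g j * t j * Z \<omega> j + (t j)\<^sup>2 * (Z \<omega> j)\<^sup>2)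
    = (\<Sum>j=1..N. expectation (\<lambda>\<omega>. (t j - 1)\<^sup>2 * (g j)\<^sup>2 + 2 * (t j - 1) * g j * t j * Z \<omega> j + (t j)\<^sup>2 * (Z \<omega> j)\<^sup>2))"
    using i by (intro Bochner_Integration.integral_sum) auto
  also have "\<dots> = (\<Sum>j=1..N. (g j)\<^sup>2 / (1 + c * lam j)\<^sup>2 + (c * lam j)\<^sup>2 / (1 + c * lam j)\<^sup>2)"
  proof (intro sum.cong refl)
    fix j assume j: "j \<in> {1..N}"
    have ex: "expectation (\<lambda>\<omega>. (t j - 1)\<^sup>2 * (g j)\<^sup>2 + 2 * (t j - 1) * g j * t j * Z \<omega> j + (t j)\<^sup>2 * (Z \<omega> j)\<^sup>2)
      = (t j - 1)\<^sup>2 * (g j)\<^sup>2 + (t j)\<^sup>2"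
      using i[OF j] n(2,3)[OF j] by (simp add: prob_space)
    have "t j - 1 = - 1 / (1 + c * lam j)" using nz[OF j] by (simp add: t_def field_simps)
    then have "(t j - 1)\<^sup>2 * (g j)\<^sup>2 + (t j)\<^sup>2 = (g j)\<^sup>2 / (1 + c * lam j)\<^sup>2 + (c * lam j)\<^sup>2 / (1 + c * lam j)\<^sup>2"
      by (simp add: power_divide) (simp add: t_def power_divide)
    from ex this show "expectation (\<lambda>\<omega>. (t j - 1)\<^sup>2 * (g j)\<^sup>2 + 2 * (t j - 1) * g j * t j * Z \<omega> j + (t j)\<^sup>2 * (Z \<omega> j)\<^sup>2)
      = (g j)\<^sup>2 / (1 + c * lam j)\<^sup>2 + (c * lam j)\<^sup>2 / (1 + c * lam j)\<^sup>2" by (rule trans)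
  qed
  finally show ?thesis unfolding eq by (simp add: DR_def D1R_def D2R_def g_def sum.distrib)
qed

text \<open>The variances are at most \<open>4 * D1R\<close> and \<open>8 * D2R\<close>, because
  \<open>r \<le> 1\<close> and \<open>1 - r\<^sup>2 \<le> 2 * (1 - r)\<close>. Both are thus
  multiples of the risk; dividing by the square of one 32nd of the risk leaves 1024 times the
  multiple, over a quantity at least \<open>D2R\<close>.\<close>

lemma (in prob_space) remainder_chebyshev:
  assumes ind: "indep_vars (\<lambda>_. borel) eps {1..N}"
    and D: "\<forall>i\<in>{1..N}. distributed M lborel (eps i) std_normal_density"
    and ob: "orthonormal_eigenbasis N U lam e"
    and lam: "\<forall>j\<in>{1..N}. lam j \<ge> 0" and c: "c \<ge> 0" and pos: "D2R N lam c > 0"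
  defines "Z \<equiv> \<lambda>\<omega> j. nvec N (\<lambda>i. eps i \<omega>) \<bullet> e j"
  shows "(\<lambda>\<omega>. R1R N lam g (Z \<omega>) c) \<in> borel_measurable M" "(\<lambda>\<omega>. R2R N lam (Z \<omega>) c) \<in> borel_measurable M"
    "prob {\<omega> \<in> space M. \<bar>R1R N lam g (Z \<omega>) c\<bar> \<ge> DR N lam g c / 32} \<le> 4096 / D2R N lam c"
    "prob {\<omega> \<in> space M. \<bar>R2R N lam (Z \<omega>) c\<bar> \<ge> DR N lam g c / 32} \<le> 8192 / D2R N lam c"
proof -
  have Zd: "nvec N (\<lambda>i. eps i \<omega>) \<bullet> e j = Z \<omega> j" for \<omega> j by (simp add: Z_def)
  note n = noise_coordinate[OF ind D ob, unfolded Zd]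
  have Zm: "(\<lambda>\<omega>. Z \<omega> j) \<in> borel_measurable M" if "j \<in> {1..N}" for j
    using borel_measurable_integrable[OF n(1)[OF that, of 1]] by simp
  show m1: "(\<lambda>\<omega>. R1R N lam g (Z \<omega>) c) \<in> borel_measurable M"
    unfolding R1R_def using Zm by (intro borel_measurable_times borel_measurable_sum borel_measurable_divide) auto
  show m2: "(\<lambda>\<omega>. R2R N lam (Z \<omega>) c) \<in> borel_measurable M"
    unfolding R2R_def using Zm
    by (intro borel_measurable_times borel_measurable_sum borel_measurable_diff borel_measurable_power) auto
  define r where "r j = 1 / (1 + c * lam j)" for j
  have r: "0 \<le> r j" "r j \<le> 1" if "j \<in> {1..N}" for j 
    using mult_nonneg_nonneg[OF c bspec[OF lam that]] by (auto simp: r_def)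
  have r2: "1 / (1 + c * lam j)\<^sup>2 = (r j)\<^sup>2" for j by (simp add: r_def power_divide)
  define DD where "DD = DR N lam g c"
  have DD: "D2R N lam c \<le> DD" "D1R N lam g c \<le> DD" "DD > 0"
    using pos D1R_nonneg[of N lam g c] D2R_nonneg[of N lam c] by (auto simp: DD_def DR_def)
  have cheb: "V / (DD / 32)\<^sup>2 \<le> K * 1024 / D2R N lam c" if "V \<le> K * DD" "K \<ge> 0" for V K
  proof -
    have "V / (DD / 32)\<^sup>2 \<le> K * DD / (DD / 32)\<^sup>2" using that by (intro divide_right_mono) auto
    also have "\<dots> = K * 1024 / DD" using DD by (simp add: power2_eq_square)
    also have "\<dots> \<le> K * 1024 / D2R N lam c" using DD pos that by (intro divide_left_mono) auto
    finally show ?thesis .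
  qed
  define a where "a j = 2 * g j * (r j)\<^sup>2" for j
  have R1: "R1R N lam g (Z \<omega>) c = (\<Sum>j=1..N. a j * Z \<omega> j)" for \<omega>
    by (simp add: R1R_def a_def r_def power_divide sum_distrib_left mult_ac)
  note nc = noise_coordinates[OF ind D ob, unfolded Zd]
  have "(\<Sum>j=1..N. (a j)\<^sup>2) \<le> (\<Sum>j=1..N. 4 * ((g j)\<^sup>2 / (1 + c * lam j)\<^sup>2))"
  proof (rule sum_mono)
    fix j assume j: "j \<in> {1..N}"
    have "(r j)\<^sup>2 * (r j)\<^sup>2 \<le> (r j)\<^sup>2 * 1" using r[OF j] by (intro mult_left_mono power_le_one) auto
    then have "(g j)\<^sup>2 * ((r j)\<^sup>2 * (r j)\<^sup>2) \<le> (g j)\<^sup>2 * (r j)\<^sup>2" by (intro mult_left_mono) auto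
    moreover have "(a j)\<^sup>2 = 4 * ((g j)\<^sup>2 * ((r j)\<^sup>2 * (r j)\<^sup>2))" by (simp add: a_def power2_eq_square)
    moreover have "(g j)\<^sup>2 / (1 + c * lam j)\<^sup>2 = (g j)\<^sup>2 * (r j)\<^sup>2" by (simp add: r_def power_divide)
    ultimately show "(a j)\<^sup>2 \<le> 4 * ((g j)\<^sup>2 / (1 + c * lam j)\<^sup>2)" by simp
  qed
  also have "\<dots> = 4 * D1R N lam g c" by (simp add: D1R_def sum_distrib_left)
  also have "\<dots> \<le> 4 * DD" using DD by simp
  finally have v1: "(\<Sum>j=1..N. (a j)\<^sup>2) \<le> 4 * DD" .
  have "prob {\<omega> \<in> space M. \<bar>R1R N lam g (Z \<omega>) c\<bar> \<ge> DD / 32} \<le> expectation (\<lambda>\<omega>. (R1R N lam g (Z \<omega>) c)\<^sup>2) / (DD / 32)\<^sup>2"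
    by (rule second_moment_method[OF m1]) (use nc(1)[of a 2] DD in \<open>auto simp: R1\<close>)
  also have "expectation (\<lambda>\<omega>. (R1R N lam g (Z \<omega>) c)\<^sup>2) = (\<Sum>j=1..N. (a j)\<^sup>2)" unfolding R1 by (rule nc(3))
  also have "(\<Sum>j=1..N. (a j)\<^sup>2) / (DD / 32)\<^sup>2 \<le> 4 * 1024 / D2R N lam c" by (rule cheb[OF v1]) simp
  finally show "prob {\<omega> \<in> space M. \<bar>R1R N lam g (Z \<omega>) c\<bar> \<ge> DR N lam g c / 32} \<le> 4096 / D2R N lam c"
    by (simp add: DD_def)
  define u where "u j = (r j)\<^sup>2 - 1" for j
  have R2: "R2R N lam (Z \<omega>) c = (\<Sum>j=1..N. u j * ((Z \<omega> j)\<^sup>2 - 1))" for \<omega>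
    unfolding R2R_def u_def r2 by (simp add: mult.commute)
  have "2 * (\<Sum>j=1..N. (u j)\<^sup>2) \<le> 2 * (\<Sum>j=1..N. 4 * ((c * lam j)\<^sup>2 / (1 + c * lam j)\<^sup>2))"
  proof (intro mult_left_mono sum_mono)
    fix j assume j: "j \<in> {1..N}"
    have "1 + c * lam j > 0" using bspec[OF lam j] c by (intro add_pos_nonneg) auto
    then have "c * lam j / (1 + c * lam j) = 1 - r j" by (simp add: r_def field_simps)
    then have t: "(c * lam j)\<^sup>2 / (1 + c * lam j)\<^sup>2 = (1 - r j)\<^sup>2" by (simp flip: power_divide)
    have "(1 + r j)\<^sup>2 \<le> 2\<^sup>2" using r[OF j] by (intro power_mono) auto
    then have "(1 - r j)\<^sup>2 * (1 + r j)\<^sup>2 \<le> (1 - r j)\<^sup>2 * 4" by (intro mult_left_mono) auto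
    moreover have "(u j)\<^sup>2 = (1 - r j)\<^sup>2 * (1 + r j)\<^sup>2" by (simp add: u_def power2_eq_square algebra_simps)
    ultimately show "(u j)\<^sup>2 \<le> 4 * ((c * lam j)\<^sup>2 / (1 + c * lam j)\<^sup>2)" unfolding t by simp
  qed simp
  also have "\<dots> = 8 * D2R N lam c" by (simp add: D2R_def sum_distrib_left)
  also have "\<dots> \<le> 8 * DD" using DD by simp
  finally have v2: "2 * (\<Sum>j=1..N. (u j)\<^sup>2) \<le> 8 * DD" .
  note cv = noise_chi_square_variance[where N = N and Z = Z and u = u, OF nc(1) nc(3) nc(4)]
  have "prob {\<omega> \<in> space M. \<bar>R2R N lam (Z \<omega>) c\<bar> \<ge> DD / 32} \<le> expectation (\<lambda>\<omega>. (R2R N lam (Z \<omega>) c)\<^sup>2) / (DD / 32)\<^sup>2"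
    by (rule second_moment_method[OF m2]) (use cv(1) DD in \<open>auto simp: R2\<close>)
  also have "expectation (\<lambda>\<omega>. (R2R N lam (Z \<omega>) c)\<^sup>2) = 2 * (\<Sum>j=1..N. (u j)\<^sup>2)" unfolding R2 by (rule cv(2))
  also have "2 * (\<Sum>j=1..N. (u j)\<^sup>2) / (DD / 32)\<^sup>2 \<le> 8 * 1024 / D2R N lam c" by (rule cheb[OF v2]) simp
  finally show "prob {\<omega> \<in> space M. \<bar>R2R N lam (Z \<omega>) c\<bar> \<ge> DR N lam g c / 32} \<le> 8192 / D2R N lam c"
    by (simp add: DD_def)
qed

section \<open>Union bound over a geometric grid\<close>

lemma power_bracket:
  fixes q x :: real
  assumes "q > 1" "x \<ge> 1"
  obtains k :: nat where "q ^ k \<le> x" "x < q ^ Suc k"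
proof -
  from real_arch_pow[OF assms(1), of x] have ex: "\<exists>n. x < q ^ n" .
  define n where "n = (LEAST n. x < q ^ n)"
  have n: "x < q ^ n" unfolding n_def using ex by (rule LeastI_ex)
  then have "n \<noteq> 0" using assms by (cases n) auto
  then obtain k where k: "n = Suc k" by (cases n) auto
  have "\<not> x < q ^ k" using not_less_Least[of k "\<lambda>n. x < q ^ n"] k unfolding n_def by simp
  then show thesis using that[of k] n k by simp
qed

text \<open>At the grid point \<open>ck k\<close> one has \<open>c * N = q ^ k * ln N\<close>, so
  the Chebyshev bounds, together \<open>12288 / D2R\<close>, decay geometrically in
  \<open>k\<close>. The ratio \<open>q = 1 + \<eta>\<close> is chosen so that
  \<open>8 * \<eta> * (5 * C + 2)\<close> equals \<open>1 / 4\<close>, as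
  \<open>remainder_bound_from_grid\<close> demands. The bound does not depend on
  \<open>g\<close>.\<close>

lemma (in prob_space) remainders_uniformly_small:
  assumes ind: "indep_vars (\<lambda>_. borel) eps {1..N}"
    and D: "\<forall>i\<in>{1..N}. distributed M lborel (eps i) std_normal_density"
    and ob: "orthonormal_eigenbasis N U lam e"
    and lam: "\<forall>j\<in>{1..N}. lam j \<ge> 0"
    and reg: "regular_spectrum m N lam C b" and C: "C \<ge> 0" and b: "b > 0" and m: "m > 1"
    and N: "ln (real N) \<ge> 1"
  defines "Z \<equiv> \<lambda>\<omega> j. nvec N (\<lambda>i. eps i \<omega>) \<bullet> e j"
    and "q \<equiv> 1 + 1 / (32 * (5 * C + 2))" and "p \<equiv> 1 / (2 * m)"
  shows "\<exists>B\<in>sets M. prob B \<le> 12288 / (b * ln (real N) powr p * (1 - q powr (- p))) \<and>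
    (\<forall>\<omega>\<in>space M - B. \<forall>c\<in>c_range m N. \<bar>R1R N lam g (Z \<omega>) c\<bar> + \<bar>R2R N lam (Z \<omega>) c\<bar> \<le> DR N lam g c / 2)"
proof -
  define \<eta> where "\<eta> = 1 / (32 * (5 * C + 2))"
  have Zd: "nvec N (\<lambda>i. eps i \<omega>) \<bullet> e j = Z \<omega> j" for \<omega> j by (simp add: Z_def)
  have eta: "0 < \<eta>" "\<eta> \<le> 1" "8 * \<eta> * (5 * C + 2) \<le> 1 / 4" and q: "q = 1 + \<eta>" "q > 1"
    using C by (auto simp: \<eta>_def q_def divide_simps)
  have p: "p > 0" using m by (simp add: p_def)
  have N0: "real N > 0" using N by (cases "N = 0") auto
  define a where "a = ln (real N) / real N"
  define ck where "ck k = q ^ k * a" for k :: nat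
  have a: "a > 0" unfolding a_def using N N0 by (intro divide_pos_pos) linarith+
  have ck0: "ck k \<ge> 0" for k using a q by (simp add: ck_def)
  \<comment> \<open>Only grid points within the range of \<open>c\<close> are kept, as the spectral
    bounds are available just there.\<close>
  define F where "F = {k. ck k \<le> real N powr (m - 1)}"
  have finF: "finite F"
  proof -
    obtain n where n: "real N powr (m - 1) / a < q ^ n" using real_arch_pow[OF q(2)] by blast
    have "F \<subseteq> {..<n}"
    proof
      fix k assume "k \<in> F"
      then have "q ^ k \<le> real N powr (m - 1) / a" using a by (simp add: F_def ck_def pos_le_divide_eq)
      then have "q ^ k < q ^ n" using n by linarith
      then show "k \<in> {..<n}" using q by (simp add: power_strict_increasing_iff)
    qed
    then show ?thesis by (rule finite_subset) simp
  qed
  have ckN: "ck k * real N = q ^ k * ln (real N)" for k using N0 by (simp add: ck_def a_def)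
  have regk: "s2 N lam (ck k) \<le> C * D2R N lam (ck k)" "b * (q ^ k * ln (real N)) powr p \<le> D2R N lam (ck k)"
    if "k \<in> F" for k
  proof -
    have "1 * 1 \<le> q ^ k * ln (real N)" using q N by (intro mult_mono one_le_power) auto
    moreover have "ck k * real N \<le> real N powr (m - 1) * real N"
      using that N0 by (intro mult_right_mono) (auto simp: F_def)
    moreover have "real N powr (m - 1) * real N = real N powr m"
      using N0 powr_add[of "real N" "m - 1" 1] by simp
    ultimately have "1 \<le> ck k * real N \<and> ck k * real N \<le> real N powr m" by (simp add: ckN)
    with reg have "s2 N lam (ck k) \<le> C * D2R N lam (ck k) \<and> b * (ck k * real N) powr (1 / (2 * m)) \<le> D2R N lam (ck k)"
      unfolding regular_spectrum_def by blast
    then show "s2 N lam (ck k) \<le> C * D2R N lam (ck k)" "b * (q ^ k * ln (real N)) powr p \<le> D2R N lam (ck k)"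
      by (auto simp: ckN p_def)
  qed
  define L where "L = ln (real N) powr p"
  have L: "L > 0" using N by (simp add: L_def)
  have low: "b * L * (q powr p) ^ k \<le> D2R N lam (ck k)" if "k \<in> F" for k
  proof -
    have "(q ^ k) powr p = (q powr p) ^ k"
      using q by (simp add: powr_realpow[symmetric] powr_powr mult.commute)
    then have "(q ^ k * ln (real N)) powr p = (q powr p) ^ k * L"
      using q N by (simp add: powr_mult L_def)
    then show ?thesis using regk(2)[OF that] by (simp add: mult_ac)
  qed
  have qp: "q powr p > 0" using q by simp
  have pos: "D2R N lam (ck k) > 0" if "k \<in> F" for k
    using low[OF that] b L qp by (meson less_le_trans mult_pos_pos zero_less_power)
  define B1 where "B1 k = {\<omega> \<in> space M. \<bar>R1R N lam g (Z \<omega>) (ck k)\<bar> \<ge> DR N lam g (ck k) / 32}" for k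
  define B2 where "B2 k = {\<omega> \<in> space M. \<bar>R2R N lam (Z \<omega>) (ck k)\<bar> \<ge> DR N lam g (ck k) / 32}" for k
  have ch: "B1 k \<in> sets M" "B2 k \<in> sets M" "prob (B1 k) \<le> 4096 / D2R N lam (ck k)" "prob (B2 k) \<le> 8192 / D2R N lam (ck k)"
    if "k \<in> F" for k
  proof -
    note r = remainder_chebyshev[OF ind D ob lam ck0 pos[OF that], unfolded Zd]
    show "B1 k \<in> sets M" unfolding B1_def using r(1)[of g] by measurable
    show "B2 k \<in> sets M" unfolding B2_def using r(2) by measurable
    show "prob (B1 k) \<le> 4096 / D2R N lam (ck k)" "prob (B2 k) \<le> 8192 / D2R N lam (ck k)"
      unfolding B1_def B2_def by (rule r(3), rule r(4))
  qed
  define B where "B = (\<Union>k\<in>F. B1 k \<union> B2 k)"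
  have "prob B \<le> (\<Sum>k\<in>F. prob (B1 k \<union> B2 k))"
    unfolding B_def using finF ch by (intro finite_measure_subadditive_finite) auto
  also have "\<dots> \<le> (\<Sum>k\<in>F. 12288 / (b * L) * (q powr (- p)) ^ k)"
  proof (rule sum_mono)
    fix k assume k: "k \<in> F"
    have "prob (B1 k \<union> B2 k) \<le> prob (B1 k) + prob (B2 k)" using ch[OF k] by (intro measure_Un_le) auto
    also have "\<dots> \<le> 12288 / D2R N lam (ck k)" using ch(3,4)[OF k] by (simp add: add_divide_distrib[symmetric])
    also have "\<dots> \<le> 12288 / (b * L * (q powr p) ^ k)"
      using low[OF k] pos[OF k] b L qp by (intro divide_left_mono) auto
    also have "\<dots> = 12288 / (b * L) * (q powr (- p)) ^ k" by (simp add: powr_minus divide_simps power_inverse)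
    finally show "prob (B1 k \<union> B2 k) \<le> 12288 / (b * L) * (q powr (- p)) ^ k" .
  qed
  also have "\<dots> \<le> 12288 / (b * L) * (1 / (1 - q powr (- p)))"
  proof -
    have "q powr (- p) < 1" using q p by (simp add: powr_less_one)
    then have x: "norm (q powr (- p)) < 1" by simp
    have "(\<Sum>k\<in>F. (q powr (- p)) ^ k) \<le> (\<Sum>k. (q powr (- p)) ^ k)"
      using finF x by (intro sum_le_suminf summable_geometric) auto
    also have "\<dots> = 1 / (1 - q powr (- p))" by (rule suminf_geometric[OF x])
    finally show ?thesis unfolding sum_distrib_left[symmetric] using b L by (intro mult_left_mono) auto
  qed
  finally have pB: "prob B \<le> 12288 / (b * ln (real N) powr p * (1 - q powr (- p)))" by (simp add: L_def)
  have good: "\<bar>R1R N lam g (Z \<omega>) c\<bar> + \<bar>R2R N lam (Z \<omega>) c\<bar> \<le> DR N lam g c / 2"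
    if w: "\<omega> \<in> space M - B" and c: "c \<in> c_range m N" for \<omega> c
  proof -
    have c: "a \<le> c" "c \<le> real N powr (m - 1)" using c by (auto simp: c_range_def a_def)
    then have "c / a \<ge> 1" using a by simp
    \<comment> \<open>The left neighbour of \<open>c\<close> in the grid; being at most
      \<open>c\<close>, it belongs to the range, so \<open>k\<close> is in \<open>F\<close>.\<close>
    then obtain k where "q ^ k \<le> c / a" "c / a < q ^ Suc k" using power_bracket[OF q(2)] by blast
    then have k: "ck k \<le> c" "c \<le> (1 + \<eta>) * ck k"
      using a by (simp_all add: ck_def q(1)[symmetric] pos_le_divide_eq pos_divide_less_eq mult_ac)
    have kF: "k \<in> F" using k c by (simp add: F_def)
    have "\<omega> \<notin> B1 k" "\<omega> \<notin> B2 k" using w kF by (auto simp: B_def)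
    then have R: "\<bar>R1R N lam g (Z \<omega>) (ck k)\<bar> \<le> DR N lam g (ck k) / 32" "\<bar>R2R N lam (Z \<omega>) (ck k)\<bar> \<le> DR N lam g (ck k) / 32"
      using w by (auto simp: B1_def B2_def)
    show ?thesis
      by (rule remainder_bound_from_grid[OF bspec[OF lam] ck0 k _ eta(2,3) regk(1)[OF kF] C R]) (use eta in auto)
  qed
  have "B \<in> sets M" unfolding B_def using finF ch by auto
  then show ?thesis using pB good by blast
qed

text \<open>By continuity in \<open>c\<close> the supremum is at most \<open>y\<close> as soon as
  this holds on a countable dense subset, which reduces an uncountable intersection to a countable
  one. Compactness gives boundedness, without which the real supremum would not be an upper
  bound.\<close>

lemma borel_measurable_SUP_interval:
  fixes h :: "real \<Rightarrow> 'a \<Rightarrow> real"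
  assumes ab: "a \<le> b" and cont: "\<And>\<omega>. \<omega> \<in> space M \<Longrightarrow> continuous_on {a..b} (\<lambda>c. h c \<omega>)"
    and meas: "\<And>c. c \<in> {a..b} \<Longrightarrow> h c \<in> borel_measurable M"
  shows "(\<lambda>\<omega>. SUP c\<in>{a..b}. h c \<omega>) \<in> borel_measurable M"
    and "\<And>\<omega> c. \<omega> \<in> space M \<Longrightarrow> c \<in> {a..b} \<Longrightarrow> h c \<omega> \<le> (SUP c\<in>{a..b}. h c \<omega>)"
proof -
  have bdd: "bdd_above ((\<lambda>c. h c \<omega>) ` {a..b})" if "\<omega> \<in> space M" for \<omega>
    using compact_continuous_image[OF cont[OF that]] by (intro bounded_imp_bdd_above compact_imp_bounded) auto
  show "h c \<omega> \<le> (SUP c\<in>{a..b}. h c \<omega>)" if "\<omega> \<in> space M" "c \<in> {a..b}" for \<omega> c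
    using bdd[OF that(1)] that(2) by (intro cSUP_upper)
  obtain T where T: "countable T" "T \<subseteq> {a..b}" "{a..b} \<subseteq> closure T" by (rule separable)
  have cl: "closure T = {a..b}" using T(2,3) closure_minimal[OF T(2)] by auto
  show "(\<lambda>\<omega>. SUP c\<in>{a..b}. h c \<omega>) \<in> borel_measurable M"
  proof (rule borel_measurableI_le)
    fix y
    have "(SUP c\<in>{a..b}. h c \<omega>) \<le> y \<longleftrightarrow> (\<forall>c\<in>T. h c \<omega> \<le> y)" if w: "\<omega> \<in> space M" for \<omega>
    proof -
      have "(SUP c\<in>{a..b}. h c \<omega>) \<le> y \<longleftrightarrow> (\<forall>c\<in>{a..b}. h c \<omega> \<le> y)"
        using bdd[OF w] ab by (intro cSUP_le_iff) auto
      also have "\<dots> \<longleftrightarrow> (\<forall>c\<in>T. h c \<omega> \<le> y)"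
        using T(2) continuous_le_on_closure[of T "\<lambda>c. h c \<omega>" _ y] cont[OF w] unfolding cl by blast
      finally show ?thesis .
    qed
    then have "{\<omega>\<in>space M. (SUP c\<in>{a..b}. h c \<omega>) \<le> y} = {\<omega>\<in>space M. \<forall>c\<in>T. h c \<omega> \<le> y}" by auto
    also have "\<dots> \<in> sets M"
    proof (rule sets.sets_Collect_countable_All'[OF _ T(1)])
      fix c assume "c \<in> T"
      then have [measurable]: "h c \<in> borel_measurable M" using T meas by blast
      show "{\<omega> \<in> space M. h c \<omega> \<le> y} \<in> sets M" by measurable
    qed
    finally show "{\<omega>\<in>space M. (SUP c\<in>{a..b}. h c \<omega>) \<le> y} \<in> sets M" .
  qed
qed

section \<open>Posterior contraction\<close>

lemma continuous_on_remainder_ratio: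
  assumes lam: "\<forall>j\<in>{1..N}. lam j \<ge> 0" and a: "a \<ge> 0" and pos: "\<forall>c\<in>{a..b}. D2R N lam c > 0"
  shows "continuous_on {a..b} (\<lambda>c. (\<bar>R1R N lam g Z c\<bar> + \<bar>R2R N lam Z c\<bar>) / DR N lam g c)"
proof -
  have nz: "1 + c * lam j \<noteq> 0" if "j \<in> {1..N}" "c \<in> {a..b}" for j c
  proof -
    have "0 \<le> c * lam j" using bspec[OF lam that(1)] that(2) a by (intro mult_nonneg_nonneg) auto
    then show ?thesis by simp
  qed
  have "DR N lam g c \<noteq> 0" if "c \<in> {a..b}" for c
    using bspec[OF pos that] D1R_nonneg[of N lam g c] by (simp add: DR_def)
  moreover have "continuous_on {a..b} (R1R N lam g Z)" "continuous_on {a..b} (R2R N lam Z)"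
    "continuous_on {a..b} (DR N lam g)"
    unfolding R1R_def[abs_def] R2R_def[abs_def] DR_def[abs_def] D1R_def D2R_def
    by (intro continuous_intros; use nz in force)+
  ultimately show ?thesis by (intro continuous_intros) auto
qed

text \<open>A statement about a single outcome \<open>\<omega>\<close>: once the remainders are
  small there, the rest is deterministic. The constant is the factor 2 of
  \<open>posterior_tail_bound\<close> times the factor \<open>3 * (5 * C + 3)\<close> of
  \<open>empirical_minimiser_bound\<close>.\<close>

lemma (in prob_space) contraction_on_good_event:
  assumes gp: "centered_gaussian_process MW W"
    and ind: "indep_vars (\<lambda>_. borel) eps {1..N}"
    and D: "\<forall>i\<in>{1..N}. distributed M lborel (eps i) std_normal_density"
    and ob: "orthonormal_eigenbasis N (cov_mat MW W N x) lam e"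
    and I: "0 \<le> a" "a \<le> b" and fv: "fv \<in> carrier_vec N"
  defines "U \<equiv> cov_mat MW W N x" and "Y \<equiv> \<lambda>\<omega>. fv + nvec N (\<lambda>i. eps i \<omega>)"
    and "g \<equiv> \<lambda>j. fv \<bullet> e j" and "Z \<equiv> \<lambda>\<omega> j. nvec N (\<lambda>i. eps i \<omega>) \<bullet> e j"
  assumes reg: "\<forall>c\<in>{a..b}. s2 N lam c \<le> C * D2R N lam c" "D2R N lam a > 0" and C: "C \<ge> 0"
    and h: "h \<in> {a..b}" "\<forall>c\<in>{a..b}. risk_criterion N U (Y \<omega>) h \<le> risk_criterion N U (Y \<omega>) c"
    and good: "\<forall>c\<in>{a..b}. \<bar>R1R N lam g (Z \<omega>) c\<bar> + \<bar>R2R N lam (Z \<omega>) c\<bar> \<le> DR N lam g c / 2"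
    and Mn: "Mn > 0"
  shows "measure (posterior MW W N x h (Y \<omega>)) {w. sqnorm (nvec N (\<lambda>i. w (x i)) - fv)
        \<ge> Mn * (INF c\<in>{a..b}. expectation (\<lambda>\<omega>'. sqnorm (fhat N U c (Y \<omega>') - fv)))} \<le> 6 * (5 * C + 3) / Mn"
proof -
  have lam: "lam j \<ge> 0" if "j \<in> {1..N}" for j by (rule cov_eigenvalue_nonneg[OF gp ob that])
  have nz: "1 + c * lam j \<noteq> 0" if "c \<in> {a..b}" "j \<in> {1..N}" for c j
  proof -
    have "0 \<le> c * lam j" using lam[OF that(2)] that(1) I by (intro mult_nonneg_nonneg) auto
    then show ?thesis by simp
  qed
  have nv: "nvec N k \<in> carrier_vec N" for k by (simp add: nvec_def)
  have risk: "expectation (\<lambda>\<omega>'. sqnorm (fhat N U c (Y \<omega>') - fv)) = DR N lam g c" if "c \<in> {a..b}" for c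
    unfolding Y_def g_def U_def using that I lam
    by (intro expected_risk[OF ind D ob cov_mat_carrier _ _ fv]) auto
  define J where "J = (INF c\<in>{a..b}. DR N lam g c)"
  have J: "(INF c\<in>{a..b}. expectation (\<lambda>\<omega>'. sqnorm (fhat N U c (Y \<omega>') - fv))) = J"
    unfolding J_def by (intro INF_cong refl risk)
  define B where "B = (\<Sum>j=1..N. h * lam j / (1 + h * lam j) + (h * lam j / (1 + h * lam j) * (g j + Z \<omega> j) - g j)\<^sup>2)"
  have crit: "risk_criterion N U (Y \<omega>) c = DR N lam g c + R1R N lam g (Z \<omega>) c + R2R N lam (Z \<omega>) c
      + (\<Sum>j=1..N. (Z \<omega> j)\<^sup>2 - 1)" if "c \<in> {a..b}" for c
    unfolding U_def Y_def g_def Z_def by (rule risk_criterion_eigen[OF ob cov_mat_carrier nz[OF that] fv nv])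
  have B: "B \<le> 3 * (5 * C + 3) * DR N lam g c" if c: "c \<in> {a..b}" for c
    unfolding B_def
  proof (rule empirical_minimiser_bound[OF lam])
    show "DR N lam g h + R1R N lam g (Z \<omega>) h + R2R N lam (Z \<omega>) h \<le> DR N lam g c + R1R N lam g (Z \<omega>) c + R2R N lam (Z \<omega>) c"
      using h(2) c crit[OF c] crit[OF h(1)] by force
  qed (use good c h(1) I reg C in auto)
  have "B / (3 * (5 * C + 3)) \<le> J"
    unfolding J_def
  proof (rule cINF_greatest)
    fix c assume "c \<in> {a..b}"
    from B[OF this] show "B / (3 * (5 * C + 3)) \<le> DR N lam g c" using C by (simp add: pos_divide_le_eq mult.commute)
  qed (use I in auto)
  then have BJ: "B \<le> 3 * (5 * C + 3) * J" using C by (simp add: pos_divide_le_eq mult.commute)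
  \<comment> \<open>The tail bound needs a positive threshold, so the infimum must be positive. As
    \<open>D2R\<close> increases with \<open>c\<close>, its value at the left endpoint is a lower
    bound for the risk on the whole interval.\<close>
  have "D2R N lam a \<le> J"
    unfolding J_def
  proof (rule cINF_greatest)
    fix c assume "c \<in> {a..b}"
    then have "D2R N lam a \<le> D2R N lam c" using I by (intro D2R_mono lam) auto
    then show "D2R N lam a \<le> DR N lam g c" using D1R_nonneg[of N lam g c] by (simp add: DR_def)
  qed (use I in auto)
  then have J0: "J > 0" using reg(2) by linarith
  have Yc: "Y \<omega> \<in> carrier_vec N" using fv nv by (simp add: Y_def)
  have Ye: "Y \<omega> \<bullet> e j = g j + Z \<omega> j" if "j \<in> {1..N}" for j
  proof -
    have "e j \<in> carrier_vec N" using ob that by (auto simp: orthonormal_eigenbasis_def)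
    then show ?thesis unfolding Y_def g_def Z_def using fv nv by (intro add_scalar_prod_distrib) auto
  qed
  have "measure (posterior MW W N x h (Y \<omega>)) {w. sqnorm (nvec N (\<lambda>i. w (x i)) - fv) \<ge> Mn * J}
    \<le> 2 * (\<Sum>j=1..N. h * lam j / (1 + h * lam j)
         + (h * lam j / (1 + h * lam j) * (Y \<omega> \<bullet> e j) - fv \<bullet> e j)\<^sup>2) / (Mn * J)"
    by (rule posterior_tail_bound[OF gp ob _ Yc fv]) (use h(1) I Mn J0 in auto)
  also have "(\<Sum>j=1..N. h * lam j / (1 + h * lam j)
         + (h * lam j / (1 + h * lam j) * (Y \<omega> \<bullet> e j) - fv \<bullet> e j)\<^sup>2) = B"
    unfolding B_def by (intro sum.cong refl) (simp only: Ye, simp add: g_def)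
  also have "2 * B / (Mn * J) \<le> 2 * (3 * (5 * C + 3) * J) / (Mn * J)"
    using BJ Mn J0 by (intro divide_right_mono mult_left_mono) auto
  also have "\<dots> = 6 * (5 * C + 3) / Mn" using J0 by simp
  finally show ?thesis unfolding J .
qed

section \<open>Endpoints of the range of \<open>c\<close> and the final limit\<close>

lemma c_range_endpoints:
  assumes "m \<ge> 1" "N \<ge> 1"
  shows "0 \<le> ln (real N) / real N" "ln (real N) / real N \<le> real N powr (m - 1)"
proof -
  show "0 \<le> ln (real N) / real N" using assms by simp
  have "ln (real N) \<le> real N" using ln_le_minus_one[of "real N"] assms by simp
  then have "ln (real N) / real N \<le> 1" using assms by simp
  also have "1 \<le> real N powr (m - 1)" using assms by (intro ge_one_powr_ge_zero) auto
  finally show "ln (real N) / real N \<le> real N powr (m - 1)" .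
qed

lemma inverse_log_power_tendsto_zero:
  assumes N: "filterlim (\<lambda>n. real (N n)) at_top sequentially" and p: "p > 0"
  shows "(\<lambda>n. K / (b * ln (real (N n)) powr p * (1 - q))) \<longlonglongrightarrow> (0::real)"
\<comment> \<open>In the excluded case the denominator vanishes, and the quotient is 0 by
  convention.\<close>
proof (cases "b = 0 \<or> q = 1")
  case False
  have "filterlim (\<lambda>n. ln (real (N n))) at_top sequentially" by (rule filterlim_compose[OF ln_at_top N])
  then have "((\<lambda>n. ln (real (N n)) powr (- p)) \<longlongrightarrow> 0) sequentially"
    using p by (intro tendsto_neg_powr) auto
  then have "(\<lambda>n. K / (b * (1 - q)) * ln (real (N n)) powr (- p)) \<longlonglongrightarrow> K / (b * (1 - q)) * 0"
    by (rule tendsto_mult_left)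
  then show ?thesis by (simp add: powr_minus divide_inverse mult_ac)
qed auto

theorem theorem18:
  fixes W :: "'x \<Rightarrow> 'v \<Rightarrow> real" and MW :: "'v measure"
    and N :: "nat \<Rightarrow> nat" and x :: "nat \<Rightarrow> nat \<Rightarrow> 'x"
    and f :: "'x \<Rightarrow> real" and m :: real
    and P :: "nat \<Rightarrow> 'w measure" and eps :: "nat \<Rightarrow> nat \<Rightarrow> 'w \<Rightarrow> real"
    and lam :: "nat \<Rightarrow> nat \<Rightarrow> real" and e :: "nat \<Rightarrow> nat \<Rightarrow> real Matrix.vec"
    and chat :: "nat \<Rightarrow> real Matrix.vec \<Rightarrow> real" and Mn :: "nat \<Rightarrow> real"
  defines "I \<equiv> \<lambda>n. c_range m (N n)"
    and "U \<equiv> \<lambda>n. cov_mat MW W (N n) (x n)"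
    and "fv \<equiv> \<lambda>n. nvec (N n) (\<lambda>i. f (x n i))"
    and "epsv \<equiv> \<lambda>n \<omega>. nvec (N n) (\<lambda>i. eps n i \<omega>)"
  defines "Y \<equiv> \<lambda>n \<omega>. fv n + epsv n \<omega>"
    and "g \<equiv> \<lambda>n j. fv n \<bullet> e n j"
    and "Z \<equiv> \<lambda>n \<omega> j. epsv n \<omega> \<bullet> e n j"
  assumes design_size: "N = (\<lambda>n. n) \<or> N = (\<lambda>n. n\<^sup>2)"
    and m: "m \<ge> 1"
    and gp: "centered_gaussian_process MW W"
    and prob: "\<And>n. prob_space (P n)"
    and noise_indep: "\<And>n. prob_space.indep_vars (P n) (\<lambda>_. borel) (eps n) {1..N n}"
    and noise_normal: "\<And>n i. i \<in> {1..N n} \<Longrightarrow> distributed (P n) lborel (eps n i) std_normal_density"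
    and eigen: "\<And>n. orthonormal_eigenbasis (N n) (U n) (lam n) (e n)"
    and chat_argmin: "\<And>n y. n \<ge> 1 \<Longrightarrow> y \<in> carrier_vec (N n) \<Longrightarrow>
          is_arg_min (risk_criterion (N n) (U n) y) (\<lambda>c. c \<in> I n) (chat n y)"
    and chat_measurable: "\<And>n. (\<lambda>\<omega>. chat n (Y n \<omega>)) \<in> borel_measurable (P n)"
    and conditions:
      "(tendsto_zero_in_prob P (\<lambda>n \<omega>. SUP c\<in>I n.
            (\<bar>R1R (N n) (lam n) (g n) (Z n \<omega>) c\<bar> + \<bar>R2R (N n) (lam n) (Z n \<omega>) c\<bar>)
              / DR (N n) (lam n) (g n) c)
        \<and> tendsto_zero_in_prob P (\<lambda>n \<omega>. SUP c\<in>I n.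
            (\<bar>R3 (N n) (lam n) (g n) (Z n \<omega>) c\<bar> + \<bar>R4 (N n) (lam n) (Z n \<omega>) c\<bar>)
              / DR (N n) (lam n) (g n) c)
        \<and> asymp_unif I (\<lambda>n. D2R (N n) (lam n)) (\<lambda>n. s2 (N n) (lam n)))
       \<or> (m > 1 \<and> N = (\<lambda>n. n) \<and> polynomial_eigenvalues m lam)
       \<or> (m > 1 \<and> N = (\<lambda>n. n\<^sup>2) \<and> product_eigenvalues m lam)
       \<or> (m > 1 \<and> N = (\<lambda>n. n\<^sup>2) \<and> sobolev_eigenvalues m lam)"
    and Mn: "filterlim Mn at_top sequentially"
  shows "tendsto_zero_in_prob P (\<lambda>n \<omega>.
           measure (posterior MW W (N n) (x n) (chat n (Y n \<omega>)) (Y n \<omega>))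
             {w. sqnorm (nvec (N n) (\<lambda>i. w (x n i)) - fv n)
                   \<ge> Mn n * (INF c\<in>I n. \<integral>\<omega>'. sqnorm (fhat (N n) (U n) c (Y n \<omega>') - fv n) \<partial>(P n))})"
proof -
  define Bad where "Bad n \<omega> \<longleftrightarrow> \<not> (\<forall>c\<in>I n. \<bar>R1R (N n) (lam n) (g n) (Z n \<omega>) c\<bar> + \<bar>R2R (N n) (lam n) (Z n \<omega>) c\<bar>
      \<le> DR (N n) (lam n) (g n) c / 2)" for n \<omega>
  have N1: "N n \<ge> 1" if "n \<ge> 1" for n using design_size that by auto
  have Nn: "N n \<ge> n" for n using design_size by (auto simp: power2_eq_square)
  have Ntop: "filterlim (\<lambda>n. real (N n)) at_top sequentially"
    by (rule filterlim_at_top_mono[OF filterlim_real_sequentially]) (use Nn in auto)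
  have lam0: "\<forall>j\<in>{1..N n}. lam n j \<ge> 0" for n
    using cov_eigenvalue_nonneg[OF gp eigen[of n, unfolded U_def]] by blast
  have D: "\<forall>i\<in>{1..N n}. distributed (P n) lborel (eps n i) std_normal_density" for n
    using noise_normal by blast
  have Zd: "nvec (N n) (\<lambda>i. eps n i \<omega>) \<bullet> e n j = Z n \<omega> j" for n \<omega> j by (simp add: Z_def epsv_def)
  have fvc: "fv n \<in> carrier_vec (N n)" for n by (simp add: fv_def nvec_def)
  have Ieq: "I n = {ln (real (N n)) / real (N n) .. real (N n) powr (m - 1)}" for n
    by (simp add: I_def c_range_def)
  \<comment> \<open>Both kinds of conditions are brought to the same form: eventually
    \<open>s2 \<le> C * D2R\<close> with positive \<open>D2R\<close> on the range, and measurable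
    exceptional sets of vanishing probability outside which the remainders are at most half the
    risk.\<close>
  obtain C where C: "C \<ge> 0"
    and reg: "\<forall>\<^sub>F n in sequentially. \<forall>c\<in>I n. s2 (N n) (lam n) c \<le> C * D2R (N n) (lam n) c \<and> D2R (N n) (lam n) c > 0"
    and bad: "\<exists>B. (\<forall>\<^sub>F n in sequentially. B n \<in> sets (P n) \<and> (\<forall>\<omega>\<in>space (P n) - B n. \<not> Bad n \<omega>))
       \<and> (\<lambda>n. measure (P n) (B n)) \<longlonglongrightarrow> 0"
  proof (cases "tendsto_zero_in_prob P (\<lambda>n \<omega>. SUP c\<in>I n.
            (\<bar>R1R (N n) (lam n) (g n) (Z n \<omega>) c\<bar> + \<bar>R2R (N n) (lam n) (Z n \<omega>) c\<bar>)
              / DR (N n) (lam n) (g n) c)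
        \<and> asymp_unif I (\<lambda>n. D2R (N n) (lam n)) (\<lambda>n. s2 (N n) (lam n))")
    case True
    then obtain A B where A: "A > 0"
      and ev: "\<forall>\<^sub>F n in sequentially. \<forall>c\<in>I n. A \<le> D2R (N n) (lam n) c / s2 (N n) (lam n) c \<and> D2R (N n) (lam n) c / s2 (N n) (lam n) c \<le> B"
      unfolding asymp_unif_def by blast
    have regA: "\<forall>\<^sub>F n in sequentially. \<forall>c\<in>I n. s2 (N n) (lam n) c \<le> 1 / A * D2R (N n) (lam n) c \<and> D2R (N n) (lam n) c > 0"
      using ev eventually_ge_at_top[of 1]
    proof eventually_elim
      case (elim n)
      show ?case
      proof
        fix c assume c: "c \<in> I n"
        then have "c \<ge> 0" using c_range_endpoints(1)[OF m N1[OF elim(2)]] by (auto simp: Ieq)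
        then have "s2 (N n) (lam n) c \<ge> 0" using lam0 by (intro s2_nonneg) auto
        \<comment> \<open>A vanishing \<open>s2\<close> would make the quotient 0 and contradict
          \<open>A > 0\<close>.\<close>
        moreover have r: "A \<le> D2R (N n) (lam n) c / s2 (N n) (lam n) c" using elim(1) c by blast
        then have "s2 (N n) (lam n) c \<noteq> 0" using A by auto
        ultimately have s: "s2 (N n) (lam n) c > 0" by simp
        then have "A * s2 (N n) (lam n) c \<le> D2R (N n) (lam n) c" using r by (simp add: pos_le_divide_eq)
        moreover have "A * s2 (N n) (lam n) c > 0" using A s by simp
        ultimately show "s2 (N n) (lam n) c \<le> 1 / A * D2R (N n) (lam n) c \<and> D2R (N n) (lam n) c > 0"
          using A by (simp add: pos_le_divide_eq mult.commute)
      qed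
    qed
    define S where "S n \<omega> = (SUP c\<in>I n. (\<bar>R1R (N n) (lam n) (g n) (Z n \<omega>) c\<bar> + \<bar>R2R (N n) (lam n) (Z n \<omega>) c\<bar>)
              / DR (N n) (lam n) (g n) c)" for n \<omega>
    \<comment> \<open>The level \<open>1 / 2\<close> is exactly the negation of \<open>Bad\<close>:
      below it, every ratio is at most \<open>1 / 2\<close>.\<close>
    define B where "B n = {\<omega> \<in> space (P n). \<bar>S n \<omega>\<bar> \<ge> 1 / 2}" for n
    have "tendsto_zero_in_prob P S" using True by (simp add: S_def[abs_def])
    note tz = this[unfolded tendsto_zero_in_prob_def, rule_format, of "1 / 2"]
    have "(\<lambda>n. measure (P n) (B n)) \<longlonglongrightarrow> 0" unfolding B_def by (rule tz) simp
    moreover have "\<forall>\<^sub>F n in sequentially. B n \<in> sets (P n) \<and> (\<forall>\<omega>\<in>space (P n) - B n. \<not> Bad n \<omega>)"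
      using regA eventually_ge_at_top[of 1]
    proof eventually_elim
      case (elim n)
      interpret prob_space "P n" by (rule prob)
      let ?a = "ln (real (N n)) / real (N n)" and ?b = "real (N n) powr (m - 1)"
      note ab = c_range_endpoints[OF m N1[OF elim(2)]]
      have pos: "\<forall>c\<in>{?a..?b}. D2R (N n) (lam n) c > 0" using elim(1) by (auto simp: Ieq)
      let ?h = "\<lambda>c \<omega>. (\<bar>R1R (N n) (lam n) (g n) (Z n \<omega>) c\<bar> + \<bar>R2R (N n) (lam n) (Z n \<omega>) c\<bar>) / DR (N n) (lam n) (g n) c"
      have meas: "?h c \<in> borel_measurable (P n)" if "c \<in> {?a..?b}" for c
      proof -
        have c: "c \<ge> 0" using that ab by auto
        note [measurable] = remainder_chebyshev(1,2)[OF noise_indep D eigen lam0 c bspec[OF pos that], unfolded Zd]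
        show ?thesis by measurable
      qed
      note sup = borel_measurable_SUP_interval[of ?a ?b "P n" ?h, OF ab(2) continuous_on_remainder_ratio[OF lam0 ab(1) pos] meas]
      \<comment> \<open>This is what gives the assumed convergence its content: on a non-measurable
        \<open>B n\<close> the value of \<open>measure\<close> would be 0 by default.\<close>
      have "S n \<in> borel_measurable (P n)" unfolding S_def[abs_def] Ieq using sup(1) by simp
      then have "B n \<in> sets (P n)" unfolding B_def by measurable
      moreover have "\<not> Bad n \<omega>" if w: "\<omega> \<in> space (P n) - B n" for \<omega>
      proof -
        have "\<bar>R1R (N n) (lam n) (g n) (Z n \<omega>) c\<bar> + \<bar>R2R (N n) (lam n) (Z n \<omega>) c\<bar> \<le> DR (N n) (lam n) (g n) c / 2"
          if c: "c \<in> I n" for c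
        proof -
          have c': "c \<in> {?a..?b}" using c by (simp add: Ieq)
          have "?h c \<omega> \<le> S n \<omega>" unfolding S_def Ieq using w by (intro sup(2)) (use c' in auto)
          also have "\<dots> \<le> 1 / 2" using w by (auto simp: B_def)
          finally have "?h c \<omega> \<le> 1 / 2" .
          moreover have "DR (N n) (lam n) (g n) c > 0"
            using bspec[OF pos c'] D1R_nonneg[of "N n" "lam n" "g n" c] by (simp add: DR_def)
          ultimately show ?thesis by (simp add: pos_divide_le_eq)
        qed
        then show ?thesis unfolding Bad_def by blast
      qed
      ultimately show ?case by blast
    qed
    ultimately show thesis using regA A by (intro that[of "1 / A"]) auto
  next
    case False
    then have "m > 1" and "\<exists>C b. C \<ge> 0 \<and> b > 0 \<and> (\<forall>\<^sub>F n in sequentially. regular_spectrum m (N n) (lam n) C b)"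
      using conditions regular_spectrum_polynomial[of m lam] regular_spectrum_product[of m lam]
        regular_spectrum_sobolev[of m lam] by (auto intro: always_eventually)
    then obtain C b where C: "C \<ge> 0" and b: "b > 0"
      and rs: "\<forall>\<^sub>F n in sequentially. regular_spectrum m (N n) (lam n) C b" by blast
    define q where "q = 1 + 1 / (32 * (5 * C + 2))"
    define p where "p = 1 / (2 * m)"
    have "filterlim (\<lambda>n. ln (real (N n))) at_top sequentially" by (rule filterlim_compose[OF ln_at_top Ntop])
    then have ln1: "\<forall>\<^sub>F n in sequentially. 1 \<le> ln (real (N n))" by (simp add: filterlim_at_top)
    have "\<forall>\<^sub>F n in sequentially. \<forall>c\<in>I n. s2 (N n) (lam n) c \<le> C * D2R (N n) (lam n) c \<and> D2R (N n) (lam n) c > 0"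
      using rs ln1 eventually_ge_at_top[of 1]
    proof eventually_elim
      case (elim n)
      show ?case
      proof
        fix c assume c: "c \<in> I n"
        have N0: "real (N n) > 0" using N1[OF elim(3)] by simp
        have "ln (real (N n)) \<le> c * real (N n)" using c N0 by (simp add: Ieq pos_divide_le_eq)
        then have 1: "1 \<le> c * real (N n)" using elim(2) by linarith
        have "c * real (N n) \<le> real (N n) powr (m - 1) * real (N n)"
          using c N0 by (intro mult_right_mono) (auto simp: Ieq)
        also have "\<dots> = real (N n) powr m" using N0 powr_add[of "real (N n)" "m - 1" 1] by simp
        finally have 2: "c * real (N n) \<le> real (N n) powr m" .
        have "b * (c * real (N n)) powr (1 / (2 * m)) > 0" using b 1 N0 by (intro mult_pos_pos) auto
        then show "s2 (N n) (lam n) c \<le> C * D2R (N n) (lam n) c \<and> D2R (N n) (lam n) c > 0"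
          using elim(1)[unfolded regular_spectrum_def, rule_format, of c] 1 2 by linarith
      qed
    qed
    moreover have "\<exists>B. (\<forall>\<^sub>F n in sequentially. B n \<in> sets (P n) \<and> (\<forall>\<omega>\<in>space (P n) - B n. \<not> Bad n \<omega>))
       \<and> (\<lambda>n. measure (P n) (B n)) \<longlonglongrightarrow> 0"
    proof -
      define ok where "ok n B \<longleftrightarrow> B \<in> sets (P n) \<and>
         measure (P n) B \<le> 12288 / (b * ln (real (N n)) powr p * (1 - q powr (- p))) \<and>
         (\<forall>\<omega>\<in>space (P n) - B. \<not> Bad n \<omega>)" for n B
      have ex: "\<forall>\<^sub>F n in sequentially. \<exists>B. ok n B"
        using rs ln1
      proof eventually_elim
        case (elim n)
        interpret prob_space "P n" by (rule prob)
        show ?case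
          using remainders_uniformly_small[OF noise_indep D eigen lam0 elim(1) C b \<open>m > 1\<close> elim(2), of "g n", unfolded Zd]
          unfolding ok_def Bad_def q_def p_def I_def by auto
      qed
      \<comment> \<open>Exceptional sets exist only for large \<open>n\<close>; for the others the
        choice is arbitrary and does not affect the limit.\<close>
      define B where "B n = (SOME B. ok n B)" for n
      have okB: "\<forall>\<^sub>F n in sequentially. ok n (B n)"
        using ex by eventually_elim (auto simp: B_def intro: someI_ex)
      have "(\<lambda>n. measure (P n) (B n)) \<longlonglongrightarrow> 0"
      proof (rule tendsto_sandwich[where f = "\<lambda>_. 0" and h = "\<lambda>n. 12288 / (b * ln (real (N n)) powr p * (1 - q powr (- p)))"])
        show "(\<lambda>n. 12288 / (b * ln (real (N n)) powr p * (1 - q powr (- p)))) \<longlonglongrightarrow> 0"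
          using m by (intro inverse_log_power_tendsto_zero[OF Ntop]) (simp add: p_def)
        show "\<forall>\<^sub>F n in sequentially. measure (P n) (B n) \<le> 12288 / (b * ln (real (N n)) powr p * (1 - q powr (- p)))"
          using okB by eventually_elim (simp add: ok_def)
      qed auto
      moreover have "\<forall>\<^sub>F n in sequentially. B n \<in> sets (P n) \<and> (\<forall>\<omega>\<in>space (P n) - B n. \<not> Bad n \<omega>)"
        using okB by eventually_elim (simp add: ok_def)
      ultimately show ?thesis by blast
    qed
    ultimately show thesis using C by (intro that[of C])
  qed
  from bad obtain B where B: "\<forall>\<^sub>F n in sequentially. B n \<in> sets (P n) \<and> (\<forall>\<omega>\<in>space (P n) - B n. \<not> Bad n \<omega>)"
    and B0: "(\<lambda>n. measure (P n) (B n)) \<longlonglongrightarrow> 0" by blast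
  define X where "X = (\<lambda>n \<omega>.
           measure (posterior MW W (N n) (x n) (chat n (Y n \<omega>)) (Y n \<omega>))
             {w. sqnorm (nvec (N n) (\<lambda>i. w (x n i)) - fv n)
                   \<ge> Mn n * (INF c\<in>I n. \<integral>\<omega>'. sqnorm (fhat (N n) (U n) c (Y n \<omega>') - fv n) \<partial>(P n))})"
  have "(\<lambda>n. measure (P n) {\<omega> \<in> space (P n). \<bar>X n \<omega>\<bar> \<ge> \<epsilon>}) \<longlonglongrightarrow> 0" if eps: "\<epsilon> > 0" for \<epsilon>
  proof (rule tendsto_sandwich[where f = "\<lambda>_. 0" and h = "\<lambda>n. measure (P n) (B n)"])
    \<comment> \<open>The extra 1 makes the final bound strictly smaller than
      \<open>\<epsilon>\<close>, as the event in question is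
      \<open>|X| \<ge> \<epsilon>\<close>.\<close>
    have "\<forall>\<^sub>F n in sequentially. Mn n \<ge> 6 * (5 * C + 3) / \<epsilon> + 1" using Mn by (simp add: filterlim_at_top)
    then show "\<forall>\<^sub>F n in sequentially. measure (P n) {\<omega> \<in> space (P n). \<bar>X n \<omega>\<bar> \<ge> \<epsilon>} \<le> measure (P n) (B n)"
      using reg B eventually_ge_at_top[of 1]
    proof eventually_elim
      case (elim n)
      interpret prob_space "P n" by (rule prob)
      note ab = c_range_endpoints[OF m N1[OF elim(4)]]
      have k0: "6 * (5 * C + 3) / \<epsilon> > 0" using C eps by simp
      then have M0: "Mn n > 0" "6 * (5 * C + 3) / \<epsilon> < Mn n" using elim(1) by linarith+
      then have small: "6 * (5 * C + 3) / Mn n < \<epsilon>" using eps by (simp add: pos_divide_less_eq mult.commute)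
      have "\<bar>X n \<omega>\<bar> < \<epsilon>" if w: "\<omega> \<in> space (P n) - B n" for \<omega>
      proof -
        have "Y n \<omega> \<in> carrier_vec (N n)" by (simp add: Y_def fv_def epsv_def nvec_def)
        note am = chat_argmin[OF elim(4) this]
        have "X n \<omega> \<le> 6 * (5 * C + 3) / Mn n"
          unfolding X_def Ieq U_def Y_def epsv_def
        proof (rule contraction_on_good_event[OF gp noise_indep D eigen[unfolded U_def] ab fvc])
          show "\<forall>c\<in>{ln (real (N n)) / real (N n)..real (N n) powr (m - 1)}. s2 (N n) (lam n) c \<le> C * D2R (N n) (lam n) c"
            using elim(2) by (auto simp: Ieq)
          show "D2R (N n) (lam n) (ln (real (N n)) / real (N n)) > 0" using elim(2) ab by (auto simp: Ieq)
          show "chat n (fv n + nvec (N n) (\<lambda>i. eps n i \<omega>)) \<in> {ln (real (N n)) / real (N n)..real (N n) powr (m - 1)}"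
            using am by (auto simp: is_arg_min_def Ieq Y_def epsv_def)
          show "\<forall>c\<in>{ln (real (N n)) / real (N n)..real (N n) powr (m - 1)}.
             risk_criterion (N n) (cov_mat MW W (N n) (x n)) (fv n + nvec (N n) (\<lambda>i. eps n i \<omega>)) (chat n (fv n + nvec (N n) (\<lambda>i. eps n i \<omega>)))
             \<le> risk_criterion (N n) (cov_mat MW W (N n) (x n)) (fv n + nvec (N n) (\<lambda>i. eps n i \<omega>)) c"
            using am by (auto simp: is_arg_min_def Ieq Y_def epsv_def U_def not_less)
          show "\<forall>c\<in>{ln (real (N n)) / real (N n)..real (N n) powr (m - 1)}.
            \<bar>R1R (N n) (lam n) (\<lambda>j. fv n \<bullet> e n j) (\<lambda>j. nvec (N n) (\<lambda>i. eps n i \<omega>) \<bullet> e n j) c\<bar>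
             + \<bar>R2R (N n) (lam n) (\<lambda>j. nvec (N n) (\<lambda>i. eps n i \<omega>) \<bullet> e n j) c\<bar>
            \<le> DR (N n) (lam n) (\<lambda>j. fv n \<bullet> e n j) c / 2"
            using elim(3) w unfolding Bad_def Ieq g_def Z_def epsv_def by blast
        qed (use C M0 in auto)
        moreover have "X n \<omega> \<ge> 0" by (simp add: X_def)
        ultimately show ?thesis using small by simp
      qed
      \<comment> \<open>Monotonicity of \<open>measure\<close> asks for measurability of the larger
        set \<open>B n\<close>.\<close>
      then have "{\<omega> \<in> space (P n). \<bar>X n \<omega>\<bar> \<ge> \<epsilon>} \<subseteq> B n" by (auto simp: not_less[symmetric])
      then show ?case using elim(3) by (intro finite_measure_mono) auto
    qed
  qed (use B0 in auto)
  then show ?thesis unfolding tendsto_zero_in_prob_def X_def by blast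
qed

end
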